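(* Let $X$ be a strictly unbounded toric symplectic $4$-manifold with moment polytope $P=\{x\in\mathbb R^2:\ell_i(x)=\langle x,\nu_i\rangle+\lambda_i\ge0,\ i=1,\dots,d\}$, $\nu_i=(\alpha_i,\beta_i)$. Let $J=\{j_1,\dots,j_m\}\subset\{1,\dots,d\}$ with $1\le j_1<\dots<j_m\le d$, and let $D_i$ be the torus-invariant divisor corresponding to the edge $\ell_{j_i}=0$, $i=1,\dots,m$. For each $j\in J$ fix a cone angle $2\pi\theta_j$ with $\theta_j\in(0,1)$, and write $\theta=(\theta_{j_1},\dots,\theta_{j_m})$. Set $(\alpha_i',\beta_i')=(\alpha_i,\beta_i)$ if $i\notin J$ and $(\alpha_i',\beta_i')=\big(\frac{\alpha_i}{\theta_i},\frac{\beta_i}{\theta_i}\big)$ if $i\in J$. Let $\nu=(\alpha,\beta)\in\mathbb R^2$ satisfy $\det(\nu,\nu_1)\ge0$ and $\det(\nu,\nu_d)\ge0$. Then there are real numbers $a_1^{(\theta)},\dots,a_{d-1}^{(\theta)}$ determined by $P$ and $\theta$ such that, setting for $H\in\mathbb R$, $r>0$, $$\xi_1=\alpha_1'\log r+\frac12\sum_{i=1}^{d-1}(\alpha_{i+1}'-\alpha_i')\log\Big(H+a_i^{(\theta)}+\sqrt{(H+a_i^{(\theta)})^2+r^2}\Big)+\alpha H,$$ $$\xi_2=\beta_1'\log r+\frac12\sum_{i=1}^{d-1}(\beta_{i+1}'-\beta_i')\log\Big(H+a_i^{(\theta)}+\sqrt{(H+a_i^{(\theta)})^2+r^2}\Big)+\beta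 H,$$ and letting $x_1,x_2$ be primitives (with suitable constants of integration) of $$\epsilon_1=r\Big(\frac{\partial\xi_2}{\partial r}dH-\frac{\partial\xi_2}{\partial H}dr\Big),\qquad\epsilon_2=-r\Big(\frac{\partial\xi_1}{\partial r}dH-\frac{\partial\xi_1}{\partial H}dr\Big),$$ the functions $x_1,x_2$ define the momentum action coordinates on $P^\circ$ of some conical toric scalar-flat Kähler metric on $X$ whose cone angle along $D_i$ is $2\pi\theta_{j_i}$ for $i=1,\dots,m$, and whose symplectic potential $u$ satisfies $du=\xi_1dx_1+\xi_2dx_2$.
   Context: Notation: $\det(v,w)=v_1w_2-v_2w_1$. A toric symplectic $4$-manifold is a symplectic $4$-manifold $(X,\omega)$ with an effective Hamiltonian $\mathbb T^2$-action whose moment map is proper onto its image $P$. The $\nu_i\in\mathbb Z^2$ are primitive interior normals of the edges, ordered so that the edges $\ell_1=0$ and $\ell_d=0$ are unbounded, consecutive edges meet, and $\det(\nu_i,\nu_{i+1})=-1$ for $1\le i\le d-1$. $X$ is strictly unbounded if $P$ is unbounded with finitely many edges and its two unbounded edges are not parallel. A toric Kähler metric is, on $P^\circ$ with action-angle coordinates $(x,\theta)$, $\omega=\sum dx_i\wedge d\theta_i$, of the form $g=\sum_{i,j}(u_{ij}dx_idx_j+u^{ij}d\theta_id\theta_j)$, with symplectic potential $u$, $(u_{ij})=\mathrm{Hess}\,u>0$, $(u^{ij})=(u_{ij})^{-1}$; it is scalar-flat iff $\sum\partial^2u^{ij}/\partial x_i\partial x_j=0$. That $x_1,x_2$ define momentum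 action coordinates on $P^\circ$ means that $(H,r)\mapsto(x_1,x_2)$ is a diffeomorphism of $\{r>0\}$ onto $P^\circ$ and $x$ are the action coordinates of the metric. The metric is smooth across the divisor of an edge $\ell_i=0$ when $u-\frac12\ell_i\log\ell_i$ is smooth there (Guillemin boundary condition), and has conical singularity with cone angle $2\pi\theta_0$ along the divisor of the edge $\ell=0$ when $u=\frac1{2\theta_0}\ell\log\ell+{}$a smooth function near that edge (at corners the corresponding terms of the two adjacent edges are added). *)

theory Defs
  imports "HOL-Analysis.Analysis"
begin

section \<open>Smooth maps on open sets\<close>

primrec Ck_on :: "nat \<Rightarrow> 'a::real_normed_vector set \<Rightarrow> ('a \<Rightarrow> 'b::real_normed_vector) \<Rightarrow> bool" where
  "Ck_on 0 S f \<longleftrightarrow> continuous_on S f"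
| "Ck_on (Suc k) S f \<longleftrightarrow> (\<forall>x\<in>S. f differentiable (at x)) \<and>
     (\<forall>v. Ck_on k S (\<lambda>x. frechet_derivative f (at x) v))"

text \<open>Only meant for open S; the values of f outside S are then irrelevant.\<close>

definition smooth_on :: "'a::real_normed_vector set \<Rightarrow> ('a \<Rightarrow> 'b::real_normed_vector) \<Rightarrow> bool" where
  "smooth_on S f \<longleftrightarrow> (\<forall>k. Ck_on k S f)"

definition diffeomorphism_betw ::
  "('a::real_normed_vector \<Rightarrow> 'b::real_normed_vector) \<Rightarrow> 'a set \<Rightarrow> 'b set \<Rightarrow> bool" where
  "diffeomorphism_betw f S T \<longleftrightarrow>
     bij_betw f S T \<and> smooth_on S f \<and> smooth_on T (inv_into S f)"

section \<open>Strictly unbounded moment polygons\<close>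

definition det2 :: "real^2 \<Rightarrow> real^2 \<Rightarrow> real" where
  "det2 v w = v$1 * w$2 - v$2 * w$1"

definition normal :: "(nat \<Rightarrow> int) \<Rightarrow> (nat \<Rightarrow> int) \<Rightarrow> nat \<Rightarrow> real^2" where
  "normal \<alpha> \<beta> i = vector [of_int (\<alpha> i), of_int (\<beta> i)]"

definition ell :: "(nat \<Rightarrow> int) \<Rightarrow> (nat \<Rightarrow> int) \<Rightarrow> (nat \<Rightarrow> real) \<Rightarrow> nat \<Rightarrow> real^2 \<Rightarrow> real" where
  "ell \<alpha> \<beta> lam i x = x \<bullet> normal \<alpha> \<beta> i + lam i"

definition polygon ::
  "nat \<Rightarrow> (nat \<Rightarrow> int) \<Rightarrow> (nat \<Rightarrow> int) \<Rightarrow> (nat \<Rightarrow> real) \<Rightarrow> (real^2) set" where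
  "polygon d \<alpha> \<beta> lam = {x. \<forall>i\<in>{1..d}. 0 \<le> ell \<alpha> \<beta> lam i x}"

definition edge ::
  "nat \<Rightarrow> (nat \<Rightarrow> int) \<Rightarrow> (nat \<Rightarrow> int) \<Rightarrow> (nat \<Rightarrow> real) \<Rightarrow> nat \<Rightarrow> (real^2) set" where
  "edge d \<alpha> \<beta> lam i = {x \<in> polygon d \<alpha> \<beta> lam. ell \<alpha> \<beta> lam i x = 0}"

text \<open>A strictly unbounded toric symplectic 4-manifold is represented by its labelled moment
  polygon. The integrality, primitivity and determinant conditions are the Delzant condition; the
  facet condition says that none of the d inequalities is redundant.\<close>

definition strictly_unbounded_polygon ::
  "nat \<Rightarrow> (nat \<Rightarrow> int) \<Rightarrow> (nat \<Rightarrow> int) \<Rightarrow> (nat \<Rightarrow> real) \<Rightarrow> bool" where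
  "strictly_unbounded_polygon d \<alpha> \<beta> lam \<longleftrightarrow>
     2 \<le> d \<and>
     interior (polygon d \<alpha> \<beta> lam) \<noteq> {} \<and>
     (\<forall>i\<in>{1..d}. coprime (\<alpha> i) (\<beta> i)) \<and>
     (\<forall>i\<in>{1..d}. edge d \<alpha> \<beta> lam i facet_of polygon d \<alpha> \<beta> lam) \<and>
     inj_on (edge d \<alpha> \<beta> lam) {1..d} \<and>
     (\<forall>i\<in>{1..d}. \<not> bounded (edge d \<alpha> \<beta> lam i) \<longleftrightarrow> i = 1 \<or> i = d) \<and>
     (\<forall>i\<in>{1..<d}. edge d \<alpha> \<beta> lam i \<inter> edge d \<alpha> \<beta> lam (Suc i) \<noteq> {}) \<and>
     (\<forall>i\<in>{1..<d}. det2 (normal \<alpha> \<beta> i) (normal \<alpha> \<beta> (Suc i)) = -1) \<and>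
     det2 (normal \<alpha> \<beta> 1) (normal \<alpha> \<beta> d) \<noteq> 0"

section \<open>Toric Kaehler metrics in action-angle coordinates\<close>

definition partial :: "2 \<Rightarrow> (real^2 \<Rightarrow> real) \<Rightarrow> real^2 \<Rightarrow> real" where
  "partial i f x = frechet_derivative f (at x) (axis i 1)"

definition hessian :: "(real^2 \<Rightarrow> real) \<Rightarrow> real^2 \<Rightarrow> real^2^2" where
  "hessian u x = (\<chi> i j. partial i (partial j u) x)"

definition pos_def_matrix :: "real^2^2 \<Rightarrow> bool" where
  "pos_def_matrix A \<longleftrightarrow> transpose A = A \<and> (\<forall>v. v \<noteq> 0 \<longrightarrow> 0 < v \<bullet> (A *v v))"

text \<open>A point of the open orbit is a pair (x, t) of action and angle coordinates, the angles being
  lifted to the plane; a tangent vector is a pair (dx, dt). A metric is a field of bilinear forms,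
  and (with the symplectic form dx1 dt1 + dx2 dt2) the toric Kaehler ones are those below.\<close>

type_synonym phase = "(real^2) \<times> (real^2)"

definition toric_kaehler_metric ::
  "(real^2) set \<Rightarrow> (phase \<Rightarrow> phase \<Rightarrow> phase \<Rightarrow> real) \<Rightarrow> (real^2 \<Rightarrow> real) \<Rightarrow> bool" where
  "toric_kaehler_metric U g u \<longleftrightarrow>
     smooth_on U u \<and>
     (\<forall>x\<in>U. pos_def_matrix (hessian u x)) \<and>
     (\<forall>x\<in>U. \<forall>t v s w z. g (x, t) (v, s) (w, z) =
        (\<Sum>i\<in>UNIV. \<Sum>j\<in>UNIV. hessian u x $ i $ j * v$i * w$j
           + matrix_inv (hessian u x) $ i $ j * s$i * z$j))"

text \<open>Abreu's equation for the symplectic potential of a toric Kaehler metric.\<close>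

definition scalar_flat :: "(real^2) set \<Rightarrow> (real^2 \<Rightarrow> real) \<Rightarrow> bool" where
  "scalar_flat U u \<longleftrightarrow>
     (\<forall>x\<in>U. (\<Sum>i\<in>UNIV. \<Sum>j\<in>UNIV.
        partial i (partial j (\<lambda>y. matrix_inv (hessian u y) $ i $ j)) x) = 0)"

text \<open>Boundary behaviour of the potential, tested near every point p of the polygon P; the sum
  ranges over the edges through p (none, one, or two at a corner). The cone angle along the divisor
  of the i-th edge is 2 pi c(i), so c(i) = 1 is the smooth (Guillemin) case. The second condition
  expresses that the metric does not degenerate on the divisors, i.e. that it is a metric on the
  whole manifold and not only on the open orbit.\<close>

definition boundary_condition ::
  "nat \<Rightarrow> (nat \<Rightarrow> int) \<Rightarrow> (nat \<Rightarrow> int) \<Rightarrow> (nat \<Rightarrow> real) \<Rightarrow> (nat \<Rightarrow> real) \<Rightarrow> (real^2 \<Rightarrow> real) \<Rightarrow> bool"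
  where
  "boundary_condition d \<alpha> \<beta> lam c u \<longleftrightarrow>
     (let P = polygon d \<alpha> \<beta> lam; L = ell \<alpha> \<beta> lam in
      \<forall>p\<in>P. let E = {i\<in>{1..d}. L i p = 0} in
        (\<exists>V f. open V \<and> p \<in> V \<and> smooth_on V f \<and>
           (\<forall>x\<in>V \<inter> interior P. u x = (\<Sum>i\<in>E. 1 / (2 * c i) * L i x * ln (L i x)) + f x)) \<and>
        (\<exists>\<delta>>0. ((\<lambda>x. det (hessian u x) * (\<Prod>i\<in>E. L i x)) \<longlongrightarrow> \<delta>)
           (at p within interior P)))"

definition conical_toric_scalar_flat_kaehler_metric ::
  "nat \<Rightarrow> (nat \<Rightarrow> int) \<Rightarrow> (nat \<Rightarrow> int) \<Rightarrow> (nat \<Rightarrow> real) \<Rightarrow> (nat \<Rightarrow> real) \<Rightarrow>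
   (phase \<Rightarrow> phase \<Rightarrow> phase \<Rightarrow> real) \<Rightarrow> (real^2 \<Rightarrow> real) \<Rightarrow> bool" where
  "conical_toric_scalar_flat_kaehler_metric d \<alpha> \<beta> lam c g u \<longleftrightarrow>
     toric_kaehler_metric (interior (polygon d \<alpha> \<beta> lam)) g u \<and>
     scalar_flat (interior (polygon d \<alpha> \<beta> lam)) u \<and>
     boundary_condition d \<alpha> \<beta> lam c u"

section \<open>The functions on the half-plane\<close>

definition cone_param :: "nat set \<Rightarrow> (nat \<Rightarrow> real) \<Rightarrow> nat \<Rightarrow> real" where
  "cone_param J \<theta> i = (if i \<in> J then \<theta> i else 1)"

definition cone_scaled :: "nat set \<Rightarrow> (nat \<Rightarrow> real) \<Rightarrow> (nat \<Rightarrow> int) \<Rightarrow> nat \<Rightarrow> real" where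
  "cone_scaled J \<theta> \<gamma> i = (if i \<in> J then of_int (\<gamma> i) / \<theta> i else of_int (\<gamma> i))"

text \<open>Both components of xi have this form, with c the scaled components of the normals and k the
  corresponding component of the extra vector.\<close>

definition xi_fun :: "nat \<Rightarrow> (nat \<Rightarrow> real) \<Rightarrow> (nat \<Rightarrow> real) \<Rightarrow> real \<Rightarrow> real \<Rightarrow> real \<Rightarrow> real" where
  "xi_fun d a c k H r =
     c 1 * ln r
     + 1/2 * (\<Sum>i=1..d-1. (c (i+1) - c i) * ln (H + a i + sqrt ((H + a i)^2 + r^2)))
     + k * H"

definition half_plane :: "(real \<times> real) set" where
  "half_plane = {(H, r). 0 < r}"

text \<open>The 1-form r (f_r dH - f_H dr) at (H, r), applied to the tangent vector (dH, dr).\<close>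

definition star_form :: "(real \<Rightarrow> real \<Rightarrow> real) \<Rightarrow> real \<times> real \<Rightarrow> real \<times> real \<Rightarrow> real" where
  "star_form f = (\<lambda>(H, r) (dH, dr).
     r * (deriv (\<lambda>s. f H s) r * dH - deriv (\<lambda>h. f h r) H * dr))"

end

theory Submission
  imports Defs
begin

text \<open>The numbers \<open>a\<close> are chosen so that the boundary line \<open>r = 0\<close> is mapped onto the boundary of the
  polygon: the differences of consecutive \<open>a\<close> are the lengths of the bounded edges, measured against the
  scaled normals. Writing \<open>H\<^sub>i = H + a i\<close> and \<open>\<rho>\<^sub>i = sqrt (H\<^sub>i\<^sup>2 + r\<^sup>2)\<close>, the points \<open>(H\<^sub>i, r) / \<rho>\<^sub>i\<close> lie on a
  semicircle, and its concavity together with the convexity of the polygon makes the Jacobian of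
  \<open>(\<xi>\<^sub>1, \<xi>\<^sub>2)\<close>, hence that of \<open>x = (x\<^sub>1, x\<^sub>2)\<close>, positive. The map \<open>x\<close> is injective because a coordinate transverse to
  a recession direction increases in H, and along its level sets the coordinate in the recession direction
  increases in r; it is onto the interior of the polygon because it is proper up to \<open>r = 0\<close>. The form
  \<open>\<xi>\<^sub>1 dx\<^sub>1 + \<xi>\<^sub>2 dx\<^sub>2\<close> is closed, so it has a primitive u; the determinant of its Hessian is \<open>1 / r\<^sup>2\<close>, and the
  rows of the inverse Hessian have as divergence twice the rotated gradient of H, which gives Abreu's
  equation. Near a corner the coordinates \<open>\<rho>\<^sub>k + H\<^sub>k\<close> and \<open>\<rho>\<^sub>k - H\<^sub>k\<close> extend x to a local diffeomorphism
  beyond the boundary, and the edge functions are these coordinates times positive smooth functions; so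
  the logarithmic terms of the gradient of u are those prescribed by the edges.\<close>

section \<open>Calculus of smooth maps\<close>

text \<open>In cylindrical coordinates H, r of three-space
  \<open>ln (H + a i + radius a i H r)\<close> is the axially symmetric harmonic function of a
  charged half line. So both components of \<xi> are harmonic, and their conjugates, which give x1
  and x2, are explicit (\<open>conj_fun\<close>). Cone angles are absorbed at the outset. For
  \<open>ell = c * L\<close> the term \<open>1 / (2 * c) * ell * ln ell\<close> is
  \<open>1/2 * L * ln L\<close> plus a linear function; a conical metric is thus one with Guillemin
  behaviour for the real normals \<open>(A i, B i)\<close>, which enter the analysis through the
  signs of their determinants and through the corners. The numbers \<open>a\<close> have to be found
  before \<nu> is given. This is possible because \<nu> enters x1 and x2 through multiples of r^2,
  which vanish on the boundary line. As \<nu> may be 0, strict positivity and properness must come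
  from the logarithms alone. The chart at corner k remains valid along all of edge k+1, and for k =
  1 also along the first edge, so one construction serves every boundary point.\<close>

lemma Ck_on_subset: "Ck_on k S f \<Longrightarrow> T \<subseteq> S \<Longrightarrow> Ck_on k T f"
  by (induction k arbitrary: f) (auto intro: continuous_on_subset)

text \<open>On an open set the derivative of g at a point of S depends only on values in S, so the
  induction passes to the derivatives.\<close>

lemma Ck_on_cong:
  assumes "open S" "\<And>x. x \<in> S \<Longrightarrow> f x = g x" "Ck_on k S f"
  shows "Ck_on k S g"
  using assms(2,3)
proof (induction k arbitrary: f g)
  case 0
  then show ?case by (metis Ck_on.simps(1) continuous_on_cong)
next
  case (Suc k)
  have d: "(g has_derivative frechet_derivative f (at x)) (at x)" if "x \<in> S" for x
    by (rule has_derivative_transform_within_open[OF _ \<open>open S\<close> that Suc.prems(1)])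
       (use Suc.prems(2) that frechet_derivative_works in auto)
  have e: "frechet_derivative f (at x) = frechet_derivative g (at x)" if "x \<in> S" for x
    using frechet_derivative_at[OF d[OF that]] .
  have "Ck_on k S (\<lambda>x. frechet_derivative g (at x) v)" for v
    by (rule Suc.IH[of "\<lambda>x. frechet_derivative f (at x) v"]) (use e Suc.prems(2) in auto)
  with d show ?case by (auto simp: differentiable_def)
qed

lemma Ck_on_SucI:
  assumes "open S" "\<And>x. x \<in> S \<Longrightarrow> (f has_derivative f' x) (at x)"
    "\<And>v. Ck_on k S (\<lambda>x. f' x v)"
  shows "Ck_on (Suc k) S f"
  using assms frechet_derivative_at[OF assms(2)]
  by (auto simp: differentiable_def intro!: Ck_on_cong[OF assms(1) _ assms(3)])

lemma Ck_on_SucD: "Ck_on (Suc k) S f \<Longrightarrow> Ck_on k S f"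
proof (induction k arbitrary: f)
  case 0
  then show ?case
    by (auto intro!: continuous_at_imp_continuous_on differentiable_imp_continuous_within)
next
  case (Suc k)
  then show ?case by (metis Ck_on.simps(2))
qed

lemma Ck_on_has_derivative:
  "Ck_on (Suc k) S f \<Longrightarrow> x \<in> S \<Longrightarrow> (f has_derivative frechet_derivative f (at x)) (at x)"
  using frechet_derivative_works by auto

lemma Ck_on_const: "Ck_on k S (\<lambda>x. c)"
  by (induction k arbitrary: c) (auto simp: frechet_derivative_const)

lemma Ck_on_bounded_linear:
  assumes "bounded_linear h" "open S" "Ck_on k S f"
  shows "Ck_on k S (\<lambda>x. h (f x))"
  using assms(3)
proof (induction k arbitrary: f)
  case 0
  then show ?case by (auto intro: bounded_linear.continuous_on[OF assms(1)])
next
  case (Suc k)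
  show ?case
    by (rule Ck_on_SucI[where f' = "\<lambda>x v. h (frechet_derivative f (at x) v)"])
       (use Suc in \<open>auto intro!: assms bounded_linear.has_derivative[OF assms(1)] Suc.IH
           Ck_on_has_derivative[OF Suc.prems]\<close>)
qed

lemma Ck_on_add:
  assumes "open S" "Ck_on k S f" "Ck_on k S g"
  shows "Ck_on k S (\<lambda>x. f x + g x)"
  using assms(2,3)
proof (induction k arbitrary: f g)
  case 0
  then show ?case by (auto intro: continuous_on_add)
next
  case (Suc k)
  show ?case
    by (rule Ck_on_SucI[where f' = "\<lambda>x v. frechet_derivative f (at x) v + frechet_derivative g (at x) v"])
       (use Suc in \<open>auto intro!: assms has_derivative_add Suc.IH
           Ck_on_has_derivative[OF Suc.prems(1)] Ck_on_has_derivative[OF Suc.prems(2)]\<close>)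
qed

lemma Ck_on_bilinear:
  assumes "bounded_bilinear h" "open S" "Ck_on k S f" "Ck_on k S g"
  shows "Ck_on k S (\<lambda>x. h (f x) (g x))"
  using assms(3,4)
proof (induction k arbitrary: f g)
  case 0
  then show ?case by (auto intro: bounded_bilinear.continuous_on[OF assms(1)])
next
  case (Suc k)
  show ?case
    by (rule Ck_on_SucI[where f' = "\<lambda>x v. h (f x) (frechet_derivative g (at x) v) + h (frechet_derivative f (at x) v) (g x)"])
       (use Suc Ck_on_SucD[OF Suc.prems(1)] Ck_on_SucD[OF Suc.prems(2)]
         in \<open>auto intro!: assms bounded_bilinear.FDERIV[OF assms(1)] Suc.IH Ck_on_add
           Ck_on_has_derivative[OF Suc.prems(1)] Ck_on_has_derivative[OF Suc.prems(2)]\<close>)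
qed

lemma Ck_on_sum:
  assumes "open S" "\<And>i. i \<in> I \<Longrightarrow> Ck_on k S (f i)"
  shows "Ck_on k S (\<lambda>x. \<Sum>i\<in>I. f i x)"
  using assms(2)
  by (induction I rule: infinite_finite_induct) (auto intro: Ck_on_const Ck_on_add assms(1))

lemma Ck_on_compose:
  fixes f :: "'b::euclidean_space \<Rightarrow> 'c::real_normed_vector"
  assumes "open S" "open T" "Ck_on k T f" "Ck_on k S g" "g ` S \<subseteq> T"
  shows "Ck_on k S (\<lambda>x. f (g x))"
  using assms(3,4)
proof (induction k arbitrary: f)
  case 0
  then show ?case using continuous_on_compose2 assms(5) by auto
next
  case (Suc k)
  note f' = Ck_on_has_derivative[OF Suc.prems(1)] and g' = Ck_on_has_derivative[OF Suc.prems(2)]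
  have gk: "Ck_on k S g" using Suc.prems(2) by (rule Ck_on_SucD)
  let ?D = "\<lambda>x v. frechet_derivative f (at (g x)) (frechet_derivative g (at x) v)"
  \<comment> \<open>The direction fed to the outer derivative varies with x. Expanded in a basis,
    only derivatives in fixed directions remain, and to these the induction hypothesis
    applies.\<close>
  have D: "?D x v = (\<Sum>b\<in>Basis. (frechet_derivative g (at x) v \<bullet> b) *\<^sub>R frechet_derivative f (at (g x)) b)"
    if "x \<in> S" for x v
  proof -
    interpret bounded_linear "frechet_derivative f (at (g x))"
      using f'[of "g x"] that assms(5) has_derivative_bounded_linear by blast
    have "?D x v = frechet_derivative f (at (g x)) (\<Sum>b\<in>Basis. (frechet_derivative g (at x) v \<bullet> b) *\<^sub>R b)"
      by (simp add: euclidean_representation)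
    then show ?thesis by (simp add: sum scaleR)
  qed
  have "Ck_on k S (\<lambda>x. ?D x v)" for v
    by (rule Ck_on_cong[OF assms(1) D[symmetric]], assumption)
       (use Suc.prems gk in \<open>auto intro!: assms(1) Ck_on_sum Ck_on_bilinear[OF bounded_bilinear_scaleR]
         Ck_on_bounded_linear[OF bounded_linear_inner_left] Suc.IH\<close>)
  moreover have "((\<lambda>x. f (g x)) has_derivative ?D x) (at x)" if "x \<in> S" for x
    using diff_chain_at[OF g'[OF that] f'[of "g x"]] that assms(5) by (auto simp: o_def)
  ultimately show ?case by (intro Ck_on_SucI[where f' = ?D] assms(1))
qed

lemma smooth_on_subset: "smooth_on S f \<Longrightarrow> T \<subseteq> S \<Longrightarrow> smooth_on T f"
  by (auto simp: smooth_on_def intro: Ck_on_subset)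

lemma smooth_on_cong:
  "open S \<Longrightarrow> smooth_on S f \<Longrightarrow> (\<And>x. x \<in> S \<Longrightarrow> f x = g x) \<Longrightarrow> smooth_on S g"
  unfolding smooth_on_def using Ck_on_cong by blast

lemma smooth_on_has_derivative:
  "smooth_on S f \<Longrightarrow> x \<in> S \<Longrightarrow> (f has_derivative frechet_derivative f (at x)) (at x)"
  unfolding smooth_on_def using Ck_on_has_derivative by blast

lemma smooth_on_frechet: "smooth_on S f \<Longrightarrow> smooth_on S (\<lambda>x. frechet_derivative f (at x) v)"
  unfolding smooth_on_def
proof
  fix k assume "\<forall>k. Ck_on k S f"
  then have "Ck_on (Suc k) S f" by blast
  then show "Ck_on k S (\<lambda>x. frechet_derivative f (at x) v)" by simp
qed

lemma smooth_on_imp_continuous_on: "smooth_on S f \<Longrightarrow> continuous_on S f"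
proof -
  assume "smooth_on S f"
  then have "Ck_on 0 S f" unfolding smooth_on_def by blast
  then show ?thesis by simp
qed

lemma smooth_onI:
  assumes "open S" "\<And>x. x \<in> S \<Longrightarrow> (f has_derivative f' x) (at x)"
    "\<And>v. smooth_on S (\<lambda>x. f' x v)"
  shows "smooth_on S f"
  using Ck_on_SucI[OF assms(1,2)] Ck_on_SucD assms(3) unfolding smooth_on_def by blast

lemma smooth_on_const: "smooth_on S (\<lambda>x. c)"
  by (simp add: smooth_on_def Ck_on_const)

lemma smooth_on_linear_compose:
  "bounded_linear h \<Longrightarrow> open S \<Longrightarrow> smooth_on S f \<Longrightarrow> smooth_on S (\<lambda>x. h (f x))"
  by (simp add: smooth_on_def Ck_on_bounded_linear)

lemma smooth_on_linear: "bounded_linear h \<Longrightarrow> open S \<Longrightarrow> smooth_on S h"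
  by (rule smooth_onI[where f' = "\<lambda>_. h"])
     (auto intro: smooth_on_const bounded_linear.has_derivative has_derivative_ident
        bounded_linear_imp_has_derivative)

lemma smooth_on_add:
  "open S \<Longrightarrow> smooth_on S f \<Longrightarrow> smooth_on S g \<Longrightarrow> smooth_on S (\<lambda>x. f x + g x)"
  by (simp add: smooth_on_def Ck_on_add)

lemma smooth_on_minus: "open S \<Longrightarrow> smooth_on S f \<Longrightarrow> smooth_on S (\<lambda>x. - f x)"
  by (rule smooth_on_linear_compose[OF bounded_linear_minus[OF bounded_linear_ident]])

lemma smooth_on_diff:
  "open S \<Longrightarrow> smooth_on S f \<Longrightarrow> smooth_on S g \<Longrightarrow> smooth_on S (\<lambda>x. f x - g x)"
  using smooth_on_add[OF _ _ smooth_on_minus] by fastforce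

lemma smooth_on_bilinear:
  "bounded_bilinear h \<Longrightarrow> open S \<Longrightarrow> smooth_on S f \<Longrightarrow> smooth_on S g
    \<Longrightarrow> smooth_on S (\<lambda>x. h (f x) (g x))"
  by (simp add: smooth_on_def Ck_on_bilinear)

lemma smooth_on_mult:
  fixes f g :: "'a::real_normed_vector \<Rightarrow> real"
  shows "open S \<Longrightarrow> smooth_on S f \<Longrightarrow> smooth_on S g \<Longrightarrow> smooth_on S (\<lambda>x. f x * g x)"
  by (rule smooth_on_bilinear[OF bounded_bilinear_mult])

lemma smooth_on_power:
  fixes f :: "'a::real_normed_vector \<Rightarrow> real"
  shows "open S \<Longrightarrow> smooth_on S f \<Longrightarrow> smooth_on S (\<lambda>x. f x ^ n)"
  by (induction n) (auto intro: smooth_on_const smooth_on_mult)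

lemma smooth_on_scaleR:
  "open S \<Longrightarrow> smooth_on S f \<Longrightarrow> smooth_on S g \<Longrightarrow> smooth_on S (\<lambda>x. f x *\<^sub>R g x)"
  by (rule smooth_on_bilinear[OF bounded_bilinear_scaleR])

lemma smooth_on_sum:
  "open S \<Longrightarrow> (\<And>i. i \<in> I \<Longrightarrow> smooth_on S (f i)) \<Longrightarrow> smooth_on S (\<lambda>x. \<Sum>i\<in>I. f i x)"
  by (simp add: smooth_on_def Ck_on_sum)

lemma smooth_on_compose:
  fixes f :: "'b::euclidean_space \<Rightarrow> 'c::real_normed_vector"
  shows "open S \<Longrightarrow> open T \<Longrightarrow> smooth_on T f \<Longrightarrow> smooth_on S g \<Longrightarrow> g ` S \<subseteq> T
    \<Longrightarrow> smooth_on S (\<lambda>x. f (g x))"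
  by (simp add: smooth_on_def Ck_on_compose)

lemma smooth_on_Pair:
  assumes "open S" "smooth_on S f" "smooth_on S g"
  shows "smooth_on S (\<lambda>x. (f x, g x))"
proof -
  have "smooth_on S (\<lambda>x. (f x, 0))" "smooth_on S (\<lambda>x. (0, g x))"
    by (intro smooth_on_linear_compose[of "\<lambda>u. (u, 0)"] smooth_on_linear_compose[of "\<lambda>u. (0, u)"]
        assms bounded_linear_Pair bounded_linear_zero bounded_linear_ident)+
  from smooth_on_add[OF assms(1) this] show ?thesis by simp
qed

text \<open>The derivative is a polynomial in the function itself, so each order of
  differentiability yields the next.\<close>

lemma smooth_on_inverse_real: "smooth_on (- {0}) (inverse :: real \<Rightarrow> real)"
proof -
  have "Ck_on k (- {0}) (inverse :: real \<Rightarrow> real)" for k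
  proof (induction k)
    case 0
    then show ?case by (auto intro!: continuous_on_inverse)
  next
    case (Suc k)
    show ?case
      by (rule Ck_on_SucI[where f' = "\<lambda>x v. - (inverse x * v * inverse x)"])
         (auto intro!: Suc Ck_on_bounded_linear[OF bounded_linear_minus[OF bounded_linear_ident]] Ck_on_bilinear[OF bounded_bilinear_mult]
           Ck_on_const bounded_linear_intros has_derivative_inverse')
  qed
  then show ?thesis by (simp add: smooth_on_def)
qed

lemma smooth_on_inverse:
  fixes f :: "'a::real_normed_vector \<Rightarrow> real"
  assumes "open S" "smooth_on S f" "\<And>x. x \<in> S \<Longrightarrow> f x \<noteq> 0"
  shows "smooth_on S (\<lambda>x. inverse (f x))"
  by (rule smooth_on_compose[OF assms(1) _ smooth_on_inverse_real assms(2)]) (use assms(3) in auto)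

lemma smooth_on_divide:
  fixes f :: "'a::real_normed_vector \<Rightarrow> real"
  assumes "open S" "smooth_on S f" "smooth_on S g" "\<And>x. x \<in> S \<Longrightarrow> g x \<noteq> 0"
  shows "smooth_on S (\<lambda>x. f x / g x)"
  unfolding divide_inverse by (intro smooth_on_mult smooth_on_inverse assms)

lemma smooth_on_ln:
  fixes f :: "'a::real_normed_vector \<Rightarrow> real"
  assumes "open S" "smooth_on S f" "\<And>x. x \<in> S \<Longrightarrow> 0 < f x"
  shows "smooth_on S (\<lambda>x. ln (f x))"
proof (rule smooth_on_compose[OF assms(1) _ _ assms(2)])
  show "smooth_on {0<..} (ln :: real \<Rightarrow> real)"
    by (rule smooth_onI[where f' = "\<lambda>x v. inverse x * v"])
       (auto intro!: smooth_on_mult smooth_on_const smooth_on_subset[OF smooth_on_inverse_real]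
         derivative_eq_intros simp: divide_inverse)
qed (use assms(3) in auto)

lemma smooth_on_sqrt:
  fixes f :: "'a::real_normed_vector \<Rightarrow> real"
  assumes "open S" "smooth_on S f" "\<And>x. x \<in> S \<Longrightarrow> 0 < f x"
  shows "smooth_on S (\<lambda>x. sqrt (f x))"
proof (rule smooth_on_compose[OF assms(1) _ _ assms(2)])
  have "Ck_on k {0<..} sqrt" for k
  proof (induction k)
    case 0
    then show ?case by (auto intro!: continuous_on_real_sqrt)
  next
    case (Suc k)
    show ?case
    proof (rule Ck_on_SucI[where f' = "\<lambda>x v. (1/2 * v) * inverse (sqrt x)"])
      show "Ck_on k {0<..} (\<lambda>x::real. (1/2 * v) * inverse (sqrt x))" for v
        by (rule Ck_on_bilinear[OF bounded_bilinear_mult _ Ck_on_const])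
           (use smooth_on_inverse_real in \<open>auto simp: smooth_on_def intro!: Ck_on_compose[where T = "- {0}", OF _ _ _ Suc]\<close>)
    qed (auto intro!: derivative_eq_intros simp: divide_simps)
  qed
  then show "smooth_on {0<..} sqrt" by (simp add: smooth_on_def)
qed (use assms(3) in auto)

lemmas smooth_on_intros = smooth_on_const smooth_on_add smooth_on_minus smooth_on_diff smooth_on_mult
  smooth_on_power smooth_on_sum smooth_on_Pair smooth_on_inverse smooth_on_divide smooth_on_ln
  smooth_on_sqrt

text \<open>Bootstrapping: Y is as smooth as its own derivative, which is a smooth function of Y.\<close>

lemma smooth_on_bootstrap:
  fixes Y :: "'a::real_normed_vector \<Rightarrow> 'b::euclidean_space"
  assumes "open T" "open S" "Y ` T \<subseteq> S" "\<And>w. smooth_on S (F w)"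
    "\<And>x. x \<in> T \<Longrightarrow> (Y has_derivative (\<lambda>w. F w (Y x))) (at x)"
  shows "smooth_on T Y"
proof -
  have "Ck_on k T Y" for k
  proof (induction k)
    case 0
    then show ?case
      by (auto intro!: continuous_at_imp_continuous_on has_derivative_continuous[OF assms(5)])
  next
    case (Suc k)
    show ?case
      by (rule Ck_on_SucI[OF assms(1,5)])
         (use assms(4) in \<open>auto simp: smooth_on_def intro!: Ck_on_compose[OF assms(1,2) _ Suc assms(3)]\<close>)
  qed
  then show ?thesis by (simp add: smooth_on_def)
qed

section \<open>Potentials, mixed derivatives and planar inverse functions\<close>

text \<open>Poincare lemma: f is the integral of G along the segment from a fixed point p,
  differentiated under the integral sign.\<close>

lemma convex_primitive:
  fixes G :: "'a::euclidean_space \<Rightarrow> 'a"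
  assumes "open S" "convex S"
    and G: "\<And>x. x \<in> S \<Longrightarrow> (G has_derivative D x) (at x)"
    and D: "\<And>v. continuous_on S (\<lambda>x. D x v)"
    and sym: "\<And>x v w. x \<in> S \<Longrightarrow> D x v \<bullet> w = D x w \<bullet> v"
  obtains f where "\<And>x. x \<in> S \<Longrightarrow> (f has_derivative (\<lambda>v. G x \<bullet> v)) (at x)"
proof (cases "S = {}")
  case True
  then show ?thesis using that by auto
next
  case False
  then obtain p where p: "p \<in> S" by auto
  define c where "c = (\<lambda>x t. p + t *\<^sub>R (x - p))"
  have cS: "c x t \<in> S" if "x \<in> S" "t \<in> {0..1}" for x t
    using convexD_alt[OF assms(2) p that(1), of t] that(2) by (auto simp: c_def algebra_simps)
  have Gc: "continuous_on S G"
    by (auto intro!: continuous_at_imp_continuous_on has_derivative_continuous[OF G])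
  have linD: "linear (D x)" if "x \<in> S" for x
    using G[OF that] has_derivative_linear by blast
  \<comment> \<open>The derivative in x, in direction v, of the integrand
    \<open>G (c x t) \<bullet> (x - p)\<close>.\<close>
  define L where "L = (\<lambda>x t v. t *\<^sub>R D (c x t) v \<bullet> (x - p) + G (c x t) \<bullet> v)"
  have bl: "bounded_linear (L x t)" if "x \<in> S" "t \<in> {0..1}" for x t
  proof -
    have "bounded_linear (D (c x t))"
      using G[OF cS[OF that]] has_derivative_bounded_linear by blast
    then show ?thesis unfolding L_def
      by (intro bounded_linear_add bounded_linear_compose[OF bounded_linear_inner_left]
          bounded_linear_compose[OF bounded_linear_scaleR_right] bounded_linear_inner_right)
  qed
  have cc: "continuous_on (S \<times> {0..1}) (\<lambda>z. c (fst z) (snd z))"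
    unfolding c_def by (intro continuous_intros)
  have Dc: "continuous_on (S \<times> {0..1}) (\<lambda>z. D (c (fst z) (snd z)) v)" for v
    by (rule continuous_on_compose2[OF D cc]) (auto intro: cS)
  have Gc': "continuous_on (S \<times> {0..1}) (\<lambda>z. G (c (fst z) (snd z)))"
    by (rule continuous_on_compose2[OF Gc cc]) (auto intro: cS)
  have LC: "continuous_on (S \<times> {0..1}) (\<lambda>z. L (fst z) (snd z) v)" for v
    unfolding L_def by (intro continuous_intros Dc Gc')
  have LB: "continuous_on (S \<times> {0..1}) (\<lambda>z. Blinfun (L (fst z) (snd z)))"
  proof (rule continuous_on_blinfun_componentwise)
    fix i :: 'a
    show "continuous_on (S \<times> {0..1}) (\<lambda>z. blinfun_apply (Blinfun (L (fst z) (snd z))) i)"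
      by (rule continuous_on_eq[OF LC[of i]]) (auto simp: bounded_linear_Blinfun_apply bl)
  qed
  define f where "f = (\<lambda>x. integral (cbox 0 1) (\<lambda>t. G (c x t) \<bullet> (x - p)))"
  have cont1: "continuous_on (cbox 0 1) (\<lambda>t. h (c x t))" if "continuous_on S h" "x \<in> S"
    for h :: "'a \<Rightarrow> 'a" and x
    by (rule continuous_on_compose2[OF that(1)]) (use that cS in \<open>auto simp: c_def intro!: continuous_intros\<close>)
  have "(f has_derivative (\<lambda>v. G x \<bullet> v)) (at x)" if x: "x \<in> S" for x
  proof -
    have *: "(f has_derivative integral (cbox 0 1) (\<lambda>t. Blinfun (L x t))) (at x within S)"
      unfolding f_def
    proof (rule leibniz_rule[where fx = "\<lambda>x t. Blinfun (L x t)"])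
      fix x and t :: real assume "x \<in> S" and t: "t \<in> cbox 0 1"
      then have t': "t \<in> {0..1}" by auto
      have c1: "((\<lambda>x. c x t) has_derivative (\<lambda>v. t *\<^sub>R v)) (at x within S)"
        unfolding c_def by (auto intro!: derivative_eq_intros)
      have "((\<lambda>x. G (c x t)) has_derivative (\<lambda>v. D (c x t) (t *\<^sub>R v))) (at x within S)"
        using has_derivative_compose[OF c1 G[OF cS[OF \<open>x \<in> S\<close> t']]] .
      then have "((\<lambda>x. G (c x t) \<bullet> (x - p)) has_derivative
          (\<lambda>v. G (c x t) \<bullet> v + D (c x t) (t *\<^sub>R v) \<bullet> (x - p))) (at x within S)"
        by (auto intro!: derivative_eq_intros)
      moreover have "(\<lambda>v. G (c x t) \<bullet> v + D (c x t) (t *\<^sub>R v) \<bullet> (x - p)) = L x t"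
        using linear_scale[OF linD[OF cS[OF \<open>x \<in> S\<close> t']]] by (auto simp: L_def fun_eq_iff)
      ultimately show "((\<lambda>x. G (c x t) \<bullet> (x - p)) has_derivative blinfun_apply (Blinfun (L x t)))
          (at x within S)"
        using bl[OF \<open>x \<in> S\<close> t'] by (simp add: bounded_linear_Blinfun_apply)
    next
      fix x assume "x \<in> S"
      show "(\<lambda>t. G (c x t) \<bullet> (x - p)) integrable_on cbox 0 1"
        by (intro integrable_continuous continuous_intros cont1 Gc \<open>x \<in> S\<close>)
    next
      show "continuous_on (S \<times> cbox 0 1) (\<lambda>(x, t). Blinfun (L x t))"
        using LB by (simp add: case_prod_unfold)
    qed (use x assms in auto)
    have LBx: "continuous_on (cbox 0 1) (\<lambda>t. Blinfun (L x t))"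
      using continuous_on_compose2[OF LB, of "cbox 0 1" "Pair x"] x
      by (force intro: continuous_on_Pair continuous_on_const continuous_on_id)
    have "blinfun_apply (integral (cbox 0 1) (\<lambda>t. Blinfun (L x t))) v = G x \<bullet> v" for v
    proof -
      have "blinfun_apply (integral (cbox 0 1) (\<lambda>t. Blinfun (L x t))) v
        = integral (cbox 0 1) (\<lambda>t. blinfun_apply (Blinfun (L x t)) v)"
        by (intro blinfun_apply_integral integrable_continuous LBx)
      also have "\<dots> = integral {0..1} (\<lambda>t. L x t v)"
        using bl[OF x] by (auto simp: bounded_linear_Blinfun_apply intro!: integral_cong)
      \<comment> \<open>By the symmetry of D the integrand is the t-derivative of
        \<open>t * (G (c x t) \<bullet> v)\<close>.\<close>
      also have "\<dots> = 1 *\<^sub>R (G (c x 1) \<bullet> v) - 0 *\<^sub>R (G (c x 0) \<bullet> v)"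
      proof (intro integral_unique fundamental_theorem_of_calculus)
        fix t :: real assume t: "t \<in> {0..1}"
        note cSt = cS[OF x t]
        have c1: "((\<lambda>t. c x t) has_derivative (\<lambda>s. s *\<^sub>R (x - p))) (at t within {0..1})"
          unfolding c_def by (auto intro!: derivative_eq_intros)
        have g: "((\<lambda>t. G (c x t)) has_derivative (\<lambda>s. D (c x t) (s *\<^sub>R (x - p)))) (at t within {0..1})"
          using has_derivative_compose[OF c1 G[OF cSt]] .
        have "((\<lambda>t. t *\<^sub>R (G (c x t) \<bullet> v)) has_derivative
            (\<lambda>s. t *\<^sub>R (D (c x t) (s *\<^sub>R (x - p)) \<bullet> v) + s *\<^sub>R (G (c x t) \<bullet> v))) (at t within {0..1})"
          using g by (auto intro!: derivative_eq_intros)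
        moreover have "(\<lambda>s. t *\<^sub>R (D (c x t) (s *\<^sub>R (x - p)) \<bullet> v) + s *\<^sub>R (G (c x t) \<bullet> v))
            = (\<lambda>s. s *\<^sub>R L x t v)"
          using sym[OF cSt, of "x - p" v] linear_scale[OF linD[OF cSt]]
          by (simp add: L_def fun_eq_iff distrib_left)
        ultimately show "((\<lambda>t. t *\<^sub>R (G (c x t) \<bullet> v)) has_vector_derivative L x t v) (at t within {0..1})"
          by (simp add: has_vector_derivative_def)
      qed auto
      finally show ?thesis by (simp add: c_def)
    qed
    then have "blinfun_apply (integral (cbox 0 1) (\<lambda>t. Blinfun (L x t))) = (\<lambda>v. G x \<bullet> v)" by blast
    then show ?thesis
      using * by (simp only: at_within_open[OF x assms(1)])
  qed
  then show ?thesis using that by blast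
qed

text \<open>The mean value theorem twice, first for the increment h along v, then for the
  v-derivative q along w. The left side is symmetric in v and w while the right side is not, which
  is what makes mixed derivatives commute.\<close>

lemma second_difference:
  fixes f :: "'a::real_normed_vector \<Rightarrow> real"
  assumes "smooth_on (ball x e) f" "0 < s" "s * (norm v + norm w) < e"
  obtains y where "y \<in> ball x e"
    "f (x + s *\<^sub>R v + s *\<^sub>R w) - f (x + s *\<^sub>R v) - f (x + s *\<^sub>R w) + f x
      = s\<^sup>2 * frechet_derivative (\<lambda>y. frechet_derivative f (at y) v) (at y) w"
proof -
  let ?f' = "\<lambda>y. frechet_derivative f (at y)"
  let ?g = "\<lambda>y. frechet_derivative f (at y) v"
  let ?g' = "\<lambda>y. frechet_derivative (\<lambda>y. frechet_derivative f (at y) v) (at y)"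
  have ball: "x + t *\<^sub>R v + r *\<^sub>R w \<in> ball x e" if "0 \<le> t" "t \<le> s" "0 \<le> r" "r \<le> s" for t r
  proof -
    have "norm (t *\<^sub>R v + r *\<^sub>R w) \<le> t * norm v + r * norm w"
      using norm_triangle_ineq[of "t *\<^sub>R v" "r *\<^sub>R w"] that by simp
    also have "\<dots> \<le> s * norm v + s * norm w"
      using that by (intro add_mono mult_right_mono) auto
    finally show ?thesis
      using assms(3) by (simp add: dist_norm algebra_simps norm_minus_commute)
  qed
  have f': "(f has_derivative ?f' y) (at y)" if "y \<in> ball x e" for y
    using smooth_on_has_derivative[OF assms(1) that] .
  have g': "(?g has_derivative ?g' y) (at y)" if "y \<in> ball x e" for y
    using smooth_on_has_derivative[OF smooth_on_frechet[OF assms(1)] that] .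
  define h where "h = (\<lambda>t. f (x + t *\<^sub>R v + s *\<^sub>R w) - f (x + t *\<^sub>R v))"
  have h: "(h has_derivative (\<lambda>k. k * (?g (x + t *\<^sub>R v + s *\<^sub>R w) - ?g (x + t *\<^sub>R v)))) (at t)"
    if "0 \<le> t" "t \<le> s" for t
  proof -
    have b1: "x + t *\<^sub>R v + s *\<^sub>R w \<in> ball x e" and b2: "x + t *\<^sub>R v \<in> ball x e"
      using ball[of t s] ball[of t 0] that assms(2) by auto
    have 1: "((\<lambda>t. f (x + t *\<^sub>R v + s *\<^sub>R w)) has_derivative (\<lambda>k. ?f' (x + t *\<^sub>R v + s *\<^sub>R w) (k *\<^sub>R v))) (at t)"
      by (rule has_derivative_compose[where g = f and f = "\<lambda>t. x + t *\<^sub>R v + s *\<^sub>R w", OF _ f'[OF b1]]) (auto intro!: derivative_eq_intros)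
    have 2: "((\<lambda>t. f (x + t *\<^sub>R v)) has_derivative (\<lambda>k. ?f' (x + t *\<^sub>R v) (k *\<^sub>R v))) (at t)"
      by (rule has_derivative_compose[where g = f and f = "\<lambda>t. x + t *\<^sub>R v", OF _ f'[OF b2]]) (auto intro!: derivative_eq_intros)
    show ?thesis unfolding h_def
      using has_derivative_diff[OF 1 2] linear_scale[OF has_derivative_linear[OF f'[OF b1]]]
        linear_scale[OF has_derivative_linear[OF f'[OF b2]]]
      by (simp add: algebra_simps)
  qed
  obtain t where t: "0 < t" "t < s" "h s - h 0 = s * (?g (x + t *\<^sub>R v + s *\<^sub>R w) - ?g (x + t *\<^sub>R v))"
    using mvt_simple[OF assms(2), of h "\<lambda>t k. k * (?g (x + t *\<^sub>R v + s *\<^sub>R w) - ?g (x + t *\<^sub>R v))"]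
      h has_derivative_at_withinI by force
  define q where "q = (\<lambda>r. ?g (x + t *\<^sub>R v + r *\<^sub>R w))"
  have q: "(q has_derivative (\<lambda>k. k * ?g' (x + t *\<^sub>R v + r *\<^sub>R w) w)) (at r)"
    if "0 \<le> r" "r \<le> s" for r
  proof -
    have b: "x + t *\<^sub>R v + r *\<^sub>R w \<in> ball x e" using ball t that by auto
    have "((\<lambda>r. ?g (x + t *\<^sub>R v + r *\<^sub>R w)) has_derivative (\<lambda>k. ?g' (x + t *\<^sub>R v + r *\<^sub>R w) (k *\<^sub>R w))) (at r)"
      by (rule has_derivative_compose[where g = ?g and f = "\<lambda>r. x + t *\<^sub>R v + r *\<^sub>R w", OF _ g'[OF b]]) (auto intro!: derivative_eq_intros)
    then show ?thesis unfolding q_def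
      using linear_scale[OF has_derivative_linear[OF g'[OF b]]] by simp
  qed
  obtain r where r: "0 < r" "r < s" "q s - q 0 = s * ?g' (x + t *\<^sub>R v + r *\<^sub>R w) w"
    using mvt_simple[OF assms(2), of q "\<lambda>r k. k * ?g' (x + t *\<^sub>R v + r *\<^sub>R w) w"]
      q has_derivative_at_withinI by force
  show ?thesis
  proof (rule that)
    show "x + t *\<^sub>R v + r *\<^sub>R w \<in> ball x e" using ball t r by auto
    show "f (x + s *\<^sub>R v + s *\<^sub>R w) - f (x + s *\<^sub>R v) - f (x + s *\<^sub>R w) + f x
      = s\<^sup>2 * ?g' (x + t *\<^sub>R v + r *\<^sub>R w) w"
      using t(3) r(3) by (simp add: h_def q_def power2_eq_square algebra_simps)
  qed
qed

text \<open>Both iterated derivatives, taken at points of arbitrarily small balls around x, equal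
  the same second difference divided by \<open>s\<^sup>2\<close>; continuity carries the equality to
  x.\<close>

lemma mixed_derivatives_commute:
  fixes f :: "'a::real_normed_vector \<Rightarrow> real"
  assumes "open S" "smooth_on S f" "x \<in> S"
  shows "frechet_derivative (\<lambda>y. frechet_derivative f (at y) v) (at x) w
    = frechet_derivative (\<lambda>y. frechet_derivative f (at y) w) (at x) v"
proof -
  define A where "A = (\<lambda>v w y. frechet_derivative (\<lambda>y. frechet_derivative f (at y) v) (at y) w)"
  obtain e where e: "e > 0" "ball x e \<subseteq> S" using assms open_contains_ball by blast
  have cont: "isCont (A v w) x" for v w
  proof -
    have "smooth_on S (A v w)" unfolding A_def by (intro smooth_on_frechet assms)
    then show ?thesis
      using assms continuous_on_eq_continuous_at smooth_on_imp_continuous_on by blast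
  qed
  have "\<exists>y z. y \<in> ball x (e / Suc n) \<and> z \<in> ball x (e / Suc n) \<and> A v w y = A w v z" for n
  proof -
    define d where "d = e / Suc n"
    have d: "d > 0" using e by (simp add: d_def)
    have "d \<le> e" using e by (simp add: d_def divide_simps)
    then have sm: "smooth_on (ball x d) f"
      using e smooth_on_subset[OF assms(2), of "ball x d"] subset_ball[of d e x] by blast
    \<comment> \<open>The summand 1 keeps the denominator positive when v and w both vanish.\<close>
    define s where "s = d / (2 * (norm v + norm w + 1))"
    have pos: "0 < 2 * (norm v + norm w + 1)" by (smt (verit) norm_ge_zero)
    have s: "s > 0" unfolding s_def using d pos by simp
    have "s * (norm v + norm w) < d"
    proof -
      have "s * (norm v + norm w) < s * (2 * (norm v + norm w + 1))"
        using s by (intro mult_strict_left_mono) (use pos in auto)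
      also have "\<dots> = d" using pos by (simp add: s_def)
      finally show ?thesis .
    qed
    then have s2: "s * (norm v + norm w) < d" "s * (norm w + norm v) < d" by (auto simp: add.commute)
    obtain y where y: "y \<in> ball x d"
      "f (x + s *\<^sub>R v + s *\<^sub>R w) - f (x + s *\<^sub>R v) - f (x + s *\<^sub>R w) + f x = s\<^sup>2 * A v w y"
      unfolding A_def by (rule second_difference[OF sm s s2(1)])
    obtain z where z: "z \<in> ball x d"
      "f (x + s *\<^sub>R w + s *\<^sub>R v) - f (x + s *\<^sub>R w) - f (x + s *\<^sub>R v) + f x = s\<^sup>2 * A w v z"
      unfolding A_def by (rule second_difference[OF sm s s2(2)])
    have "x + s *\<^sub>R w + s *\<^sub>R v = x + s *\<^sub>R v + s *\<^sub>R w" by simp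
    then have "s\<^sup>2 * A v w y = s\<^sup>2 * A w v z" using y(2) z(2) by (simp add: algebra_simps)
    then have "A v w y = A w v z" using s by simp
    then show ?thesis using s y(1) z(1) unfolding d_def by auto
  qed
  then obtain y z where yz: "\<And>n. y n \<in> ball x (e / Suc n)" "\<And>n. z n \<in> ball x (e / Suc n)"
      "\<And>n. A v w (y n) = A w v (z n)"
    by metis
  have lim: "u \<longlonglongrightarrow> x" if "\<And>n. u n \<in> ball x (e / Suc n)" for u
  proof (rule metric_LIMSEQ_I)
    fix r :: real assume "r > 0"
    have "(\<lambda>n. e * inverse (real (Suc n))) \<longlonglongrightarrow> e * 0"
      by (intro tendsto_intros LIMSEQ_inverse_real_of_nat)
    then obtain N where N: "\<And>n. n \<ge> N \<Longrightarrow> \<bar>e * inverse (real (Suc n))\<bar> < r"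
      using \<open>r > 0\<close> LIMSEQ_D by fastforce
    have "dist (u n) x < r" if "n \<ge> N" for n
    proof -
      have "dist (u n) x < e / Suc n" using \<open>\<And>n. u n \<in> ball x (e / Suc n)\<close>[of n] by (simp add: dist_commute)
      also have "\<dots> = e * inverse (real (Suc n))" by (simp add: divide_inverse)
      also have "\<dots> < r" using N[OF that] by linarith
      finally show ?thesis .
    qed
    then show "\<exists>N. \<forall>n\<ge>N. dist (u n) x < r" by blast
  qed
  have "(\<lambda>n. A v w (y n)) \<longlonglongrightarrow> A v w x"
    using isCont_tendsto_compose[OF cont lim[OF yz(1)]] .
  moreover have "(\<lambda>n. A w v (z n)) \<longlonglongrightarrow> A w v x"
    using isCont_tendsto_compose[OF cont lim[OF yz(2)]] .
  ultimately have "A v w x = A w v x"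
    using LIMSEQ_unique by (simp add: yz(3))
  then show ?thesis by (simp add: A_def)
qed

text \<open>\<open>F w z\<close> is Cramer's rule for the derivative matrix at z. The image is open
  by invariance of domain, and since the derivative of Y is F evaluated at Y, smoothness follows by
  bootstrapping.\<close>

lemma planar_inverse:
  fixes X1 X2 a b c d :: "real \<times> real \<Rightarrow> real" and Y :: "real \<times> real \<Rightarrow> real \<times> real"
  assumes "open S" "\<And>z. z \<in> S \<Longrightarrow> Y (X1 z, X2 z) = z"
    and X1: "\<And>z. z \<in> S \<Longrightarrow> (X1 has_derivative (\<lambda>v. a z * fst v + b z * snd v)) (at z)"
    and X2: "\<And>z. z \<in> S \<Longrightarrow> (X2 has_derivative (\<lambda>v. c z * fst v + d z * snd v)) (at z)"
    and j: "\<And>z. z \<in> S \<Longrightarrow> a z * d z - b z * c z \<noteq> 0"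
    and smooth: "smooth_on S a" "smooth_on S b" "smooth_on S c" "smooth_on S d"
  defines "F \<equiv> \<lambda>w z. ((fst w * d z - snd w * b z) / (a z * d z - b z * c z),
      (snd w * a z - fst w * c z) / (a z * d z - b z * c z))"
  shows "open ((\<lambda>z. (X1 z, X2 z)) ` S)"
    and "\<And>x. x \<in> (\<lambda>z. (X1 z, X2 z)) ` S \<Longrightarrow> (Y has_derivative (\<lambda>w. F w (Y x))) (at x)"
    and "smooth_on ((\<lambda>z. (X1 z, X2 z)) ` S) Y"
proof -
  let ?X = "\<lambda>z. (X1 z, X2 z)"
  have DX: "(?X has_derivative (\<lambda>v. (a z * fst v + b z * snd v, c z * fst v + d z * snd v))) (at z)"
    if "z \<in> S" for z
    by (intro has_derivative_Pair X1 X2 that)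
  have cX: "continuous_on S ?X"
    by (auto intro!: continuous_at_imp_continuous_on has_derivative_continuous[OF DX])
  show op: "open (?X ` S)"
    by (rule invariance_of_domain[OF cX assms(1)]) (rule inj_on_inverseI[where g = Y], simp add: assms(2))
  show DY: "(Y has_derivative (\<lambda>w. F w (Y x))) (at x)" if x: "x \<in> ?X ` S" for x
  proof -
    obtain z where z: "z \<in> S" "x = ?X z" using x by auto
    have eq: "a z * ((p * d z - q * b z) / (a z * d z - b z * c z))
        + b z * ((q * a z - p * c z) / (a z * d z - b z * c z)) = p"
      "c z * ((p * d z - q * b z) / (a z * d z - b z * c z))
        + d z * ((q * a z - p * c z) / (a z * d z - b z * c z)) = q" for p q
      using j[OF z(1)] by (auto simp: divide_simps) (auto simp: algebra_simps)
    have "(Y has_derivative (\<lambda>w. F w z)) (at (?X z))"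
      by (rule has_derivative_inverse_strong[OF assms(1) z(1) cX _ DX[OF z(1)]])
         (use assms(2) eq in \<open>simp_all add: fun_eq_iff F_def\<close>)
    then show ?thesis using assms(2) z by simp
  qed
  show "smooth_on (?X ` S) Y"
  proof (rule smooth_on_bootstrap[OF op assms(1) _ _ DY])
    show "Y ` ?X ` S \<subseteq> S" using assms(2) by auto
    show "smooth_on S (F w)" for w
      unfolding F_def by (intro smooth_on_intros assms smooth j)
  qed
qed

text \<open>Supplies, near a point with invertible derivative, the injectivity from which the left
  inverse of \<open>planar_inverse\<close> is built.\<close>

lemma planar_locally_injective:
  fixes X1 X2 a b c d :: "real \<times> real \<Rightarrow> real"
  assumes "open S" "z0 \<in> S"
    and X1: "\<And>z. z \<in> S \<Longrightarrow> (X1 has_derivative (\<lambda>v. a z * fst v + b z * snd v)) (at z)"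
    and X2: "\<And>z. z \<in> S \<Longrightarrow> (X2 has_derivative (\<lambda>v. c z * fst v + d z * snd v)) (at z)"
    and j: "a z0 * d z0 - b z0 * c z0 \<noteq> 0"
    and cont: "continuous_on S a" "continuous_on S b" "continuous_on S c" "continuous_on S d"
  obtains N where "open N" "z0 \<in> N" "N \<subseteq> S" "inj_on (\<lambda>z. (X1 z, X2 z)) N"
proof -
  define f' where "f' = (\<lambda>z v. (a z * fst v + b z * snd v, c z * fst v + d z * snd v))"
  define g' where "g' = (\<lambda>w. ((fst w * d z0 - snd w * b z0) / (a z0 * d z0 - b z0 * c z0),
      (snd w * a z0 - fst w * c z0) / (a z0 * d z0 - b z0 * c z0)))"
  have DX: "((\<lambda>z. (X1 z, X2 z)) has_derivative f' z) (at z)" if "z \<in> S" for z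
    unfolding f'_def by (intro has_derivative_Pair X1 X2 that)
  have bl: "bounded_linear g'"
    unfolding g'_def divide_inverse
    by (intro bounded_linear_Pair bounded_linear_mult_const bounded_linear_sub
        bounded_linear_fst bounded_linear_snd)
  have comp: "g' \<circ> f' z0 = id"
  proof -
    have "((a z0 * p + b z0 * q) * d z0 - (c z0 * p + d z0 * q) * b z0) / (a z0 * d z0 - b z0 * c z0) = p"
      "((c z0 * p + d z0 * q) * a z0 - (a z0 * p + b z0 * q) * c z0) / (a z0 * d z0 - b z0 * c z0) = q" for p q
      using j by (auto simp: divide_simps) (auto simp: algebra_simps)
    then show ?thesis by (auto simp: fun_eq_iff g'_def f'_def)
  qed
  have "\<exists>k>0. \<forall>x. dist z0 x < k \<longrightarrow> onorm (\<lambda>v. f' x v - f' z0 v) < e" if "e > 0" for e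
  proof -
    \<comment> \<open>The total change of the four matrix entries, which bounds the operator norm of
      the change of the derivative.\<close>
    define h where "h = (\<lambda>z. \<bar>a z - a z0\<bar> + \<bar>b z - b z0\<bar> + \<bar>c z - c z0\<bar> + \<bar>d z - d z0\<bar>)"
    have "isCont a z0" "isCont b z0" "isCont c z0" "isCont d z0"
      using cont assms(1,2) continuous_on_eq_continuous_at by blast+
    then have "isCont h z0" unfolding h_def by (intro continuous_intros)
    then obtain k where k: "k > 0" "\<And>x. dist x z0 < k \<Longrightarrow> dist (h x) (h z0) < e"
      using \<open>e > 0\<close> unfolding continuous_at_eps_delta by blast
    have "onorm (\<lambda>v. f' x v - f' z0 v) \<le> h x" for x
    proof (rule onorm_le)
      fix v :: "real \<times> real"
      obtain p q where v: "v = (p, q)" by (cases v)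
      have pq: "\<bar>p\<bar> \<le> norm v" "\<bar>q\<bar> \<le> norm v"
        using norm_fst_le[of p q] norm_snd_le[of q p] v by auto
      have "norm (f' x v - f' z0 v) = norm ((a x - a z0) * p + (b x - b z0) * q, (c x - c z0) * p + (d x - d z0) * q)"
        by (simp add: f'_def v algebra_simps)
      also have "\<dots> \<le> \<bar>(a x - a z0) * p + (b x - b z0) * q\<bar> + \<bar>(c x - c z0) * p + (d x - d z0) * q\<bar>"
        using norm_Pair_le[of "(a x - a z0) * p + (b x - b z0) * q" "(c x - c z0) * p + (d x - d z0) * q"]
        unfolding real_norm_def .
      also have "\<dots> \<le> (\<bar>a x - a z0\<bar> * \<bar>p\<bar> + \<bar>b x - b z0\<bar> * \<bar>q\<bar>) + (\<bar>c x - c z0\<bar> * \<bar>p\<bar> + \<bar>d x - d z0\<bar> * \<bar>q\<bar>)"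
        by (intro add_mono order.trans[OF abs_triangle_ineq]) (auto simp: abs_mult)
      also have "\<dots> \<le> (\<bar>a x - a z0\<bar> * norm v + \<bar>b x - b z0\<bar> * norm v) + (\<bar>c x - c z0\<bar> * norm v + \<bar>d x - d z0\<bar> * norm v)"
        using pq by (intro add_mono mult_left_mono) auto
      finally show "norm (f' x v - f' z0 v) \<le> h x * norm v"
        by (simp add: h_def algebra_simps)
    qed
    moreover have "h z0 = 0" "h x \<ge> 0" for x by (auto simp: h_def)
    moreover have "h x < e" if "dist z0 x < k" for x
      using k(2)[of x] that \<open>h z0 = 0\<close> by (simp add: dist_commute dist_real_def)
    ultimately have "onorm (\<lambda>v. f' x v - f' z0 v) < e" if "dist z0 x < k" for x
      using that by (meson order.strict_trans1)
    then show ?thesis using k(1) by blast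
  qed
  then show ?thesis
    using has_derivative_locally_injective[OF assms(2,1) bl comp DX, of thesis] that[of "ball z0 _"]
    by auto
qed

section \<open>Summation by parts\<close>

text \<open>The values \<open>z 0\<close> and \<open>z d\<close> do not occur on the left and cancel
  on the right, so they may be prescribed at will; the end values of the nodes below are chosen that
  way.\<close>

lemma sum_by_parts:
  fixes c z :: "nat \<Rightarrow> real"
  assumes "1 \<le> d"
  shows "(\<Sum>i=1..d-1. (c (i+1) - c i) * z i)
    = c d * z d - c 1 * z 0 - (\<Sum>k=1..d. c k * (z k - z (k-1)))"
  using assms
proof (induction d rule: dec_induct)
  case base
  then show ?case by (simp add: algebra_simps)
next
  case (step n)
  have "(\<Sum>i=1..Suc n - 1. (c (i+1) - c i) * z i)
      = (\<Sum>i=1..n-1. (c (i+1) - c i) * z i) + (c (n+1) - c n) * z n"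
    using step(1) by (cases n) auto
  with step show ?case by (simp add: algebra_simps)
qed

text \<open>Summation by parts with \<open>z 0 = 0\<close>: the increments of z are nonnegative, so
  replacing every \<open>D i\<close> with \<open>i \<le> n\<close> by its upper bound
  \<open>- m\<close> lowers the sum. Applied with \<open>D (n+1) = 0\<close>, it leaves
  \<open>m * z n\<close>.\<close>

lemma sum_increments_lower:
  fixes D z :: "nat \<Rightarrow> real"
  assumes "1 \<le> n" "\<And>i. 1 \<le> i \<Longrightarrow> i \<le> n \<Longrightarrow> D i \<le> - m" "0 \<le> z 1"
    "\<And>i. 1 \<le> i \<Longrightarrow> i < n \<Longrightarrow> z i \<le> z (i+1)"
  shows "(D (n+1) + m) * z n \<le> (\<Sum>i=1..n. (D (i+1) - D i) * z i)"
  using assms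
proof (induction n rule: dec_induct)
  case base
  have "(D 2 + m) * z 1 \<le> (D 2 - D 1) * z 1"
    using base(1)[of 1] base(2) by (intro mult_right_mono) auto
  then show ?case by (simp add: numeral_2_eq_2)
next
  case (step n)
  have "(D (n+1) + m) * (z (n+1) - z n) \<le> 0"
    using step(4)[of "n+1"] step(6)[of n] step(1) by (intro mult_nonpos_nonneg) auto
  then show ?case using step by (simp add: algebra_simps)
qed

text \<open>Mirror image for decreasing weights, by induction downward from d; applied with
  \<open>D n = 0\<close>.\<close>

lemma sum_decrements_lower:
  fixes D z :: "nat \<Rightarrow> real"
  assumes "n < d" "\<And>i. n < i \<Longrightarrow> i \<le> d \<Longrightarrow> m \<le> D i" "0 \<le> z (d-1)"
    "\<And>i. n \<le> i \<Longrightarrow> i + 1 < d \<Longrightarrow> z (i+1) \<le> z i"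
  shows "(m - D n) * z n \<le> (\<Sum>i=n..d-1. (D (i+1) - D i) * z i)"
  using assms
proof (induction "d - n" arbitrary: n)
  case 0
  then show ?case by simp
next
  case (Suc k)
  show ?case
  proof (cases "n + 1 = d")
    case True
    then have e: "d - 1 = n" by auto
    have "(m - D n) * z n \<le> (D (n+1) - D n) * z n"
      using Suc(4)[of "n+1"] Suc(5) e True by (intro mult_right_mono) auto
    then show ?thesis unfolding e by simp
  next
    case False
    then have n: "n + 1 < d" using Suc by auto
    have IH: "(m - D (n+1)) * z (n+1) \<le> (\<Sum>i=n+1..d-1. (D (i+1) - D i) * z i)"
      using Suc.prems n Suc(2) by (intro Suc.hyps(1)) auto
    have "0 \<le> (D (n+1) - m) * (z n - z (n+1))"
      using Suc(4)[of "n+1"] Suc(6)[of n] n by (intro mult_nonneg_nonneg) auto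
    moreover have "(\<Sum>i=n..d-1. (D (i+1) - D i) * z i)
        = (D (n+1) - D n) * z n + (\<Sum>i=n+1..d-1. (D (i+1) - D i) * z i)"
      using n by (subst sum.atLeast_Suc_atMost) auto
    ultimately show ?thesis using IH by (simp add: algebra_simps)
  qed
qed

section \<open>The map on the half-plane\<close>

definition radius :: "(nat \<Rightarrow> real) \<Rightarrow> nat \<Rightarrow> real \<Rightarrow> real \<Rightarrow> real" where
  "radius a i H r = sqrt ((H + a i)\<^sup>2 + r\<^sup>2)"

text \<open>A primitive of the star form of the function with the same parameters.\<close>

definition conj_fun :: "nat \<Rightarrow> (nat \<Rightarrow> real) \<Rightarrow> (nat \<Rightarrow> real) \<Rightarrow> real \<Rightarrow> real \<Rightarrow> real \<Rightarrow> real" where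
  "conj_fun d a c n H r = (c 1 + c d) / 2 * H
     - 1/2 * (\<Sum>i=1..d-1. (c (i+1) - c i) * radius a i H r) - n * r\<^sup>2 / 2"

definition xi_H :: "nat \<Rightarrow> (nat \<Rightarrow> real) \<Rightarrow> (nat \<Rightarrow> real) \<Rightarrow> real \<Rightarrow> real \<times> real \<Rightarrow> real" where
  "xi_H d a c n z = n + 1/2 * (\<Sum>i=1..d-1. (c (i+1) - c i) * (1 / radius a i (fst z) (snd z)))"

text \<open>The derivative in the direction of r, multiplied by r.\<close>

definition xi_r :: "nat \<Rightarrow> (nat \<Rightarrow> real) \<Rightarrow> (nat \<Rightarrow> real) \<Rightarrow> real \<times> real \<Rightarrow> real" where
  "xi_r d a c z = (c 1 + c d) / 2
     - 1/2 * (\<Sum>i=1..d-1. (c (i+1) - c i) * ((fst z + a i) / radius a i (fst z) (snd z)))"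

lemma radius_pos: "0 < r \<Longrightarrow> 0 < radius a i H r"
  unfolding radius_def by (intro real_sqrt_gt_zero add_nonneg_pos) auto

lemma radius_abs_le: "\<bar>H + a i\<bar> \<le> radius a i H r"
  unfolding radius_def using real_sqrt_le_mono[of "(H + a i)\<^sup>2" "(H + a i)\<^sup>2 + r\<^sup>2"] by simp

lemma radius_abs_less: "r \<noteq> 0 \<Longrightarrow> \<bar>H + a i\<bar> < radius a i H r"
  unfolding radius_def using real_sqrt_less_mono[of "(H + a i)\<^sup>2" "(H + a i)\<^sup>2 + r\<^sup>2"] by simp

lemma radius_sq: "(radius a i H r)\<^sup>2 = (H + a i)\<^sup>2 + r\<^sup>2"
  unfolding radius_def by (simp add: add_nonneg_nonneg)

lemma radius_0: "radius a i H 0 = \<bar>H + a i\<bar>"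
  by (simp add: radius_def)

lemma radius_has_derivative:
  assumes "0 < snd z"
  shows "((\<lambda>z. radius a i (fst z) (snd z)) has_derivative
    (\<lambda>v. ((fst z + a i) / radius a i (fst z) (snd z)) * fst v
      + (snd z / radius a i (fst z) (snd z)) * snd v)) (at z)"
proof -
  have pos: "0 < (fst z + a i)\<^sup>2 + (snd z)\<^sup>2" using assms by (intro add_nonneg_pos) auto
  show ?thesis unfolding radius_def
    by (rule derivative_eq_intros refl pos | use pos in \<open>auto simp: divide_simps algebra_simps\<close>)+
qed

lemma xi_fun_has_derivative:
  assumes "0 < snd z" and d: "1 \<le> d"
  shows "((\<lambda>z. xi_fun d a c n (fst z) (snd z)) has_derivative
    (\<lambda>v. xi_H d a c n z * fst v + xi_r d a c z / snd z * snd v)) (at z)"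
proof -
  let ?H = "fst z" and ?r = "snd z"
  have ln_der: "((\<lambda>z. ln (fst z + a i + radius a i (fst z) (snd z))) has_derivative
    (\<lambda>v. (1 / radius a i ?H ?r) * fst v
      + ((1 - (?H + a i) / radius a i ?H ?r) / ?r) * snd v)) (at z)" for i
  proof -
    let ?R = "radius a i ?H ?r"
    have R: "0 < ?R" and pos: "0 < ?H + a i + ?R"
      using radius_pos[OF assms(1)] radius_abs_less[of ?r ?H a i] assms by auto
    have sq: "?R * ?R = (?H + a i) * (?H + a i) + ?r * ?r"
      using radius_sq[of a i ?H ?r] by (simp add: power2_eq_square)
    have e1: "inverse (?H + a i + ?R) * (1 + (?H + a i) / ?R) = 1 / ?R"
      using R pos by (simp add: divide_simps)
    \<comment> \<open>Rationalised by means of \<open>(R - h) * (R + h) = r\<^sup>2\<close>.\<close>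
    have e2: "inverse (?H + a i + ?R) * (?r / ?R) = (1 - (?H + a i) / ?R) / ?r"
      using R pos assms sq by (simp add: divide_simps) (simp add: algebra_simps)
    have "((\<lambda>z. ln (fst z + a i + radius a i (fst z) (snd z))) has_derivative
      (\<lambda>v. inverse (?H + a i + ?R) * (fst v + (((?H + a i) / ?R) * fst v + (?r / ?R) * snd v)))) (at z)"
      by (rule derivative_eq_intros radius_has_derivative[OF assms(1)] refl pos
          | use pos in \<open>simp add: divide_inverse mult.commute\<close>)+
    moreover have "inverse (?H + a i + ?R) * (p + (((?H + a i) / ?R) * p + (?r / ?R) * q))
        = (1 / ?R) * p + ((1 - (?H + a i) / ?R) / ?r) * q" for p q
      by (simp only: e1[symmetric] e2[symmetric]) (simp add: algebra_simps)
    ultimately show ?thesis by simp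
  qed
  have ln_snd: "((\<lambda>z. ln (snd z)) has_derivative (\<lambda>v. snd v / ?r)) (at z)"
    using assms(1) by (auto intro!: derivative_eq_intros simp: divide_inverse)
  have "((\<lambda>z. c 1 * ln (snd z)
     + 1/2 * (\<Sum>i=1..d-1. (c (i+1) - c i) * ln (fst z + a i + radius a i (fst z) (snd z)))
     + n * fst z) has_derivative
     (\<lambda>v. c 1 * (snd v / ?r) + 1/2 * (\<Sum>i=1..d-1. (c (i+1) - c i) * ((1 / radius a i ?H ?r) * fst v
      + ((1 - (?H + a i) / radius a i ?H ?r) / ?r) * snd v)) + n * fst v)) (at z)"
    by (intro has_derivative_add has_derivative_mult_right has_derivative_sum ln_der ln_snd
        bounded_linear_imp_has_derivative bounded_linear_fst)
  moreover have "c 1 * (q / ?r) + 1/2 * (\<Sum>i=1..d-1. (c (i+1) - c i) * ((1 / radius a i ?H ?r) * p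
      + ((1 - (?H + a i) / radius a i ?H ?r) / ?r) * q)) + n * p
      = xi_H d a c n z * p + xi_r d a c z / ?r * q" for p q
  proof -
    \<comment> \<open>The constant parts of the r-derivatives telescope to \<open>c d - c 1\<close>;
      half of this added to \<open>c 1\<close> is the mean \<open>(c 1 + c d) / 2\<close> in
      \<open>xi_r\<close>.\<close>
    have tel: "(\<Sum>i=1..d-1. (c (i+1) - c i)) = c d - c 1"
      using sum_by_parts[OF d, of c "\<lambda>_. 1"] by simp
    have alg: "c1 * (q / ?r) + 1/2 * (S1 * p + ((cd - c1) - S2) / ?r * q) + n * p
        = (n + 1/2 * S1) * p + ((c1 + cd) / 2 - 1/2 * S2) / ?r * q" for c1 cd S1 S2
      using assms(1) by (simp add: field_simps)
    have sums: "(\<Sum>i=1..d-1. (c (i+1) - c i) * ((1 / radius a i ?H ?r) * p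
        + ((1 - (?H + a i) / radius a i ?H ?r) / ?r) * q))
      = (\<Sum>i=1..d-1. (c (i+1) - c i) * (1 / radius a i ?H ?r)) * p
        + ((\<Sum>i=1..d-1. (c (i+1) - c i))
          - (\<Sum>i=1..d-1. (c (i+1) - c i) * ((?H + a i) / radius a i ?H ?r))) / ?r * q"
      unfolding sum_distrib_right sum_divide_distrib sum_subtractf[symmetric] sum.distrib[symmetric]
      by (intro sum.cong) (auto simp: algebra_simps diff_divide_distrib add_divide_distrib)
    show ?thesis unfolding xi_H_def xi_r_def sums tel by (rule alg)
  qed
  ultimately show ?thesis
    unfolding xi_fun_def radius_def by (simp only: )
qed

lemma conj_fun_has_derivative:
  assumes "0 < snd z"
  shows "((\<lambda>z. conj_fun d a c n (fst z) (snd z)) has_derivative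
    (\<lambda>v. xi_r d a c z * fst v + (- snd z * xi_H d a c n z) * snd v)) (at z)"
proof -
  let ?H = "fst z" and ?r = "snd z"
  have "((\<lambda>z. conj_fun d a c n (fst z) (snd z)) has_derivative
    (\<lambda>v. (c 1 + c d) / 2 * fst v - 1/2 * (\<Sum>i=1..d-1. (c (i+1) - c i) *
       (((?H + a i) / radius a i ?H ?r) * fst v + (?r / radius a i ?H ?r) * snd v)) - n * ?r * snd v)) (at z)"
    unfolding conj_fun_def
    by (rule derivative_eq_intros radius_has_derivative[OF assms] refl
        | simp add: fun_eq_iff algebra_simps)+
  moreover have "(c 1 + c d) / 2 * p - 1/2 * (\<Sum>i=1..d-1. (c (i+1) - c i) *
       (((?H + a i) / radius a i ?H ?r) * p + (?r / radius a i ?H ?r) * q)) - n * ?r * q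
      = xi_r d a c z * p + (- ?r * xi_H d a c n z) * q" for p q
  proof -
    have "(\<Sum>i=1..d-1. (c (i+1) - c i) *
       (((?H + a i) / radius a i ?H ?r) * p + (?r / radius a i ?H ?r) * q))
      = (\<Sum>i=1..d-1. (c (i+1) - c i) * ((?H + a i) / radius a i ?H ?r)) * p
       + (\<Sum>i=1..d-1. (c (i+1) - c i) * (1 / radius a i ?H ?r)) * ?r * q"
      unfolding sum_distrib_right sum.distrib[symmetric]
      by (intro sum.cong) (auto simp: algebra_simps)
    then show ?thesis unfolding xi_H_def xi_r_def
      by (simp add: algebra_simps)
  qed
  ultimately show ?thesis by simp
qed

lemma star_form_xi_fun:
  assumes "0 < snd z" "1 \<le> d"
  shows "star_form (xi_fun d a c n) z v = xi_r d a c z * fst v + (- snd z * xi_H d a c n z) * snd v"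
proof -
  obtain H r p q where zv: "z = (H, r)" "v = (p, q)" by (metis surj_pair)
  note D = xi_fun_has_derivative[OF assms, of a c n, unfolded zv fst_conv snd_conv]
  have "((\<lambda>s. xi_fun d a c n H s) has_derivative (\<lambda>k. xi_r d a c (H, r) / r * k)) (at r)"
    using has_derivative_compose[OF has_derivative_Pair[OF has_derivative_const has_derivative_ident] D] by simp
  then have 1: "deriv (\<lambda>s. xi_fun d a c n H s) r = xi_r d a c (H, r) / r"
    by (intro DERIV_imp_deriv has_derivative_imp_has_field_derivative) (auto simp: mult.commute)
  have "((\<lambda>h. xi_fun d a c n h r) has_derivative (\<lambda>k. xi_H d a c n (H, r) * k)) (at H)"
    using has_derivative_compose[OF has_derivative_Pair[OF has_derivative_ident has_derivative_const] D] by simp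
  then have 2: "deriv (\<lambda>h. xi_fun d a c n h r) H = xi_H d a c n (H, r)"
    by (intro DERIV_imp_deriv has_derivative_imp_has_field_derivative) (auto simp: mult.commute)
  show ?thesis using assms unfolding star_form_def zv by (simp add: 1 2 algebra_simps)
qed

lemma open_half_plane: "open half_plane"
proof -
  have "half_plane = {z. 0 < snd z}" by (auto simp: half_plane_def)
  moreover have "open {z :: real \<times> real. 0 < snd z}" by (intro open_Collect_less continuous_intros)
  ultimately show ?thesis by simp
qed

lemma half_plane_iff: "z \<in> half_plane \<longleftrightarrow> 0 < snd z"
  by (auto simp: half_plane_def)

lemma radius_nonzero: "z \<in> half_plane \<Longrightarrow> radius a i (fst z) (snd z) \<noteq> 0"
  using radius_pos[of "snd z" a i "fst z"] by (auto simp: half_plane_def)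

lemma smooth_on_fst: "open S \<Longrightarrow> smooth_on S fst" and smooth_on_snd: "open S \<Longrightarrow> smooth_on S snd"
  by (auto intro: smooth_on_linear bounded_linear_fst bounded_linear_snd)

lemma smooth_on_radius: "smooth_on half_plane (\<lambda>z. radius a i (fst z) (snd z))"
  unfolding radius_def
  by (intro smooth_on_intros smooth_on_fst smooth_on_snd open_half_plane)
     (auto simp: half_plane_iff intro: add_nonneg_pos)

lemma smooth_on_xi_H: "smooth_on half_plane (xi_H d a c n)"
  unfolding xi_H_def[abs_def]
  by (intro smooth_on_intros smooth_on_radius open_half_plane)
     (rule radius_nonzero)

lemma smooth_on_xi_r: "smooth_on half_plane (xi_r d a c)"
  unfolding xi_r_def[abs_def]
  by (intro smooth_on_intros smooth_on_radius smooth_on_fst open_half_plane)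
     (rule radius_nonzero)

text \<open>The points \<open>(cos_node i, r * sin_node i)\<close> run clockwise through the upper unit semicircle; the end
  points correspond to \<open>a 0 = -\<infinity>\<close> and \<open>a d = \<infinity>\<close>.\<close>

definition cos_node :: "nat \<Rightarrow> (nat \<Rightarrow> real) \<Rightarrow> real \<times> real \<Rightarrow> nat \<Rightarrow> real" where
  "cos_node d a z i = (if i = 0 then -1 else if i = d then 1 else (fst z + a i) / radius a i (fst z) (snd z))"

definition sin_node :: "nat \<Rightarrow> (nat \<Rightarrow> real) \<Rightarrow> real \<times> real \<Rightarrow> nat \<Rightarrow> real" where
  "sin_node d a z i = (if i = 0 \<or> i = d then 0 else 1 / radius a i (fst z) (snd z))"

text \<open>With the end values -1 and 1 the boundary terms of the summation by parts absorb
  \<open>(c 1 + c d) / 2\<close>. What remains weights each normal with an increment of the cosines,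
  which will be positive.\<close>

lemma xi_r_eq:
  assumes "1 \<le> d"
  shows "xi_r d a c z = 1/2 * (\<Sum>k=1..d. c k * (cos_node d a z k - cos_node d a z (k-1)))"
proof -
  have "(\<Sum>i=1..d-1. (c (i+1) - c i) * ((fst z + a i) / radius a i (fst z) (snd z)))
      = (\<Sum>i=1..d-1. (c (i+1) - c i) * cos_node d a z i)"
    using assms by (intro sum.cong) (auto simp: cos_node_def)
  then show ?thesis
    using assms unfolding xi_r_def sum_by_parts[OF assms]
    by (simp add: cos_node_def algebra_simps)
qed

lemma xi_H_eq:
  assumes "1 \<le> d"
  shows "xi_H d a c n z = n - 1/2 * (\<Sum>k=1..d. c k * (sin_node d a z k - sin_node d a z (k-1)))"
proof -
  have "(\<Sum>i=1..d-1. (c (i+1) - c i) * (1 / radius a i (fst z) (snd z)))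
      = (\<Sum>i=1..d-1. (c (i+1) - c i) * sin_node d a z i)"
    using assms by (intro sum.cong) (auto simp: sin_node_def)
  then show ?thesis
    using assms unfolding xi_H_def sum_by_parts[OF assms]
    by (simp add: sin_node_def algebra_simps)
qed

text \<open>The normals \<open>(A i, B i)\<close> and constants l are real: cone parameters are
  already divided out. q1 and q2 are the constants of integration. The corner conditions send the
  boundary point \<open>H = - a k\<close> to the intersection of the lines k and k+1; at
  \<open>r = 0\<close> the \<nu> term vanishes, hence the 0 in place of n1 and n2.\<close>

locale toric_data =
  fixes d :: nat and A B a l :: "nat \<Rightarrow> real" and n1 n2 q1 q2 :: real
  assumes d: "2 \<le> d"
    and det_neg: "\<And>i j. 1 \<le> i \<Longrightarrow> i < j \<Longrightarrow> j \<le> d \<Longrightarrow> A i * B j - B i * A j < 0"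
    and a_less: "\<And>i j. 1 \<le> i \<Longrightarrow> i < j \<Longrightarrow> j < d \<Longrightarrow> a i < a j"
    and n_det: "\<And>j. 1 \<le> j \<Longrightarrow> j \<le> d \<Longrightarrow> 0 \<le> n1 * B j - n2 * A j"
    and corner1: "\<And>k. 1 \<le> k \<Longrightarrow> k < d \<Longrightarrow>
      A k * (q1 + conj_fun d a B 0 (- a k) 0) + B k * (q2 - conj_fun d a A 0 (- a k) 0) + l k = 0"
    and corner2: "\<And>k. 1 \<le> k \<Longrightarrow> k < d \<Longrightarrow>
      A (k+1) * (q1 + conj_fun d a B 0 (- a k) 0) + B (k+1) * (q2 - conj_fun d a A 0 (- a k) 0) + l (k+1) = 0"
begin

definition X1 :: "real \<times> real \<Rightarrow> real" where "X1 z = q1 + conj_fun d a B n2 (fst z) (snd z)"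
definition X2 :: "real \<times> real \<Rightarrow> real" where "X2 z = q2 - conj_fun d a A n1 (fst z) (snd z)"
definition X :: "real \<times> real \<Rightarrow> real \<times> real" where "X z = (X1 z, X2 z)"

abbreviation "AH \<equiv> xi_H d a A n1"
abbreviation "BH \<equiv> xi_H d a B n2"
abbreviation "Ar \<equiv> xi_r d a A"
abbreviation "Br \<equiv> xi_r d a B"

text \<open>The Jacobian of \<open>(\<xi>\<^sub>1, \<xi>\<^sub>2)\<close>, multiplied by r.\<close>

definition K :: "real \<times> real \<Rightarrow> real" where "K z = AH z * Br z - BH z * Ar z"

definition D :: "nat \<Rightarrow> nat \<Rightarrow> real" where "D i j = A i * B j - B i * A j"

lemma D_neg: "1 \<le> i \<Longrightarrow> i < j \<Longrightarrow> j \<le> d \<Longrightarrow> D i j < 0"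
  unfolding D_def by (rule det_neg)

lemma D_swap: "D i j = - D j i" and D_self [simp]: "D i i = 0"
  by (auto simp: D_def algebra_simps)

lemma d1: "1 \<le> d" using d by simp

section \<open>Nodes on the semicircle and positivity of the Jacobian\<close>

lemma cos_node_less:
  assumes "0 < snd z" "i < j" "j \<le> d"
  shows "cos_node d a z i < cos_node d a z j"
proof -
  define t where "t = (\<lambda>h. h / sqrt (h\<^sup>2 + (snd z)\<^sup>2))"
  have pos: "0 < sqrt (h\<^sup>2 + (snd z)\<^sup>2)" for h
    using assms by (intro real_sqrt_gt_zero add_nonneg_pos) auto
  have abs: "\<bar>h\<bar> < sqrt (h\<^sup>2 + (snd z)\<^sup>2)" for h
    using real_sqrt_less_mono[of "h\<^sup>2" "h\<^sup>2 + (snd z)\<^sup>2"] assms by simp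
  have t1: "-1 < t h" "t h < 1" for h
    using pos[of h] abs[of h] by (auto simp: t_def divide_simps abs_less_iff)
  have mono: "t h < t k" if "h < k" for h k
  proof (rule DERIV_pos_imp_increasing[OF that])
    fix x
    have "0 < x\<^sup>2 + (snd z)\<^sup>2" using assms by (intro add_nonneg_pos) auto
    then have "DERIV t x :> (sqrt (x\<^sup>2 + (snd z)\<^sup>2) - x * (x / sqrt (x\<^sup>2 + (snd z)\<^sup>2))) / (sqrt (x\<^sup>2 + (snd z)\<^sup>2))\<^sup>2"
      unfolding t_def
      by (auto intro!: derivative_eq_intros simp: power2_eq_square divide_simps)
    moreover have "x * x < sqrt (x\<^sup>2 + (snd z)\<^sup>2) * sqrt (x\<^sup>2 + (snd z)\<^sup>2)"
      using assms by (simp add: power2_eq_square)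
    then have "x * (x / sqrt (x\<^sup>2 + (snd z)\<^sup>2)) < sqrt (x\<^sup>2 + (snd z)\<^sup>2)"
      using pos[of x] by (simp add: divide_simps)
    then have "0 < (sqrt (x\<^sup>2 + (snd z)\<^sup>2) - x * (x / sqrt (x\<^sup>2 + (snd z)\<^sup>2))) / (sqrt (x\<^sup>2 + (snd z)\<^sup>2))\<^sup>2"
      using pos[of x] by (intro divide_pos_pos) auto
    ultimately show "\<exists>y. DERIV t x :> y \<and> 0 < y" by blast
  qed
  have c: "cos_node d a z i = (if i = 0 then -1 else if i = d then 1 else t (fst z + a i))" for i
    by (simp add: cos_node_def t_def radius_def)
  show ?thesis using assms(2,3) t1 mono a_less[of i j] by (auto simp: c)
qed

lemma node_circle:
  assumes "0 < snd z" "i \<le> d"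
  shows "(snd z)\<^sup>2 * (sin_node d a z i)\<^sup>2 = 1 - (cos_node d a z i)\<^sup>2"
  using radius_pos[OF assms(1), of a i "fst z"] radius_sq[of a i "fst z" "snd z"]
  by (auto simp: sin_node_def cos_node_def divide_simps)

lemma sin_node_pos: "0 < snd z \<Longrightarrow> 1 \<le> i \<Longrightarrow> i < d \<Longrightarrow> 0 < sin_node d a z i"
  using radius_pos by (auto simp: sin_node_def)

lemma sin_node_nonneg: "0 < snd z \<Longrightarrow> 0 \<le> sin_node d a z i"
  using radius_pos[of "snd z" a i "fst z"] by (auto simp: sin_node_def)

text \<open>The ratio of cosine node to sine node is \<open>H + a i\<close>, which increases with i.
  Cross-multiplication includes the two end nodes, where the sine is 0.\<close>

lemma node_slope:
  assumes z: "0 < snd z" and "i \<le> j" "j \<le> d"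
  shows "cos_node d a z i * sin_node d a z j \<le> cos_node d a z j * sin_node d a z i"
    and "i < j \<Longrightarrow> 1 \<le> i \<Longrightarrow> cos_node d a z i * sin_node d a z j < cos_node d a z j * sin_node d a z i"
proof -
  have c: "cos_node d a z i = (fst z + a i) * sin_node d a z i" if "1 \<le> i" "i < d" for i
    using that by (simp add: cos_node_def sin_node_def)
  have *: "cos_node d a z i * sin_node d a z j < cos_node d a z j * sin_node d a z i"
    if "i < j" "j \<le> d" "1 \<le> i" for i j
  proof (cases "j = d")
    case True
    then show ?thesis using sin_node_pos[OF z, of i] that by (simp add: sin_node_def cos_node_def)
  next
    case False
    have "0 < (a j - a i) * (sin_node d a z i * sin_node d a z j)"
      using that False sin_node_pos[OF z, of i] sin_node_pos[OF z, of j] a_less[of i j]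
      by (intro mult_pos_pos) auto
    then show ?thesis using c[of i] c[of j] that False by (simp add: algebra_simps)
  qed
  show "i < j \<Longrightarrow> 1 \<le> i \<Longrightarrow> cos_node d a z i * sin_node d a z j < cos_node d a z j * sin_node d a z i"
    using * assms by auto
  have "cos_node d a z 0 * sin_node d a z j \<le> cos_node d a z j * sin_node d a z 0" for j
    using sin_node_nonneg[OF z, of j] by (simp add: cos_node_def sin_node_def)
  then show "cos_node d a z i * sin_node d a z j \<le> cos_node d a z j * sin_node d a z i"
    using *[of i j] assms by (cases "i = j"; cases "i = 0") auto
qed

text \<open>Strict concavity of the semicircle.\<close>

lemma node_concave:
  assumes z: "0 < snd z" and jk: "1 \<le> j" "j < k" "k \<le> d"
  defines "s \<equiv> sin_node d a z" and "t \<equiv> cos_node d a z"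
  shows "0 < (s j - s (j-1)) * (t k - t (k-1)) - (s k - s (k-1)) * (t j - t (j-1))"
proof -
  define p where "p = j - 1"
  define m where "m = k - 1"
  have le: "p < j" "j \<le> m" "m < k" using jk by (auto simp: p_def m_def)
  \<comment> \<open>Only the pair j, k is strict: p may be the end node 0, and m may coincide with
    j.\<close>
  have "t p * s m \<le> t m * s p" "t p * s k \<le> t k * s p" "t j * s m \<le> t m * s j" "t j * s k < t k * s j"
    unfolding s_def t_def using le jk by (auto intro!: node_slope[OF z])
  then have 1: "(t j + t p) * (s k + s m) < (t k + t m) * (s j + s p)"
    by (simp add: algebra_simps)
  have tt: "0 < t j - t p" "0 < t k - t m"
    using cos_node_less[OF z] le jk by (auto simp: t_def)
  have ss: "0 < s j + s p" "0 < s k + s m"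
    using sin_node_pos[OF z, of j] sin_node_nonneg[OF z, of p] sin_node_nonneg[OF z, of k]
      sin_node_pos[OF z, of m] le jk by (auto simp: s_def)
  \<comment> \<open>The circle equation trades differences of sines for differences of cosines.
    Multiplied by the positive sums of sines, the determinant of the two chords becomes the
    comparison of slopes of their midpoints.\<close>
  have E1: "(snd z)\<^sup>2 * ((s j - s p) * (s j + s p)) = - ((t j - t p) * (t j + t p))"
    using node_circle[OF z, of j] node_circle[OF z, of p] le jk
    by (simp add: s_def t_def power2_eq_square algebra_simps)
  have E2: "(snd z)\<^sup>2 * ((s k - s m) * (s k + s m)) = - ((t k - t m) * (t k + t m))"
    using node_circle[OF z, of k] node_circle[OF z, of m] le jk
    by (simp add: s_def t_def power2_eq_square algebra_simps)
  have "(snd z)\<^sup>2 * (((s j - s p) * (t k - t m) - (s k - s m) * (t j - t p)) * ((s j + s p) * (s k + s m)))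
     = ((snd z)\<^sup>2 * ((s j - s p) * (s j + s p))) * ((t k - t m) * (s k + s m))
      - ((snd z)\<^sup>2 * ((s k - s m) * (s k + s m))) * ((t j - t p) * (s j + s p))"
    by (simp only: algebra_simps)
  also have "\<dots> = ((t j - t p) * (t k - t m)) * ((t k + t m) * (s j + s p) - (t j + t p) * (s k + s m))"
    unfolding E1 E2 by (simp add: algebra_simps)
  also have "\<dots> > 0" using tt 1 by (intro mult_pos_pos) auto
  finally have "0 < (s j - s p) * (t k - t m) - (s k - s m) * (t j - t p)"
    using zero_less_mult_pos zero_less_mult_pos2 mult_pos_pos[OF ss] z
    by (meson zero_less_power)
  then show ?thesis by (simp add: p_def m_def)
qed

lemma K_pos:
  assumes z: "0 < snd z"
  shows "0 < K z"
proof -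
  define s where "s = (\<lambda>k. sin_node d a z k - sin_node d a z (k-1))"
  define t where "t = (\<lambda>k. cos_node d a z k - cos_node d a z (k-1))"
  have AB: "Ar z = 1/2 * (\<Sum>k=1..d. A k * t k)" "Br z = 1/2 * (\<Sum>k=1..d. B k * t k)"
    "AH z = n1 - 1/2 * (\<Sum>k=1..d. A k * s k)" "BH z = n2 - 1/2 * (\<Sum>k=1..d. B k * s k)"
    by (simp_all add: xi_r_eq[OF d1] xi_H_eq[OF d1] s_def t_def)
  have "K z = 1/2 * (n1 * (\<Sum>k=1..d. B k * t k) - n2 * (\<Sum>k=1..d. A k * t k))
     - 1/4 * ((\<Sum>k=1..d. A k * s k) * (\<Sum>k=1..d. B k * t k) - (\<Sum>k=1..d. B k * s k) * (\<Sum>k=1..d. A k * t k))"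
    unfolding K_def AB by (simp add: algebra_simps)
  also have "n1 * (\<Sum>k=1..d. B k * t k) - n2 * (\<Sum>k=1..d. A k * t k)
     = (\<Sum>k=1..d. (n1 * B k - n2 * A k) * t k)"
    by (simp add: sum_distrib_left sum_subtractf algebra_simps)
  also have "(\<Sum>k=1..d. A k * s k) * (\<Sum>k=1..d. B k * t k) - (\<Sum>k=1..d. B k * s k) * (\<Sum>k=1..d. A k * t k)
     = (\<Sum>j=1..d. \<Sum>k=1..d. D j k * (s j * t k))"
    unfolding sum_product sum_subtractf[symmetric] D_def
    by (intro sum.cong refl) (simp add: algebra_simps)
  \<comment> \<open>D is antisymmetric, so only the antisymmetric part of the weights counts; this
    is minus the determinant of two chords up to order, and its sign is known pair by pair.\<close>
  also have "\<dots> = 1/2 * (\<Sum>j=1..d. \<Sum>k=1..d. D j k * (s j * t k - s k * t j))"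
  proof -
    have "(\<Sum>j=1..d. \<Sum>k=1..d. D j k * (s k * t j)) = (\<Sum>k=1..d. \<Sum>j=1..d. D j k * (s k * t j))"
      by (rule sum.swap)
    also have "\<dots> = - (\<Sum>j=1..d. \<Sum>k=1..d. D j k * (s j * t k))"
      unfolding sum_negf[symmetric] by (intro sum.cong refl, subst D_swap) simp
    finally show ?thesis by (simp add: right_diff_distrib sum_subtractf)
  qed
  finally have K: "K z = 1/2 * (\<Sum>k=1..d. (n1 * B k - n2 * A k) * t k)
     + 1/8 * (\<Sum>j=1..d. \<Sum>k=1..d. - D j k * (s j * t k - s k * t j))"
    by (simp add: sum_negf)
  have lt: "0 < - D j k * (s j * t k - s k * t j)" if "1 \<le> j" "j < k" "k \<le> d" for j k
    using node_concave[OF z that] D_neg[OF that] unfolding s_def t_def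
    by (intro mult_pos_pos) auto
  have nonneg: "0 \<le> - D j k * (s j * t k - s k * t j)" if "j \<in> {1..d}" "k \<in> {1..d}" for j k
  proof (cases j k rule: linorder_cases)
    case greater
    have "- D j k * (s j * t k - s k * t j) = - D k j * (s k * t j - s j * t k)"
      by (subst D_swap) (simp add: algebra_simps)
    then show ?thesis using lt[of k j] that greater by simp
  qed (use lt[of j k] that in auto)
  \<comment> \<open>Strictness comes from the pair (1, 2), available because
    \<open>2 \<le> d\<close>; the \<nu> term contributes only a weak inequality.\<close>
  have "0 < (\<Sum>j=1..d. \<Sum>k=1..d. - D j k * (s j * t k - s k * t j))"
  proof (rule sum_pos2[of _ 1])
    show "0 < (\<Sum>k=1..d. - D 1 k * (s 1 * t k - s k * t 1))"
      by (rule sum_pos2[of _ 2]) (use lt[of 1 2] nonneg d in auto)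
  qed (use nonneg d in \<open>auto intro!: sum_nonneg\<close>)
  moreover have "0 \<le> (\<Sum>k=1..d. (n1 * B k - n2 * A k) * t k)"
  proof (intro sum_nonneg mult_nonneg_nonneg)
    fix k assume "k \<in> {1..d}"
    then show "0 \<le> n1 * B k - n2 * A k" "0 \<le> t k"
      using n_det cos_node_less[OF z, of "k-1" k] by (auto simp: t_def)
  qed
  ultimately show ?thesis unfolding K by linarith
qed

lemma X1_has_derivative: "0 < snd z \<Longrightarrow>
    (X1 has_derivative (\<lambda>v. Br z * fst v + (- snd z * BH z) * snd v)) (at z)"
  unfolding X1_def[abs_def] by (auto intro!: derivative_eq_intros conj_fun_has_derivative)

lemma X2_has_derivative: "0 < snd z \<Longrightarrow>
    (X2 has_derivative (\<lambda>v. (- Ar z) * fst v + (snd z * AH z) * snd v)) (at z)"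
  unfolding X2_def[abs_def] by (auto intro!: derivative_eq_intros conj_fun_has_derivative)

lemma X_jacobian: "Br z * (snd z * AH z) - (- snd z * BH z) * (- Ar z) = snd z * K z"
  by (simp add: K_def algebra_simps)

end

section \<open>Edge functions of the image points\<close>

lemma radius_lipschitz: "\<bar>radius a j H r - radius a i H r\<bar> \<le> \<bar>a j - a i\<bar>"
proof -
  have "radius a j H r - radius a i H r \<le> \<bar>a j - a i\<bar>" for i j
    using real_sqrt_sum_squares_triangle_ineq[of "H + a i" "a j - a i" r 0]
    by (simp add: radius_def)
  from this[of i j] this[of j i] show ?thesis by linarith
qed

lemma sum_split_at:
  fixes f :: "nat \<Rightarrow> real"
  assumes "1 \<le> j" "j \<le> d"
  shows "(\<Sum>i=1..d-1. f i) = (\<Sum>i=1..j-1. f i) + (\<Sum>i=j..d-1. f i)"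
proof -
  have "{1..d-1} = {1..j-1} \<union> {j..d-1}" using assms by auto
  then show ?thesis by (simp add: sum.union_disjoint)
qed

lemma sum_telescope_nat:
  fixes c :: "nat \<Rightarrow> real"
  assumes "1 \<le> j" "j \<le> d"
  shows "(\<Sum>i=1..j-1. c (i+1) - c i) = c j - c 1" "(\<Sum>i=j..d-1. c (i+1) - c i) = c d - c j"
proof -
  show 1: "(\<Sum>i=1..j-1. c (i+1) - c i) = c j - c 1"
    using sum_by_parts[OF assms(1), of c "\<lambda>_. 1"] by simp
  have "(\<Sum>i=1..d-1. c (i+1) - c i) = c d - c 1"
    using sum_by_parts[of d c "\<lambda>_. 1"] assms by simp
  then show "(\<Sum>i=j..d-1. c (i+1) - c i) = c d - c j"
    using 1 sum_split_at[OF assms, of "\<lambda>i. c (i+1) - c i"] by linarith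
qed

context toric_data
begin

lemma a_le: "1 \<le> i \<Longrightarrow> i \<le> j \<Longrightarrow> j < d \<Longrightarrow> a i \<le> a j"
  using a_less[of i j] by (cases "i = j") auto

text \<open>A minimum over finitely many pairs. The uniform constant turns sign conditions into the
  quantitative bounds behind properness.\<close>

lemma D_gap:
  obtains m where "0 < m" "\<And>i j. 1 \<le> i \<Longrightarrow> i < j \<Longrightarrow> j \<le> d \<Longrightarrow> D i j \<le> - m"
proof -
  define S where "S = (\<lambda>p. - D (fst p) (snd p)) ` {p \<in> {1..d} \<times> {1..d}. fst p < snd p}"
  have fin: "finite S" by (auto simp: S_def)
  have "(1, 2) \<in> {p \<in> {1..d} \<times> {1..d}. fst p < snd p}" using d by auto
  then have ne: "S \<noteq> {}" unfolding S_def by blast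
  have "0 < Min S" using Min_in[OF fin ne] D_neg by (auto simp: S_def)
  moreover have "D i j \<le> - Min S" if "1 \<le> i" "i < j" "j \<le> d" for i j
  proof -
    have "- D i j \<in> S" unfolding S_def using that by (intro image_eqI[of _ _ "(i, j)"]) auto
    then show ?thesis using Min_le[OF fin] by fastforce
  qed
  ultimately show ?thesis using that by blast
qed

definition L :: "nat \<Rightarrow> real \<times> real \<Rightarrow> real" where
  "L j p = A j * fst p + B j * snd p + l j"

text \<open>For a node before edge j the radius is completed to \<open>radius + (H + a i)\<close>,
  for the others to \<open>radius - (H + a i)\<close>. All these are nonnegative and vanish at
  \<open>r = 0\<close> on the interval belonging to edge j; the linear terms so introduced telescope
  to the coefficient of H.\<close>

lemma L_X:
  assumes "1 \<le> j" "j \<le> d"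
  shows "L j (X (H, r)) = 1/2 * ((\<Sum>i=1..j-1. (D (i+1) j - D i j) * (radius a i H r + (H + a i)))
      + (\<Sum>i=j..d-1. (D (i+1) j - D i j) * (radius a i H r - (H + a i))))
      + (n1 * B j - n2 * A j) * r\<^sup>2 / 2"
proof -
  define F where "F = (\<lambda>H r. 1/2 * ((\<Sum>i=1..j-1. (D (i+1) j - D i j) * (radius a i H r + (H + a i)))
      + (\<Sum>i=j..d-1. (D (i+1) j - D i j) * (radius a i H r - (H + a i))))
      + (n1 * B j - n2 * A j) * r\<^sup>2 / 2)"
  \<comment> \<open>All that is independent of H and r. It vanishes because F is 0 at a corner of
    edge j, where the corner conditions make \<open>L j\<close> vanish too.\<close>
  define C where "C = A j * q1 + B j * q2 + l j - 1/2 * (\<Sum>i=1..j-1. (D (i+1) j - D i j) * a i)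
      + 1/2 * (\<Sum>i=j..d-1. (D (i+1) j - D i j) * a i)"
  have L: "L j (X (H, r)) = F H r + C" for H r
  proof -
    let ?R = "\<Sum>i=1..d-1. (D (i+1) j - D i j) * radius a i H r"
    have "A j * (\<Sum>i=1..d-1. (B (i+1) - B i) * radius a i H r)
        - B j * (\<Sum>i=1..d-1. (A (i+1) - A i) * radius a i H r) = - ?R"
      unfolding sum_distrib_left sum_subtractf[symmetric] sum_negf[symmetric]
      by (intro sum.cong) (auto simp: D_def algebra_simps)
    then have "L j (X (H, r)) = A j * q1 + B j * q2 + l j - (D 1 j + D d j) / 2 * H + 1/2 * ?R
        + (n1 * B j - n2 * A j) * r\<^sup>2 / 2"
      by (simp add: L_def X_def X1_def X2_def conj_fun_def D_def field_simps)
    also have "?R = (\<Sum>i=1..j-1. (D (i+1) j - D i j) * radius a i H r)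
        + (\<Sum>i=j..d-1. (D (i+1) j - D i j) * radius a i H r)"
      by (rule sum_split_at[OF assms])
    also have "(\<Sum>i=1..j-1. (D (i+1) j - D i j) * radius a i H r)
       = (\<Sum>i=1..j-1. (D (i+1) j - D i j) * (radius a i H r + (H + a i)))
         - (\<Sum>i=1..j-1. D (i+1) j - D i j) * H - (\<Sum>i=1..j-1. (D (i+1) j - D i j) * a i)"
      unfolding sum_distrib_right sum_subtractf[symmetric]
      by (intro sum.cong) (auto simp: algebra_simps)
    also have "(\<Sum>i=j..d-1. (D (i+1) j - D i j) * radius a i H r)
       = (\<Sum>i=j..d-1. (D (i+1) j - D i j) * (radius a i H r - (H + a i)))
         + (\<Sum>i=j..d-1. D (i+1) j - D i j) * H + (\<Sum>i=j..d-1. (D (i+1) j - D i j) * a i)"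
      unfolding sum_distrib_right sum.distrib[symmetric]
      by (intro sum.cong) (auto simp: algebra_simps)
    finally show ?thesis
      unfolding sum_telescope_nat[OF assms, of "\<lambda>i. D i j"] F_def C_def
      by (simp add: field_simps)
  qed
  have conj0: "conj_fun d a c n H 0 = conj_fun d a c 0 H 0" for c n H by (simp add: conj_fun_def)
  have zero: "F (- a k) 0 = 0" if "1 \<le> k" "k < d" "j = k \<or> j = k + 1" for k
  proof -
    have "radius a i (- a k) 0 + (- a k + a i) = 0" if "i \<in> {1..j-1}" for i
      using a_le[of i k] that \<open>1 \<le> k\<close> \<open>k < d\<close> \<open>j = k \<or> j = k + 1\<close> by (auto simp: radius_0)
    moreover have "radius a i (- a k) 0 - (- a k + a i) = 0" if "i \<in> {j..d-1}" for i
      using a_le[of k i] that \<open>1 \<le> k\<close> \<open>k < d\<close> \<open>j = k \<or> j = k + 1\<close> by (auto simp: radius_0)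
    ultimately show ?thesis by (simp add: F_def)
  qed
  have "C = 0"
  proof (cases "j < d")
    case True
    have "L j (X (- a j, 0)) = 0"
      using corner1[of j] True assms by (simp add: L_def X_def X1_def X2_def conj0[of B n2] conj0[of A n1])
    then show ?thesis using L[of "- a j" 0] zero[of j] True assms by simp
  next
    \<comment> \<open>The last edge has no corner of index d; its only corner has index
      \<open>d - 1\<close>.\<close>
    case False
    then have j: "d - 1 + 1 = d" "j = d - 1 + 1" using assms by auto
    have "L j (X (- a (d - 1), 0)) = 0"
      using corner2[of "d - 1"] d unfolding j(1)
      by (simp add: L_def X_def X1_def X2_def conj0[of B n2] conj0[of A n1] j)
    then show ?thesis using L[of "- a (d - 1)" 0] zero[of "d - 1"] j d by simp
  qed
  then show ?thesis using L by (simp add: F_def)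
qed

text \<open>Each of the two sums in \<open>L_X\<close> is bounded by its node next to edge j, of
  index \<open>j - 1\<close> or j; the first and the last edge have only one such node. The \<nu>
  term is nonnegative and is dropped.\<close>

lemma L_X_lower:
  assumes "1 \<le> j" "j \<le> d"
    and m: "0 < m" "\<And>i j. 1 \<le> i \<Longrightarrow> i < j \<Longrightarrow> j \<le> d \<Longrightarrow> D i j \<le> - m"
  shows "m/2 * ((if 1 < j then radius a (j-1) H r + (H + a (j-1)) else 0)
      + (if j < d then radius a j H r - (H + a j) else 0)) \<le> L j (X (H, r))"
proof -
  have nn: "0 \<le> radius a i H r + (H + a i)" "0 \<le> radius a i H r - (H + a i)" for i
    using radius_abs_le[of H a i r] by linarith+
  have lip: "\<bar>radius a (i+1) H r - radius a i H r\<bar> \<le> a (i+1) - a i" if "1 \<le> i" "i + 1 < d" for i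
    using radius_lipschitz[of a "i+1" H r i] a_less[of i "i+1"] that by auto
  have inc: "radius a i H r + (H + a i) \<le> radius a (i+1) H r + (H + a (i+1))"
    and dec: "radius a (i+1) H r - (H + a (i+1)) \<le> radius a i H r - (H + a i)" if "1 \<le> i" "i + 1 < d" for i
    using lip[OF that] by linarith+
  have "m * (if 1 < j then radius a (j-1) H r + (H + a (j-1)) else 0)
      \<le> (\<Sum>i=1..j-1. (D (i+1) j - D i j) * (radius a i H r + (H + a i)))"
  proof (cases "1 < j")
    case True
    have "(D (j-1+1) j + m) * (radius a (j-1) H r + (H + a (j-1)))
      \<le> (\<Sum>i=1..j-1. (D (i+1) j - D i j) * (radius a i H r + (H + a i)))"
      using True assms nn m inc
      by (intro sum_increments_lower[where z = "\<lambda>i. radius a i H r + (H + a i)"]) auto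
    then show ?thesis using True by simp
  qed simp
  moreover have "m * (if j < d then radius a j H r - (H + a j) else 0)
      \<le> (\<Sum>i=j..d-1. (D (i+1) j - D i j) * (radius a i H r - (H + a i)))"
  proof (cases "j < d")
    case True
    have "m \<le> D i j" if "j < i" "i \<le> d" for i
      using m(2)[OF assms(1) that] D_swap[of i j] by linarith
    then have "(m - D j j) * (radius a j H r - (H + a j))
      \<le> (\<Sum>i=j..d-1. (D (i+1) j - D i j) * (radius a i H r - (H + a i)))"
      using True assms nn m dec
      by (intro sum_decrements_lower[where z = "\<lambda>i. radius a i H r - (H + a i)"]) auto
    then show ?thesis using True by simp
  next
    case False
    then have "{j..d-1} = {}" using assms d by auto
    then show ?thesis using False by simp
  qed
  moreover have "0 \<le> (n1 * B j - n2 * A j) * r\<^sup>2 / 2" using n_det assms by simp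
  moreover have "m/2 * (u + v) \<le> 1/2 * (S1 + S2) + w" if "m * u \<le> S1" "m * v \<le> S2" "0 \<le> w"
    for u v w S1 S2 :: real
  proof -
    have "m/2 * (u + v) = (m * u + m * v) / 2" by (simp add: distrib_left add_divide_distrib)
    also have "\<dots> \<le> (S1 + S2) / 2" using that by (intro divide_right_mono add_mono) auto
    also have "\<dots> \<le> 1/2 * (S1 + S2) + w" using that by simp
    finally show ?thesis .
  qed
  ultimately show ?thesis unfolding L_X[OF assms(1,2)] by blast
qed

text \<open>On the line \<open>r = 0\<close> edge j belongs to the interval from
  \<open>- a j\<close> to \<open>- a (j-1)\<close>, unbounded to the right for \<open>j = 1\<close>
  and to the left for \<open>j = d\<close>. Off that interval, or off the line, one of the two terms
  in \<open>L_X_lower\<close> is positive.\<close>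

lemma L_X_pos:
  assumes "1 \<le> j" "j \<le> d"
    and "snd z \<noteq> 0 \<or> (1 < j \<and> 0 < fst z + a (j-1)) \<or> (j < d \<and> fst z + a j < 0)"
  shows "0 < L j (X z)"
proof -
  obtain m where m: "0 < m" "\<And>i j. 1 \<le> i \<Longrightarrow> i < j \<Longrightarrow> j \<le> d \<Longrightarrow> D i j \<le> - m"
    using D_gap by blast
  define h where "h = (\<lambda>i. radius a i (fst z) (snd z) + (fst z + a i))"
  define g where "g = (\<lambda>i. radius a i (fst z) (snd z) - (fst z + a i))"
  have nn: "0 \<le> h i" "0 \<le> g i" for i
    using radius_abs_le[of "fst z" a i "snd z"] unfolding h_def g_def by linarith+
  have h: "0 < h i" if "snd z \<noteq> 0 \<or> 0 < fst z + a i" for i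
    using that radius_abs_le[of "fst z" a i "snd z"] radius_abs_less[of "snd z" "fst z" a i]
    unfolding h_def by linarith
  have g: "0 < g i" if "snd z \<noteq> 0 \<or> fst z + a i < 0" for i
    using that radius_abs_le[of "fst z" a i "snd z"] radius_abs_less[of "snd z" "fst z" a i]
    unfolding g_def by linarith
  have "1 < j \<and> 0 < h (j-1) \<or> j < d \<and> 0 < g j"
    using assms d h[of "j-1"] g[of j] by (cases "1 < j") auto
  then have "0 < (if 1 < j then h (j-1) else 0) + (if j < d then g j else 0)"
    using nn[of "j-1"] nn[of j] by (auto intro: add_pos_nonneg add_nonneg_pos)
  then have "0 < m/2 * ((if 1 < j then h (j-1) else 0) + (if j < d then g j else 0))"
    using m(1) by simp
  also have "\<dots> \<le> L j (X (fst z, snd z))" unfolding h_def g_def by (rule L_X_lower[OF assms(1,2) m])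
  finally show ?thesis by simp
qed

lemma L_X_zero:
  assumes "1 \<le> j" "j \<le> d" "1 < j \<Longrightarrow> H + a (j-1) \<le> 0" "j < d \<Longrightarrow> 0 \<le> H + a j"
  shows "L j (X (H, 0)) = 0"
proof -
  have "radius a i H 0 + (H + a i) = 0" if "i \<in> {1..j-1}" for i
  proof -
    have "H + a i \<le> 0" using a_le[of i "j-1"] that assms by force
    then show ?thesis by (simp add: radius_0)
  qed
  moreover have "radius a i H 0 - (H + a i) = 0" if "i \<in> {j..d-1}" for i
  proof -
    have "0 \<le> H + a i" using a_le[of j i] that assms by force
    then show ?thesis by (simp add: radius_0)
  qed
  ultimately show ?thesis by (simp add: L_X[OF assms(1,2)])
qed

text \<open>As H increases, the index of the edge decreases. Case \<open>edge k\<close> is the open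
  edge k+1, which for \<open>k + 1 = d\<close> is the last unbounded one; the first edge has no
  preceding corner and gets a case of its own.\<close>

lemma boundary_cases:
  obtains (corner) k where "1 \<le> k" "k < d" "H = - a k"
  | (edge) k where "1 \<le> k" "k < d" "H + a k < 0" "k + 1 < d \<Longrightarrow> 0 < H + a (k+1)"
  | (first_edge) "0 < H + a 1"
proof (cases "0 < H + a 1 \<or> (\<exists>k. 1 \<le> k \<and> k < d \<and> H = - a k)")
  case True
  then show ?thesis using that by blast
next
  case False
  then have ne: "H + a k \<noteq> 0" if "1 \<le> k" "k < d" for k using that by (smt (verit))
  define S where "S = {k. 1 \<le> k \<and> k < d \<and> H + a k < 0}"
  have fin: "finite S" unfolding S_def by (rule finite_subset[of _ "{..d}"]) auto
  have "1 \<in> S" using False d ne[of 1] by (auto simp: S_def)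
  then have M: "Max S \<in> S" using fin Max_in by blast
  show ?thesis
  proof (rule edge)
    show "1 \<le> Max S" "Max S < d" "H + a (Max S) < 0" using M by (auto simp: S_def)
    show "0 < H + a (Max S + 1)" if "Max S + 1 < d"
    proof -
      have "Max S + 1 \<notin> S" using Max_ge[OF fin, of "Max S + 1"] by auto
      then show ?thesis using that ne[of "Max S + 1"] by (auto simp: S_def)
    qed
  qed
qed

lemma boundary_on_edge: "\<exists>j. 1 \<le> j \<and> j \<le> d \<and> L j (X (H, 0)) = 0"
proof (cases H rule: boundary_cases)
  case (corner k)
  then show ?thesis using a_le[of "k-1" k] by (intro exI[of _ k]) (auto intro!: L_X_zero)
next
  case (edge k)
  then show ?thesis by (intro exI[of _ "k+1"]) (auto intro!: L_X_zero)
next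
  case first_edge
  then show ?thesis using d by (intro exI[of _ 1]) (auto intro!: L_X_zero)
qed

section \<open>The map is a bijection onto the interior of the polygon\<close>

text \<open>\<open>(e1, e2)\<close> is the sum of \<open>(B 1, - A 1)\<close> and
  \<open>(- B d, A d)\<close>, the directions in which the two unbounded edges run to
  infinity.\<close>

definition e1 :: real where "e1 = B 1 - B d"
definition e2 :: real where "e2 = A d - A 1"
definition E :: "nat \<Rightarrow> real" where "E k = e1 * A k + e2 * B k"

text \<open>The vector \<open>(e1, e2)\<close> points into the interior of the recession cone of the polygon.\<close>

lemma E_pos: "1 \<le> k \<Longrightarrow> k \<le> d \<Longrightarrow> 0 < E k"
proof -
  assume k: "1 \<le> k" "k \<le> d"
  have "E k = - D 1 k - D k d" by (simp add: E_def e1_def e2_def D_def algebra_simps)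
  then show ?thesis
    using k d D_neg[of 1 k] D_neg[of k d] by (cases "k = 1"; cases "k = d") auto
qed

lemma xi_r_linear: "xi_r d a (\<lambda>k. x * A k + y * B k) z = x * Ar z + y * Br z"
  unfolding xi_r_eq[OF d1] sum_distrib_left sum.distrib[symmetric]
  by (intro sum.cong) (auto simp: algebra_simps)

lemma xi_r_E: "xi_r d a E z = e1 * Ar z + e2 * Br z"
  using xi_r_linear[of e1 e2 z] by (simp add: E_def[abs_def])

text \<open>Rotated action coordinates: \<open>eta\<close> along the recession direction
  \<open>(e1, e2)\<close>, \<open>tau\<close> across it.\<close>

definition tau :: "real \<times> real \<Rightarrow> real" where "tau z = e2 * X1 z - e1 * X2 z"
definition eta :: "real \<times> real \<Rightarrow> real" where "eta z = e1 * X1 z + e2 * X2 z"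

definition tau_H :: "real \<times> real \<Rightarrow> real" where "tau_H z = e1 * Ar z + e2 * Br z"
definition tau_r :: "real \<times> real \<Rightarrow> real" where "tau_r z = - snd z * (e1 * AH z + e2 * BH z)"

lemma tau_has_derivative: "0 < snd z \<Longrightarrow>
    (tau has_derivative (\<lambda>v. tau_H z * fst v + tau_r z * snd v)) (at z)"
  unfolding tau_def[abs_def] tau_H_def tau_r_def
  by (rule derivative_eq_intros X1_has_derivative X2_has_derivative refl | assumption
      | simp add: fun_eq_iff algebra_simps)+

lemma eta_has_derivative: "0 < snd z \<Longrightarrow>
    (eta has_derivative (\<lambda>v. (e1 * Br z - e2 * Ar z) * fst v
      + (- snd z * (e1 * BH z - e2 * AH z)) * snd v)) (at z)"
  unfolding eta_def[abs_def]
  by (rule derivative_eq_intros X1_has_derivative X2_has_derivative refl | assumption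
      | simp add: fun_eq_iff algebra_simps)+

text \<open>\<open>tau_H\<close> is the average of the positive numbers \<open>E k\<close>, with
  half the cosine increments as weights: these are positive and sum to 1. The bound being uniform,
  \<open>tau\<close> takes every value on each line of constant r.\<close>

lemma tau_H_lower:
  obtains m where "0 < m" "\<And>z. 0 < snd z \<Longrightarrow> m \<le> tau_H z"
proof -
  define m where "m = Min (E ` {1..d})"
  have ne: "E ` {1..d} \<noteq> {}" using d by auto
  have "m \<in> E ` {1..d}" unfolding m_def by (rule Min_in[OF _ ne]) simp
  then have m: "0 < m" using E_pos by auto
  have mE: "m \<le> E k" if "k \<in> {1..d}" for k unfolding m_def using that by (intro Min_le) auto
  have "m \<le> tau_H z" if z: "0 < snd z" for z
  proof -
    have "2 * m = (\<Sum>k=1..d. m * (cos_node d a z k - cos_node d a z (k-1)))"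
      using sum_by_parts[OF d1, of "\<lambda>_. m" "cos_node d a z"] d by (simp add: cos_node_def)
    also have "\<dots> \<le> (\<Sum>k=1..d. E k * (cos_node d a z k - cos_node d a z (k-1)))"
      using mE cos_node_less[OF z] by (intro sum_mono mult_right_mono) (auto simp: less_imp_le)
    also have "\<dots> = 2 * xi_r d a E z"
      unfolding xi_r_eq[OF d1] by simp
    also have "\<dots> = 2 * tau_H z" by (simp add: tau_H_def xi_r_E)
    finally show ?thesis by simp
  qed
  then show ?thesis using that m by blast
qed

lemma tau_increasing:
  obtains m where "0 < m"
    "\<And>H H' r. 0 < r \<Longrightarrow> H \<le> H' \<Longrightarrow> tau (H, r) + m * (H' - H) \<le> tau (H', r)"
proof -
  obtain m where m: "0 < m" "\<And>z. 0 < snd z \<Longrightarrow> m \<le> tau_H z" using tau_H_lower by blast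
  have "tau (H, r) + m * (H' - H) \<le> tau (H', r)" if "0 < r" "H \<le> H'" for H H' r
  proof -
    have "\<exists>y. ((\<lambda>h. tau (h, r) - m * h) has_real_derivative y) (at h) \<and> 0 \<le> y" for h
    proof -
      have "((\<lambda>h. tau (h, r)) has_derivative (\<lambda>k. tau_H (h, r) * k)) (at h)"
        using has_derivative_compose[OF has_derivative_Pair[OF has_derivative_ident has_derivative_const]
          tau_has_derivative[of "(h, r)"]] that by simp
      then have "((\<lambda>h. tau (h, r)) has_real_derivative tau_H (h, r)) (at h)"
        by (intro has_derivative_imp_has_field_derivative) (auto simp: mult.commute)
      then have "((\<lambda>h. tau (h, r) - m * h) has_real_derivative tau_H (h, r) - m) (at h)"
        by (auto intro!: derivative_eq_intros)
      then show ?thesis using m(2)[of "(h, r)"] that by force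
    qed
    then have "tau (H, r) - m * H \<le> tau (H', r) - m * H'"
      by (intro DERIV_nonneg_imp_nondecreasing[OF that(2)])
    then show ?thesis by (simp add: algebra_simps)
  qed
  then show ?thesis using that m by blast
qed

lemma smooth_on_tau_H: "smooth_on half_plane tau_H" and smooth_on_tau_r: "smooth_on half_plane tau_r"
  unfolding tau_H_def[abs_def] tau_r_def[abs_def]
  by (intro smooth_on_intros smooth_on_xi_r smooth_on_xi_H open_half_plane smooth_on_snd)+

lemma inj_on_tau: "inj_on (\<lambda>z. (tau z, snd z)) half_plane"
proof (rule inj_onI)
  fix x y assume xy: "x \<in> half_plane" "y \<in> half_plane" "(tau x, snd x) = (tau y, snd y)"
  obtain m where m: "0 < m"
    "\<And>H H' r. 0 < r \<Longrightarrow> H \<le> H' \<Longrightarrow> tau (H, r) + m * (H' - H) \<le> tau (H', r)"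
    using tau_increasing by blast
  have le: "fst y \<le> fst x"
    if "snd x > 0" "tau x = tau y" "snd x = snd y" for x y :: "real \<times> real"
  proof (rule ccontr)
    assume lt: "\<not> fst y \<le> fst x"
    then have "tau (fst x, snd x) + m * (fst y - fst x) \<le> tau (fst y, snd x)"
      using that by (intro m(2)) auto
    moreover have "0 < m * (fst y - fst x)" using lt m(1) by simp
    moreover have "(fst x, snd y) = x" using that(3) by (simp add: prod_eq_iff)
    ultimately show False using that by simp
  qed
  have *: "0 < snd x" "0 < snd y" "tau x = tau y" "snd x = snd y" using xy by (auto simp: half_plane_iff)
  have "fst x = fst y"
    by (rule antisym) (rule le[OF *(2) *(3,4)[symmetric]], rule le[OF *(1,3,4)])
  then show "x = y" using *(4) by (rule prod_eqI)
qed

lemma tau_surj: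
  assumes "0 < r"
  obtains H where "tau (H, r) = T"
proof -
  obtain m where m: "0 < m"
    "\<And>H H' r. 0 < r \<Longrightarrow> H \<le> H' \<Longrightarrow> tau (H, r) + m * (H' - H) \<le> tau (H', r)"
    using tau_increasing by blast
  \<comment> \<open>Growing at rate at least m, \<open>tau\<close> covers the distance from
    \<open>tau (0, r)\<close> to T within h.\<close>
  define h where "h = \<bar>T - tau (0, r)\<bar> / m"
  have h: "0 \<le> h" "m * h = \<bar>T - tau (0, r)\<bar>" using m(1) by (auto simp: h_def)
  have "T \<le> tau (h, r)" "tau (- h, r) \<le> T"
    using m(2)[of r 0 h] m(2)[of r "- h" 0] h assms by auto
  moreover have "isCont (\<lambda>h. tau (h, r)) x" for x
  proof -
    have "isCont tau (x, r)"
      using has_derivative_continuous[OF tau_has_derivative[of "(x, r)"]] assms by simp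
    then show ?thesis
      by (intro isCont_o2[where f = "\<lambda>h. (h, r)" and g = tau] continuous_intros) auto
  qed
  ultimately obtain H where "tau (H, r) = T"
    using IVT[of "\<lambda>h. tau (h, r)" "- h" T h] h(1) by auto
  then show ?thesis by (rule that)
qed

lemma e_nonzero: "0 < e1\<^sup>2 + e2\<^sup>2"
proof -
  have "e1 \<noteq> 0 \<or> e2 \<noteq> 0" using E_pos[of 1] d by (auto simp: E_def)
  then show ?thesis by (auto intro: add_pos_nonneg add_nonneg_pos)
qed

text \<open>Along a curve of constant \<open>tau\<close>, parametrised by \<open>r\<close>, the other coordinate \<open>eta\<close> increases:
  its derivative is a positive multiple of the Jacobian.\<close>

lemma inj_on_X: "inj_on X half_plane"
proof -
  define G where "G = inv_into half_plane (\<lambda>z. (tau z, snd z))"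
  have GF: "G (tau z, snd z) = z" if "z \<in> half_plane" for z
    unfolding G_def using inv_into_f_f[OF inj_on_tau that] by simp
  \<comment> \<open>The inverse derivative of \<open>planar_inverse\<close> for the coordinates
    \<open>(tau, r)\<close>; the factors 1 and 0 are the second row of the matrix.\<close>
  define F' where "F' = (\<lambda>w z. ((fst w * 1 - snd w * tau_r z) / (tau_H z * 1 - tau_r z * 0),
      (snd w * tau_H z - fst w * 0) / (tau_H z * 1 - tau_r z * 0)))"
  have tau_H_pos: "0 < tau_H z" if "z \<in> half_plane" for z
    using tau_H_lower that by (metis half_plane_iff less_le_trans)
  have tau_H_nonzero: "tau_H z \<noteq> 0" if "z \<in> half_plane" for z
    using tau_H_pos[OF that] by simp
  have DG: "(G has_derivative (\<lambda>w. F' w (G x))) (at x)"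
    if "x \<in> (\<lambda>z. (tau z, snd z)) ` half_plane" for x
    unfolding F'_def
    by (rule planar_inverse(2)[where c = "\<lambda>_. 0" and d = "\<lambda>_. 1", OF open_half_plane GF _ _ _ _ _ _ _ that])
       (use tau_H_nonzero tau_has_derivative[folded half_plane_iff] in \<open>auto
         intro: smooth_on_tau_H smooth_on_tau_r smooth_on_const bounded_linear_imp_has_derivative
           bounded_linear_snd\<close>)
  have incr: "eta (G (T, r)) < eta (G (T, r'))" if "0 < r" "r < r'" for T r r'
  proof (rule DERIV_pos_imp_increasing[OF that(2)])
    fix s assume s: "r \<le> s" "s \<le> r'"
    then have "0 < s" using that by simp
    then obtain H where H: "tau (H, s) = T" using tau_surj by blast
    define z where "z = (H, s)"
    have z: "z \<in> half_plane" "0 < snd z" using \<open>0 < s\<close> by (auto simp: half_plane_iff z_def)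
    have Gz: "G (T, s) = z" using GF[OF z(1)] by (simp add: z_def H)
    have "(T, s) \<in> (\<lambda>z. (tau z, snd z)) ` half_plane"
      using z(1) by (intro image_eqI[of _ _ z]) (auto simp: z_def H)
    from DG[OF this] have D1: "(G has_derivative (\<lambda>w. F' w z)) (at (T, s))" by (simp add: Gz)
    have D2: "((\<lambda>s. G (T, s)) has_derivative (\<lambda>k. F' (0, k) z)) (at s)"
      using has_derivative_compose[OF has_derivative_Pair[OF has_derivative_const has_derivative_ident] D1]
      by simp
    have D3: "((\<lambda>s. eta (G (T, s))) has_derivative (\<lambda>k. (e1 * Br z - e2 * Ar z) * fst (F' (0, k) z)
      + (- snd z * (e1 * BH z - e2 * AH z)) * snd (F' (0, k) z))) (at s)"
      using has_derivative_compose[OF D2, of eta] eta_has_derivative[OF z(2)] by (simp add: Gz)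
    have tp: "0 < tau_H z" using tau_H_pos z by simp
    \<comment> \<open>Passing from \<open>(X1, X2)\<close> to \<open>(tau, eta)\<close> is a
      rotation followed by a scaling and a reflection, so the Jacobian \<open>snd z * K z\<close>
      acquires the factor \<open>e1\<^sup>2 + e2\<^sup>2\<close> up to sign.\<close>
    have "(e1 * Br z - e2 * Ar z) * (- tau_r z) - snd z * (e1 * BH z - e2 * AH z) * tau_H z
      = snd z * (e1\<^sup>2 + e2\<^sup>2) * K z"
      by (simp add: tau_r_def tau_H_def K_def power2_eq_square algebra_simps)
    moreover have "(e1 * Br z - e2 * Ar z) * fst (F' (0, k) z)
      + (- snd z * (e1 * BH z - e2 * AH z)) * snd (F' (0, k) z)
      = ((e1 * Br z - e2 * Ar z) * (- tau_r z) - snd z * (e1 * BH z - e2 * AH z) * tau_H z) / tau_H z * k" for k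
      using tp by (simp add: F'_def field_simps)
    ultimately have "((\<lambda>s. eta (G (T, s))) has_real_derivative snd z * (e1\<^sup>2 + e2\<^sup>2) * K z / tau_H z) (at s)"
      using D3 by (intro has_derivative_imp_has_field_derivative) (auto simp: mult.commute)
    moreover have "0 < snd z * (e1\<^sup>2 + e2\<^sup>2) * K z / tau_H z"
      using z e_nonzero K_pos tp by (intro divide_pos_pos mult_pos_pos) auto
    ultimately show "\<exists>y. ((\<lambda>s. eta (G (T, s))) has_real_derivative y) (at s) \<and> 0 < y" by blast
  qed
  show ?thesis
  proof (rule inj_onI)
    fix x y assume xy: "x \<in> half_plane" "y \<in> half_plane" "X x = X y"
    have eq: "tau x = tau y" "eta x = eta y" using xy(3) by (auto simp: X_def tau_def eta_def)
    have x: "x = G (tau x, snd x)" "y = G (tau x, snd y)" using GF[OF xy(1)] GF[OF xy(2)] eq by auto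
    have "snd x = snd y"
    proof (cases "snd x" "snd y" rule: linorder_cases)
      case less
      then have "eta (G (tau x, snd x)) < eta (G (tau x, snd y))"
        using incr xy by (auto simp: half_plane_iff)
      then show ?thesis using x eq by simp
    next
      case greater
      then have "eta (G (tau x, snd y)) < eta (G (tau x, snd x))"
        using incr xy by (auto simp: half_plane_iff)
      then show ?thesis using x eq by simp
    qed
    then show "x = y" using x by simp
  qed
qed

section \<open>Properness and surjectivity\<close>

lemma continuous_on_X: "continuous_on S X"
proof -
  have "continuous_on S (\<lambda>z :: real \<times> real. radius a i (fst z) (snd z))" for i
    unfolding radius_def by (intro continuous_on_real_sqrt continuous_on_add continuous_on_power
        continuous_on_fst continuous_on_snd continuous_on_const continuous_on_id)
  then have "continuous_on S (\<lambda>z. conj_fun d a c n (fst z) (snd z))" for c n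
    unfolding conj_fun_def by (auto intro!: continuous_on_diff continuous_on_divide continuous_on_mult
        continuous_on_sum continuous_on_power continuous_on_fst continuous_on_snd continuous_on_const continuous_on_id)
  then show ?thesis
    unfolding X_def[abs_def] X1_def X2_def
    by (intro continuous_on_Pair continuous_on_add continuous_on_diff continuous_on_const)
qed

text \<open>In the sum of the lower bounds for the first and the last edge function H cancels, and a
  multiple of the radius remains. Hence preimages of a convergent sequence are bounded and have a
  convergent subsequence.\<close>

lemma closed_X_image: "closed (X ` {z. 0 \<le> snd z})"
  unfolding closed_sequential_limits
proof (intro allI impI)
  fix x p assume xp: "(\<forall>n. x n \<in> X ` {z. 0 \<le> snd z}) \<and> x \<longlonglongrightarrow> p"
  then have "\<forall>n. \<exists>z. 0 \<le> snd z \<and> x n = X z" unfolding image_iff by blast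
  then obtain z where z: "\<And>n. 0 \<le> snd (z n)" "\<And>n. x n = X (z n)" by metis
  obtain m where m: "0 < m" "\<And>i j. 1 \<le> i \<Longrightarrow> i < j \<Longrightarrow> j \<le> d \<Longrightarrow> D i j \<le> - m"
    using D_gap by blast
  have "(\<lambda>n. L 1 (x n) + L d (x n)) \<longlonglongrightarrow> L 1 p + L d p"
    using xp unfolding L_def by (intro tendsto_intros) auto
  then have "bounded (range (\<lambda>n. L 1 (x n) + L d (x n)))" by (rule convergent_imp_bounded)
  then obtain M where "\<forall>y\<in>range (\<lambda>n. L 1 (x n) + L d (x n)). norm y \<le> M"
    unfolding bounded_iff by blast
  then have M: "L 1 (x n) + L d (x n) \<le> M" for n by (auto simp: abs_le_iff)
  have "norm (z n) \<le> 4 * M / m + \<bar>a 1\<bar>" for n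
  proof -
    obtain H r where Hr: "z n = (H, r)" by (cases "z n")
    have "m/2 * (radius a 1 H r - (H + a 1)) \<le> L 1 (x n)"
      using L_X_lower[OF _ _ m, of 1 H r] d by (simp add: z Hr)
    moreover have "m/2 * (radius a (d-1) H r + (H + a (d-1))) \<le> L d (x n)"
      using L_X_lower[OF _ _ m, of d H r] d by (simp add: z Hr)
    moreover have "m/2 * (radius a 1 H r + radius a (d-1) H r + (a (d-1) - a 1))
        = m/2 * (radius a 1 H r - (H + a 1)) + m/2 * (radius a (d-1) H r + (H + a (d-1)))"
      by (subst distrib_left[symmetric], rule arg_cong[where f = "(*) (m/2)"], simp)
    ultimately have "m/2 * (radius a 1 H r + radius a (d-1) H r + (a (d-1) - a 1)) \<le> M"
      using M[of n] by simp
    moreover have "m/2 * radius a 1 H r \<le> m/2 * (radius a 1 H r + radius a (d-1) H r + (a (d-1) - a 1))"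
      using a_le[of 1 "d-1"] d m(1) radius_abs_le[of H a "d-1" r] by (intro mult_left_mono) auto
    ultimately have "m/2 * radius a 1 H r \<le> M" by linarith
    then have R: "radius a 1 H r \<le> 2 * M / m" using m(1) by (simp add: field_simps)
    have "\<bar>r\<bar> \<le> radius a 1 H r"
      using real_sqrt_le_mono[of "r\<^sup>2" "(H + a 1)\<^sup>2 + r\<^sup>2"] by (simp add: radius_def)
    moreover have "\<bar>H\<bar> \<le> radius a 1 H r + \<bar>a 1\<bar>" using radius_abs_le[of H a 1 r] by linarith
    moreover have "norm (z n) \<le> \<bar>H\<bar> + \<bar>r\<bar>" using norm_Pair_le[of H r] by (simp add: Hr)
    ultimately show ?thesis using R by simp
  qed
  then have "bounded (range z)" by (auto simp: bounded_iff)
  then obtain q f where f: "strict_mono f" "(z \<circ> f) \<longlonglongrightarrow> q"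
    using bounded_imp_convergent_subsequence by blast
  have "(\<lambda>n. snd ((z \<circ> f) n)) \<longlonglongrightarrow> snd q" using f(2) by (rule tendsto_snd)
  then have "0 \<le> snd q" using z(1) by (intro LIMSEQ_le_const) auto
  moreover have "isCont X q" using continuous_on_X[of UNIV] continuous_on_eq_continuous_at[OF open_UNIV] by blast
  then have "(\<lambda>n. X ((z \<circ> f) n)) \<longlonglongrightarrow> X q" using f(2) by (rule isCont_tendsto_compose)
  then have "(x \<circ> f) \<longlonglongrightarrow> X q" by (simp add: z(2)[symmetric] o_def)
  moreover have "(x \<circ> f) \<longlonglongrightarrow> p" using xp f(1) LIMSEQ_subseq_LIMSEQ by blast
  ultimately show "p \<in> X ` {z. 0 \<le> snd z}" using LIMSEQ_unique by blast
qed

definition P_int :: "(real \<times> real) set" where "P_int = {p. \<forall>j. 1 \<le> j \<and> j \<le> d \<longrightarrow> 0 < L j p}"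

definition Y :: "real \<times> real \<Rightarrow> real \<times> real" where "Y = inv_into half_plane X"

lemma Y_X: "z \<in> half_plane \<Longrightarrow> Y (X z) = z"
  unfolding Y_def by (rule inv_into_f_f[OF inj_on_X])

lemma K_nonzero: "z \<in> half_plane \<Longrightarrow> K z \<noteq> 0"
  using K_pos[of z] by (simp add: half_plane_iff)

lemma X_inverse:
  shows "open (X ` half_plane)"
    and "p \<in> X ` half_plane \<Longrightarrow> (Y has_derivative (\<lambda>w.
      ((fst w * AH (Y p) + snd w * BH (Y p)) / K (Y p),
       (fst w * Ar (Y p) + snd w * Br (Y p)) / (snd (Y p) * K (Y p))))) (at p)"
    and "smooth_on (X ` half_plane) Y"
proof -
  have X: "X = (\<lambda>z. (X1 z, X2 z))" by (simp add: X_def fun_eq_iff)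
  have j: "Br z * (snd z * AH z) - (- snd z * BH z) * (- Ar z) \<noteq> 0" if "z \<in> half_plane" for z
    using K_nonzero[OF that] that unfolding X_jacobian by (simp add: half_plane_iff)
  have sm: "smooth_on half_plane Br" "smooth_on half_plane (\<lambda>z. - snd z * BH z)"
    "smooth_on half_plane (\<lambda>z. - Ar z)" "smooth_on half_plane (\<lambda>z. snd z * AH z)"
    by (intro smooth_on_intros smooth_on_xi_r smooth_on_xi_H open_half_plane smooth_on_snd)+
  have YX: "Y (X1 z, X2 z) = z" if "z \<in> half_plane" for z using Y_X[OF that] by (simp add: X)
  note inv = planar_inverse[OF open_half_plane YX X1_has_derivative[unfolded half_plane_iff[symmetric]]
    X2_has_derivative[unfolded half_plane_iff[symmetric]] j sm]
  show "open (X ` half_plane)" "smooth_on (X ` half_plane) Y" unfolding X using inv(1,3) by blast+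
  assume p: "p \<in> X ` half_plane"
  then have z: "0 < snd (Y p)" "K (Y p) \<noteq> 0" using Y_X K_nonzero by (auto simp: half_plane_iff)
  have eq: "(x * (s * q)) / (s * k) = (x * q) / k" if "s \<noteq> 0" for x s q k :: real using that by simp
  show "(Y has_derivative (\<lambda>w.
      ((fst w * AH (Y p) + snd w * BH (Y p)) / K (Y p),
       (fst w * Ar (Y p) + snd w * Br (Y p)) / (snd (Y p) * K (Y p))))) (at p)"
  proof (rule has_derivative_eq_rhs[OF inv(2)])
    show "p \<in> (\<lambda>z. (X1 z, X2 z)) ` half_plane" using p by (simp add: X)
    show "(\<lambda>w. ((fst w * (snd (Y p) * AH (Y p)) - snd w * (- snd (Y p) * BH (Y p)))
        / (Br (Y p) * (snd (Y p) * AH (Y p)) - - snd (Y p) * BH (Y p) * - Ar (Y p)),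
        (snd w * Br (Y p) - fst w * - Ar (Y p))
        / (Br (Y p) * (snd (Y p) * AH (Y p)) - - snd (Y p) * BH (Y p) * - Ar (Y p))))
      = (\<lambda>w. ((fst w * AH (Y p) + snd w * BH (Y p)) / K (Y p),
       (fst w * Ar (Y p) + snd w * Br (Y p)) / (snd (Y p) * K (Y p))))"
      unfolding X_jacobian using z by (simp add: fun_eq_iff field_simps)
  qed
qed

lemma convex_P_int: "convex P_int"
proof -
  have "0 < L j p \<longleftrightarrow> (A j, B j) \<bullet> p > - l j" for j p
    by (cases p) (auto simp: L_def)
  then have "P_int = (\<Inter>j\<in>{1..d}. {p. (A j, B j) \<bullet> p > - l j})"
    by (auto simp: P_int_def)
  then show ?thesis by (auto intro!: convex_INT convex_halfspace_gt)
qed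

text \<open>The image of the open half-plane is open, and it is closed in \<open>P_int\<close>
  because the line \<open>r = 0\<close> is sent to edges, outside \<open>P_int\<close>. As
  \<open>P_int\<close> is convex, hence connected, it is all of \<open>P_int\<close>.\<close>

lemma X_image: "X ` half_plane = P_int"
proof -
  have sub: "X ` half_plane \<subseteq> P_int"
    using L_X_pos by (auto simp: P_int_def half_plane_iff)
  have "P_int \<inter> X ` {z. 0 \<le> snd z} \<subseteq> X ` half_plane"
  proof
    fix p assume p: "p \<in> P_int \<inter> X ` {z. 0 \<le> snd z}"
    then obtain H r where *: "p = X (H, r)" "0 \<le> r" by auto
    have "r \<noteq> 0" using boundary_on_edge[of H] p * by (force simp: P_int_def)
    then show "p \<in> X ` half_plane" using * by (auto simp: half_plane_iff)
  qed
  moreover have "X ` half_plane \<subseteq> X ` {z. 0 \<le> snd z}" by (auto simp: half_plane_def)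
  ultimately have "X ` half_plane = P_int \<inter> X ` {z. 0 \<le> snd z}" using sub by blast
  then have "closedin (top_of_set P_int) (X ` half_plane)"
    using closed_X_image closedin_closed by blast
  moreover have "openin (top_of_set P_int) (X ` half_plane)"
    using X_inverse(1) sub by (simp add: openin_open_eq open_subset)
  moreover have "(0, 1) \<in> half_plane" by (simp add: half_plane_def)
  ultimately show ?thesis
    using convex_connected[OF convex_P_int] unfolding connected_clopen by blast
qed

lemma open_P_int: "open P_int"
  using X_inverse(1) X_image by simp

text \<open>A small step in the recession direction leads into \<open>P_int\<close>; closedness of
  the image then gives the point itself.\<close>

lemma closed_polygon_subset:
  assumes "\<And>j. 1 \<le> j \<Longrightarrow> j \<le> d \<Longrightarrow> 0 \<le> L j p"
  obtains z where "0 \<le> snd z" "p = X z"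
proof -
  define x where "x = (\<lambda>n. p + inverse (real (Suc n)) *\<^sub>R (e1, e2))"
  have "x n \<in> X ` {z. 0 \<le> snd z}" for n
  proof -
    have "L j (x n) = L j p + inverse (real (Suc n)) * E j" for j
      by (simp add: x_def L_def E_def algebra_simps)
    then have "x n \<in> P_int" using assms E_pos
      by (auto simp: P_int_def intro!: add_nonneg_pos)
    then show ?thesis unfolding X_image[symmetric] by (auto simp: half_plane_def)
  qed
  moreover have "x \<longlonglongrightarrow> p + 0 *\<^sub>R (e1, e2)"
    unfolding x_def by (intro tendsto_intros LIMSEQ_inverse_real_of_nat)
  ultimately have "p \<in> X ` {z. 0 \<le> snd z}"
    using closed_X_image unfolding closed_sequential_limits by (metis add.right_neutral scale_zero_left)
  then show ?thesis using that by blast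
qed

end

section \<open>Functions on the plane of action coordinates\<close>

lemma smooth_on_planar:
  fixes g :: "real^2 \<Rightarrow> real"
  assumes "open S" "\<And>x. x \<in> S \<Longrightarrow> (g has_derivative (\<lambda>w. p x * w $ 1 + q x * w $ 2)) (at x)"
    "smooth_on S p" "smooth_on S q"
  shows "smooth_on S g"
  by (rule smooth_onI[OF assms(1,2)], assumption, intro smooth_on_intros assms)

lemma planar_primitive:
  fixes g1 g2 p q s :: "real^2 \<Rightarrow> real"
  assumes "open S" "convex S"
    and g1: "\<And>x. x \<in> S \<Longrightarrow> (g1 has_derivative (\<lambda>w. p x * w $ 1 + q x * w $ 2)) (at x)"
    and g2: "\<And>x. x \<in> S \<Longrightarrow> (g2 has_derivative (\<lambda>w. q x * w $ 1 + s x * w $ 2)) (at x)"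
    and "continuous_on S p" "continuous_on S q" "continuous_on S s"
  obtains f where "\<And>x. x \<in> S \<Longrightarrow> (f has_derivative (\<lambda>w. g1 x * w $ 1 + g2 x * w $ 2)) (at x)"
proof -
  define b :: "2 \<Rightarrow> real^2" where "b = (\<lambda>i. axis i 1)"
  have b: "b 1 \<bullet> w = w $ 1" "b 2 \<bullet> w = w $ 2" for w by (auto simp: b_def inner_axis')
  define D where "D = (\<lambda>x (w :: real^2). (p x * w $ 1 + q x * w $ 2) *\<^sub>R b 1 + (q x * w $ 1 + s x * w $ 2) *\<^sub>R b 2)"
  have "((\<lambda>x. g1 x *\<^sub>R b 1 + g2 x *\<^sub>R b 2) has_derivative D x) (at x)" if "x \<in> S" for x
    unfolding D_def using g1[OF that] g2[OF that]
    by (intro has_derivative_add has_derivative_scaleR_left)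
  moreover have "continuous_on S (\<lambda>x. D x w)" for w
    unfolding D_def by (intro continuous_intros assms)
  moreover have "D x v \<bullet> w = D x w \<bullet> v" for x v w
    by (simp add: D_def inner_add_left b algebra_simps)
  ultimately obtain f where
    "\<And>x. x \<in> S \<Longrightarrow> (f has_derivative (\<lambda>v. (g1 x *\<^sub>R b 1 + g2 x *\<^sub>R b 2) \<bullet> v)) (at x)"
    using convex_primitive[OF assms(1,2), of "\<lambda>x. g1 x *\<^sub>R b 1 + g2 x *\<^sub>R b 2" D] by blast
  then show ?thesis using that[of f] by (simp add: inner_add_left b)
qed

text \<open>Covers non-differentiable functions too: f and g have the same derivatives at x, so the
  same one is chosen.\<close>

lemma frechet_derivative_cong_open:
  assumes "open S" "x \<in> S" "\<And>y. y \<in> S \<Longrightarrow> f y = g y"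
  shows "frechet_derivative f (at x) = frechet_derivative g (at x)"
proof -
  have "(f has_derivative D) (at x) \<longleftrightarrow> (g has_derivative D) (at x)" for D
    using has_derivative_transform_within_open[OF _ assms(1,2), of f D UNIV g]
      has_derivative_transform_within_open[OF _ assms(1,2), of g D UNIV f] assms(3) by auto
  then show ?thesis unfolding frechet_derivative_def by simp
qed

section \<open>Partial derivatives and inverses of two by two matrices\<close>

lemma partial_cong:
  assumes "open S" "x \<in> S" "\<And>y. y \<in> S \<Longrightarrow> f y = g y"
  shows "partial i f x = partial i g x"
  unfolding partial_def using frechet_derivative_cong_open[OF assms] by simp

lemma partial_eq: "(f has_derivative D) (at x) \<Longrightarrow> partial i f x = D (axis i 1)"
  unfolding partial_def by (metis frechet_derivative_at)

lemma partial_planar: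
  assumes "(f has_derivative (\<lambda>w. p * w $ 1 + q * w $ 2)) (at x)"
  shows "partial 1 f x = p" "partial 2 f x = q"
  using partial_eq[OF assms] by (auto simp: axis_def)

lemma smooth_on_partial: "smooth_on S f \<Longrightarrow> smooth_on S (partial i f)"
  unfolding partial_def[abs_def] by (rule smooth_on_frechet)

lemma partial_mult:
  assumes "smooth_on S f" "smooth_on S g" "x \<in> S"
  shows "partial i (\<lambda>y. f y * g y) x = partial i f x * g x + f x * partial i g x"
  using partial_eq[OF has_derivative_mult[OF smooth_on_has_derivative[OF assms(1,3)]
        smooth_on_has_derivative[OF assms(2,3)]], of i]
  by (simp add: partial_def)

lemma partial_add:
  assumes "smooth_on S f" "smooth_on S g" "x \<in> S"
  shows "partial i (\<lambda>y. f y + g y) x = partial i f x + partial i g x"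
  using partial_eq[OF has_derivative_add[OF smooth_on_has_derivative[OF assms(1,3)]
        smooth_on_has_derivative[OF assms(2,3)]], of i]
  by (simp add: partial_def)

lemma partial_commute:
  assumes "open S" "smooth_on S f" "x \<in> S"
  shows "partial i (partial j f) x = partial j (partial i f) x"
  unfolding partial_def[abs_def] by (rule mixed_derivatives_commute[OF assms])

lemma matrix_inv_2:
  fixes M :: "real^2^2"
  assumes "det M \<noteq> 0"
  shows "matrix_inv M $ 1 $ 1 = M $ 2 $ 2 / det M" "matrix_inv M $ 1 $ 2 = - M $ 1 $ 2 / det M"
    "matrix_inv M $ 2 $ 1 = - M $ 2 $ 1 / det M" "matrix_inv M $ 2 $ 2 = M $ 1 $ 1 / det M"
proof -
  define N :: "real^2^2" where
    "N = vector [vector [M $ 2 $ 2 / det M, - M $ 1 $ 2 / det M], vector [- M $ 2 $ 1 / det M, M $ 1 $ 1 / det M]]"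
  have MN: "M ** N = mat 1" and NM: "N ** M = mat 1"
    using assms by (auto simp: vec_eq_iff forall_2 matrix_matrix_mult_def sum_2 N_def mat_def divide_simps;
      (simp add: det_2 algebra_simps)?)+
  have "M ** matrix_inv M = mat 1 \<and> matrix_inv M ** M = mat 1"
    unfolding matrix_inv_def by (rule someI[of "\<lambda>A'. M ** A' = mat 1 \<and> A' ** M = mat 1" N]) (use MN NM in simp)
  then have "matrix_inv M = matrix_inv M ** (M ** N)" "matrix_inv M ** M = mat 1" using MN by auto
  then have "matrix_inv M = N" by (metis matrix_mul_assoc matrix_mul_lid)
  then show "matrix_inv M $ 1 $ 1 = M $ 2 $ 2 / det M" "matrix_inv M $ 1 $ 2 = - M $ 1 $ 2 / det M"
    "matrix_inv M $ 2 $ 1 = - M $ 2 $ 1 / det M" "matrix_inv M $ 2 $ 2 = M $ 1 $ 1 / det M"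
    by (simp_all add: N_def)
qed

context toric_data
begin

section \<open>The symplectic potential\<close>

definition U :: "(real^2) set" where "U = {x. (x $ 1, x $ 2) \<in> P_int}"

definition hp :: "real^2 \<Rightarrow> real \<times> real" where "hp x = Y (x $ 1, x $ 2)"

definition Xi1 :: "real^2 \<Rightarrow> real" where "Xi1 x = xi_fun d a A n1 (fst (hp x)) (snd (hp x))"
definition Xi2 :: "real^2 \<Rightarrow> real" where "Xi2 x = xi_fun d a B n2 (fst (hp x)) (snd (hp x))"

lemma bounded_linear_pair: "bounded_linear (\<lambda>x :: real^2. (x $ 1, x $ 2))"
  by (intro bounded_linear_Pair bounded_linear_vec_nth)

lemma open_U: "open U"
proof -
  have "continuous_on UNIV (\<lambda>x :: real^2. (x $ 1, x $ 2))"
    by (intro linear_continuous_on bounded_linear_pair)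
  from open_vimage[OF open_P_int this] show ?thesis by (simp add: U_def vimage_def)
qed

lemma convex_U: "convex U"
  using convex_linear_vimage[OF bounded_linear.linear[OF bounded_linear_pair] convex_P_int]
  by (simp add: U_def vimage_def)

lemma hp_half_plane: "x \<in> U \<Longrightarrow> hp x \<in> half_plane" and X_hp: "x \<in> U \<Longrightarrow> X (hp x) = (x $ 1, x $ 2)"
proof -
  assume "x \<in> U"
  then have "(x $ 1, x $ 2) \<in> X ` half_plane" using X_image by (simp add: U_def)
  then obtain z where "z \<in> half_plane" "(x $ 1, x $ 2) = X z" by blast
  then show "hp x \<in> half_plane" "X (hp x) = (x $ 1, x $ 2)" by (auto simp: hp_def Y_X)
qed

lemma hp_X:
  assumes "z \<in> half_plane"
  shows "vector [X1 z, X2 z] \<in> U" "hp (vector [X1 z, X2 z]) = z"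
  using assms X_image Y_X[OF assms] by (auto simp: U_def hp_def X_def)

lemma smooth_on_hp: "smooth_on U hp"
  unfolding hp_def[abs_def]
  using smooth_on_compose[OF open_U open_P_int _ smooth_on_linear[OF bounded_linear_pair open_U], of Y]
    X_inverse(3) X_image by (auto simp: U_def)

lemma hp_has_derivative:
  assumes "x \<in> U"
  defines "z \<equiv> hp x"
  shows "((\<lambda>x. fst (hp x)) has_derivative (\<lambda>w. AH z / K z * w $ 1 + BH z / K z * w $ 2)) (at x)"
    and "((\<lambda>x. snd (hp x)) has_derivative
      (\<lambda>w. Ar z / (snd z * K z) * w $ 1 + Br z / (snd z * K z) * w $ 2)) (at x)"
proof -
  have "(x $ 1, x $ 2) \<in> X ` half_plane" using assms X_image by (simp add: U_def)
  from has_derivative_compose[OF bounded_linear_imp_has_derivative[OF bounded_linear_pair] X_inverse(2)[OF this]]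
  have D: "(hp has_derivative (\<lambda>w. ((w $ 1 * AH z + w $ 2 * BH z) / K z,
       (w $ 1 * Ar z + w $ 2 * Br z) / (snd z * K z)))) (at x)"
    by (simp add: hp_def[abs_def] z_def)
  show "((\<lambda>x. fst (hp x)) has_derivative (\<lambda>w. AH z / K z * w $ 1 + BH z / K z * w $ 2)) (at x)"
    using has_derivative_fst[OF D] by (simp add: add_divide_distrib mult.commute)
  show "((\<lambda>x. snd (hp x)) has_derivative
      (\<lambda>w. Ar z / (snd z * K z) * w $ 1 + Br z / (snd z * K z) * w $ 2)) (at x)"
    using has_derivative_snd[OF D] by (simp add: add_divide_distrib mult.commute)
qed

text \<open>With \<open>p = (AH, BH)\<close> and \<open>q = (Ar, Br)\<close>, whose determinant is
  K, these are the entries of the matrix (p p^T + q q^T / r^2) / K, which is going to be the Hessian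
  of the potential.\<close>

definition N11 :: "real \<times> real \<Rightarrow> real" where "N11 z = (AH z * AH z + Ar z * Ar z / (snd z)\<^sup>2) / K z"
definition N12 :: "real \<times> real \<Rightarrow> real" where "N12 z = (AH z * BH z + Ar z * Br z / (snd z)\<^sup>2) / K z"
definition N22 :: "real \<times> real \<Rightarrow> real" where "N22 z = (BH z * BH z + Br z * Br z / (snd z)\<^sup>2) / K z"

text \<open>The coefficient \<open>N12\<close> shared by both lines is the closedness of the form
  that u has to integrate.\<close>

lemma Xi_has_derivative:
  assumes "x \<in> U"
  shows "(Xi1 has_derivative (\<lambda>w. N11 (hp x) * w $ 1 + N12 (hp x) * w $ 2)) (at x)"
    and "(Xi2 has_derivative (\<lambda>w. N12 (hp x) * w $ 1 + N22 (hp x) * w $ 2)) (at x)"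
proof -
  let ?z = "hp x"
  have z: "0 < snd ?z" "K ?z \<noteq> 0" using hp_half_plane[OF assms] K_nonzero by (auto simp: half_plane_iff)
  have hp: "(hp has_derivative (\<lambda>w. (AH ?z / K ?z * w $ 1 + BH ?z / K ?z * w $ 2,
      Ar ?z / (snd ?z * K ?z) * w $ 1 + Br ?z / (snd ?z * K ?z) * w $ 2))) (at x)"
    using has_derivative_Pair[OF hp_has_derivative[OF assms]] by simp
  show "(Xi1 has_derivative (\<lambda>w. N11 ?z * w $ 1 + N12 ?z * w $ 2)) (at x)"
    unfolding Xi1_def[abs_def]
    by (rule has_derivative_eq_rhs[OF has_derivative_compose[OF hp xi_fun_has_derivative[OF z(1) d1]]])
       (use z in \<open>simp add: fun_eq_iff N11_def N12_def power2_eq_square field_simps\<close>)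
  show "(Xi2 has_derivative (\<lambda>w. N12 ?z * w $ 1 + N22 ?z * w $ 2)) (at x)"
    unfolding Xi2_def[abs_def]
    by (rule has_derivative_eq_rhs[OF has_derivative_compose[OF hp xi_fun_has_derivative[OF z(1) d1]]])
       (use z in \<open>simp add: fun_eq_iff N22_def N12_def power2_eq_square field_simps\<close>)
qed

lemma smooth_on_K: "smooth_on half_plane K"
  unfolding K_def[abs_def]
  by (intro smooth_on_intros smooth_on_xi_r smooth_on_xi_H open_half_plane)

lemma smooth_on_N: "smooth_on half_plane N11" "smooth_on half_plane N12" "smooth_on half_plane N22"
  unfolding N11_def[abs_def] N12_def[abs_def] N22_def[abs_def]
  by (intro smooth_on_intros smooth_on_xi_r smooth_on_xi_H smooth_on_K open_half_plane smooth_on_snd K_nonzero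
      | simp add: half_plane_iff)+

lemma smooth_on_comp_hp: "smooth_on half_plane f \<Longrightarrow> smooth_on U (\<lambda>x. f (hp x))"
  by (rule smooth_on_compose[OF open_U open_half_plane _ smooth_on_hp]) (auto simp: hp_half_plane)

lemma smooth_on_Xi: "smooth_on U Xi1" "smooth_on U Xi2"
  using smooth_on_planar[OF open_U Xi_has_derivative(1)] smooth_on_planar[OF open_U Xi_has_derivative(2)]
    smooth_on_comp_hp smooth_on_N by auto

text \<open>A sum of two rank one matrices p p^T + q q^T / r^2 has determinant det(p, q)^2 / r^2,
  that is \<open>K\<^sup>2 / r\<^sup>2\<close>.\<close>

lemma N_det:
  assumes "0 < snd z"
  shows "N11 z * N22 z - N12 z * N12 z = 1 / (snd z)\<^sup>2"
proof -
  define R where "R = (snd z)\<^sup>2"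
  have K: "K z \<noteq> 0" and R: "R \<noteq> 0" using K_pos[OF assms] assms by (auto simp: R_def)
  have "N11 z * N22 z - N12 z * N12 z
     = ((AH z * AH z + Ar z * Ar z / R) * (BH z * BH z + Br z * Br z / R)
      - (AH z * BH z + Ar z * Br z / R) * (AH z * BH z + Ar z * Br z / R)) / (K z * K z)"
    by (simp add: N11_def N12_def N22_def R_def diff_divide_distrib)
  also have "(AH z * AH z + Ar z * Ar z / R) * (BH z * BH z + Br z * Br z / R)
      - (AH z * BH z + Ar z * Br z / R) * (AH z * BH z + Ar z * Br z / R) = K z * K z / R"
    using R by (simp add: K_def field_simps)
  finally show ?thesis using K R by (simp add: R_def)
qed

lemma potential_exists:
  obtains u where "\<And>x. x \<in> U \<Longrightarrow> (u has_derivative (\<lambda>w. Xi1 x * w $ 1 + Xi2 x * w $ 2)) (at x)"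
  using planar_primitive[OF open_U convex_U Xi_has_derivative]
    smooth_on_N[THEN smooth_on_comp_hp, THEN smooth_on_imp_continuous_on] by blast

end

locale toric_potential = toric_data +
  fixes u :: "real^2 \<Rightarrow> real"
  assumes u: "\<And>x. x \<in> U \<Longrightarrow> (u has_derivative (\<lambda>w. Xi1 x * w $ 1 + Xi2 x * w $ 2)) (at x)"
begin

lemma smooth_on_u: "smooth_on U u"
  by (rule smooth_on_planar[OF open_U u smooth_on_Xi])

lemma partial_u: "x \<in> U \<Longrightarrow> partial 1 u x = Xi1 x" "x \<in> U \<Longrightarrow> partial 2 u x = Xi2 x"
  using partial_planar[OF u] by auto

lemma partial_Xi:
  assumes "x \<in> U"
  shows "partial 1 Xi1 x = N11 (hp x)" "partial 2 Xi1 x = N12 (hp x)"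
    "partial 1 Xi2 x = N12 (hp x)" "partial 2 Xi2 x = N22 (hp x)"
  using partial_planar[OF Xi_has_derivative(1)[OF assms]] partial_planar[OF Xi_has_derivative(2)[OF assms]]
  by auto

lemma hessian_u:
  assumes "x \<in> U"
  shows "hessian u x $ 1 $ 1 = N11 (hp x)" "hessian u x $ 1 $ 2 = N12 (hp x)"
    "hessian u x $ 2 $ 1 = N12 (hp x)" "hessian u x $ 2 $ 2 = N22 (hp x)"
proof -
  have "partial i (partial 1 u) x = partial i Xi1 x" "partial i (partial 2 u) x = partial i Xi2 x" for i
    using partial_cong[OF open_U assms, of "partial 1 u" Xi1] partial_cong[OF open_U assms, of "partial 2 u" Xi2]
    by (auto simp: partial_u)
  then show "hessian u x $ 1 $ 1 = N11 (hp x)" "hessian u x $ 1 $ 2 = N12 (hp x)"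
    "hessian u x $ 2 $ 1 = N12 (hp x)" "hessian u x $ 2 $ 2 = N22 (hp x)"
    by (simp_all add: hessian_def partial_Xi[OF assms])
qed

lemma det_hessian_u: "x \<in> U \<Longrightarrow> det (hessian u x) = 1 / (snd (hp x))\<^sup>2"
  using N_det[of "hp x"] hp_half_plane by (simp add: det_2 hessian_u half_plane_iff)

lemma pos_def_hessian_u:
  assumes "x \<in> U"
  shows "pos_def_matrix (hessian u x)"
  unfolding pos_def_matrix_def
proof (intro conjI allI impI)
  show "transpose (hessian u x) = hessian u x"
    by (simp add: vec_eq_iff forall_2 transpose_def hessian_u[OF assms])
next
  fix v :: "real^2" assume v: "v \<noteq> 0"
  define z where "z = hp x"
  have z: "0 < snd z" "0 < K z" using hp_half_plane[OF assms] K_pos by (auto simp: half_plane_iff z_def)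
  define p where "p = AH z * v $ 1 + BH z * v $ 2"
  define q where "q = Ar z * v $ 1 + Br z * v $ 2"
  have "v \<bullet> (hessian u x *v v) = N11 z * (v $ 1 * v $ 1) + 2 * N12 z * (v $ 1 * v $ 2) + N22 z * (v $ 2 * v $ 2)"
    by (simp add: inner_vec_def sum_2 matrix_vector_mult_def hessian_u[OF assms] z_def algebra_simps)
  also have "\<dots> = (p\<^sup>2 + (q / snd z)\<^sup>2) / K z"
    using z by (simp add: N11_def N12_def N22_def p_def q_def power2_eq_square field_simps)
  finally have *: "v \<bullet> (hessian u x *v v) = (p\<^sup>2 + (q / snd z)\<^sup>2) / K z" .
  \<comment> \<open>p and q are linear forms in v with determinant \<open>K z\<close>, so they
    vanish together only at \<open>v = 0\<close>.\<close>
  have "p \<noteq> 0 \<or> q \<noteq> 0"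
  proof (rule ccontr)
    assume "\<not> (p \<noteq> 0 \<or> q \<noteq> 0)"
    then have "p * Br z - BH z * q = 0" "AH z * q - p * Ar z = 0" by auto
    then have "K z * v $ 1 = 0" "K z * v $ 2 = 0" by (auto simp: K_def p_def q_def algebra_simps)
    then show False using v z by (simp add: vec_eq_iff forall_2)
  qed
  then have "0 < p\<^sup>2 + (q / snd z)\<^sup>2" using z by (auto intro: add_pos_nonneg add_nonneg_pos)
  then show "0 < v \<bullet> (hessian u x *v v)" using * z by simp
qed

text \<open>The rows of the inverse Hessian have the divergences \<open>- 2 \<partial>H/\<partial>x\<^sub>2\<close> and \<open>2 \<partial>H/\<partial>x\<^sub>1\<close>.\<close>

lemma scalar_flat_u: "scalar_flat U u"
  unfolding scalar_flat_def
proof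
  fix x assume x: "x \<in> U"
  define R where "R = (\<lambda>x. (snd (hp x))\<^sup>2)"
  \<comment> \<open>As the Hessian has determinant \<open>1 / r\<^sup>2\<close>, its inverse is
    \<open>r\<^sup>2\<close> times the cofactor matrix. The equal off-diagonal entries are written
    through different components, so that each cofactor row is a rotated gradient; it is divergence
    free and only derivatives of \<open>r\<^sup>2\<close> survive.\<close>
  define V11 where "V11 = (\<lambda>x. R x * partial 2 Xi2 x)"
  define V12 where "V12 = (\<lambda>x. R x * (- partial 1 Xi2 x))"
  define V21 where "V21 = (\<lambda>x. R x * (- partial 2 Xi1 x))"
  define V22 where "V22 = (\<lambda>x. R x * partial 1 Xi1 x)"
  define h where "h = (\<lambda>x. fst (hp x))"
  have Rsm: "smooth_on U R" unfolding R_def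
    by (intro smooth_on_power open_U smooth_on_comp_hp smooth_on_snd open_half_plane)
  have hsm: "smooth_on U h" unfolding h_def
    by (intro open_U smooth_on_comp_hp smooth_on_fst open_half_plane)
  note psm = smooth_on_partial[OF smooth_on_Xi(1)] smooth_on_partial[OF smooth_on_Xi(2)]
  note nsm = psm[THEN smooth_on_minus[OF open_U]]
  have Vsm: "smooth_on U V11" "smooth_on U V12" "smooth_on U V21" "smooth_on U V22"
    unfolding V11_def V12_def V21_def V22_def by (intro smooth_on_mult open_U Rsm psm nsm)+
  have neg: "partial i (\<lambda>y. - f y) y = - partial i f y" if "smooth_on U f" "y \<in> U" for i f y
    using partial_eq[OF has_derivative_minus[OF smooth_on_has_derivative[OF that]], of i]
    by (simp add: partial_def)
  have inv: "matrix_inv (hessian u y) $ 1 $ 1 = V11 y" "matrix_inv (hessian u y) $ 1 $ 2 = V12 y"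
    "matrix_inv (hessian u y) $ 2 $ 1 = V21 y" "matrix_inv (hessian u y) $ 2 $ 2 = V22 y" if "y \<in> U" for y
  proof -
    have "det (hessian u y) \<noteq> 0" "snd (hp y) \<noteq> 0"
      using det_hessian_u[OF that] hp_half_plane[OF that] by (auto simp: half_plane_iff)
    then show "matrix_inv (hessian u y) $ 1 $ 1 = V11 y" "matrix_inv (hessian u y) $ 1 $ 2 = V12 y"
      "matrix_inv (hessian u y) $ 2 $ 1 = V21 y" "matrix_inv (hessian u y) $ 2 $ 2 = V22 y"
      by (simp_all add: matrix_inv_2 hessian_u[OF that] partial_Xi[OF that] det_hessian_u[OF that]
          V11_def V12_def V21_def V22_def R_def)
  qed
  have dR: "partial 1 R y = 2 * Ar (hp y) / K (hp y)" "partial 2 R y = 2 * Br (hp y) / K (hp y)"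
    if y: "y \<in> U" for y
  proof -
    let ?z = "hp y"
    have z: "0 < snd ?z" "K ?z \<noteq> 0" using hp_half_plane[OF y] K_nonzero by (auto simp: half_plane_iff)
    have "(R has_derivative (\<lambda>w. 2 * Ar ?z / K ?z * w $ 1 + 2 * Br ?z / K ?z * w $ 2)) (at y)"
      unfolding R_def
      by (rule has_derivative_eq_rhs[OF has_derivative_power[OF hp_has_derivative(2)[OF y]]])
         (use z in \<open>simp add: fun_eq_iff field_simps\<close>)
    then show "partial 1 R y = 2 * Ar (hp y) / K (hp y)" "partial 2 R y = 2 * Br (hp y) / K (hp y)"
      by (rule partial_planar)+
  qed
  have dh: "partial 1 h y = AH (hp y) / K (hp y)" "partial 2 h y = BH (hp y) / K (hp y)" if y: "y \<in> U" for y
    using partial_planar[OF hp_has_derivative(1)[OF y]] by (auto simp: h_def)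
  have W1: "partial 1 V11 y + partial 2 V12 y = - 2 * partial 2 h y" if y: "y \<in> U" for y
  proof -
    have "partial 1 V11 y + partial 2 V12 y
      = partial 1 R y * partial 2 Xi2 y - partial 2 R y * partial 1 Xi2 y"
      unfolding V11_def V12_def partial_mult[OF Rsm psm(2) y] partial_mult[OF Rsm nsm(2) y] neg[OF psm(2) y]
      using partial_commute[OF open_U smooth_on_Xi(2) y, of 1 2] by simp
    also have "\<dots> = - 2 * partial 2 h y"
      using K_nonzero[OF hp_half_plane[OF y]] hp_half_plane[OF y]
      by (simp add: dR[OF y] partial_Xi[OF y] dh[OF y] N12_def N22_def half_plane_iff field_simps)
         (simp add: K_def algebra_simps)
    finally show ?thesis .
  qed
  have W2: "partial 1 V21 y + partial 2 V22 y = 2 * partial 1 h y" if y: "y \<in> U" for y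
  proof -
    have "partial 1 V21 y + partial 2 V22 y
      = partial 2 R y * partial 1 Xi1 y - partial 1 R y * partial 2 Xi1 y"
      unfolding V21_def V22_def partial_mult[OF Rsm psm(1) y] partial_mult[OF Rsm nsm(1) y] neg[OF psm(1) y]
      using partial_commute[OF open_U smooth_on_Xi(1) y, of 1 2] by simp
    also have "\<dots> = 2 * partial 1 h y"
      using K_nonzero[OF hp_half_plane[OF y]] hp_half_plane[OF y]
      by (simp add: dR[OF y] partial_Xi[OF y] dh[OF y] N12_def N11_def half_plane_iff field_simps)
         (simp add: K_def algebra_simps)
    finally show ?thesis .
  qed
  have PP: "partial i (partial j (\<lambda>y. matrix_inv (hessian u y) $ i' $ j')) x = partial i (partial j V) x"
    if "\<And>y. y \<in> U \<Longrightarrow> matrix_inv (hessian u y) $ i' $ j' = V y" for i j i' j' V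
    using that by (intro partial_cong[OF open_U x] partial_cong[OF open_U]) auto
  have scale: "partial i (\<lambda>y. c * f y) x = c * partial i f x" if "smooth_on U f" for i f and c :: real
    using partial_mult[OF smooth_on_const[of U c] that x] partial_eq[OF has_derivative_const[of c "at x"]] by simp
  have "partial 1 (partial 1 V11) x + partial 1 (partial 2 V12) x = - 2 * partial 1 (partial 2 h) x"
    unfolding partial_add[OF smooth_on_partial[OF Vsm(1)] smooth_on_partial[OF Vsm(2)] x, symmetric]
      scale[OF smooth_on_partial[OF hsm], symmetric]
    by (rule partial_cong[OF open_U x W1])
  moreover have "partial 2 (partial 1 V21) x + partial 2 (partial 2 V22) x = 2 * partial 2 (partial 1 h) x"
    unfolding partial_add[OF smooth_on_partial[OF Vsm(3)] smooth_on_partial[OF Vsm(4)] x, symmetric]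
      scale[OF smooth_on_partial[OF hsm], symmetric]
    by (rule partial_cong[OF open_U x W2])
  ultimately have sum0: "(partial 1 (partial 1 V11) x + partial 1 (partial 2 V12) x)
      + (partial 2 (partial 1 V21) x + partial 2 (partial 2 V22) x) = 0"
    using partial_commute[OF open_U hsm x, of 1 2] by simp
  show "(\<Sum>i\<in>UNIV. \<Sum>j\<in>UNIV. partial i (partial j (\<lambda>y. matrix_inv (hessian u y) $ i $ j)) x) = 0"
    unfolding sum_2
    using sum0 PP[of 1 1 V11 1 1] PP[of 1 2 V12 1 2] PP[of 2 1 V21 2 1] PP[of 2 2 V22 2 2] inv
    by (simp only: refl)
qed

end

section \<open>Behaviour of the potential near the boundary\<close>

text \<open>Near the corner between the edges k and k+1 the coordinates \<open>y = (\<rho>\<^sub>k + H\<^sub>k, \<rho>\<^sub>k - H\<^sub>k)\<close>, with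
  \<open>H\<^sub>k = H + a k\<close>, resolve the square root singularity of \<open>\<rho>\<^sub>k\<close>; the product of the two is \<open>r\<^sup>2\<close>.
  All other \<open>\<rho>\<^sub>i\<close> remain smooth across the boundary of the quadrant.\<close>

locale toric_corner = toric_potential +
  fixes k :: nat
  assumes k: "1 \<le> k" "k < d"
begin

definition Hk :: "real \<times> real \<Rightarrow> real" where "Hk y = (fst y - snd y) / 2 - a k"
definition h :: "nat \<Rightarrow> real \<times> real \<Rightarrow> real" where "h i y = (fst y - snd y) / 2 + (a i - a k)"
definition Q :: "nat \<Rightarrow> real \<times> real \<Rightarrow> real" where "Q i y = sqrt ((h i y)\<^sup>2 + fst y * snd y)"
text \<open>The sign of \<open>h i\<close> at the corner. It selects in \<open>w i\<close> the one
  of \<open>Q i + h i\<close> and \<open>Q i - h i\<close> that stays away from 0; the other is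
  \<open>fst y * snd y / w i\<close>.\<close>

definition sg :: "nat \<Rightarrow> real" where "sg i = (if i < k then -1 else 1)"
definition w :: "nat \<Rightarrow> real \<times> real \<Rightarrow> real" where "w i y = Q i y + sg i * h i y"
definition I :: "nat set" where "I = {1..d-1} - {k}"
text \<open>The product \<open>fst y * snd y\<close> may be negative here, so points on the axes are
  interior points of the chart.\<close>

definition Dom :: "(real \<times> real) set" where
  "Dom = {y. \<forall>i\<in>I. 0 < (h i y)\<^sup>2 + fst y * snd y \<and> 0 < w i y}"

text \<open>For w, T, S and \<gamma> the suffixes 1 and 2 denote the partial derivatives in the two
  coordinates.\<close>

definition w1 :: "nat \<Rightarrow> real \<times> real \<Rightarrow> real" where "w1 i y = (h i y + snd y) / (2 * Q i y) + sg i / 2"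
definition w2 :: "nat \<Rightarrow> real \<times> real \<Rightarrow> real" where "w2 i y = (fst y - h i y) / (2 * Q i y) - sg i / 2"

text \<open>\<open>T\<close> is the factor of \<open>- 1/2 * r\<^sup>2\<close> in
  \<open>conj_fun\<close>, \<open>S\<close> is what remains of \<open>xi_fun\<close> without the
  logarithms of the coordinates, and \<open>Bq\<close> is the increment of \<open>conj_fun\<close>
  from its value at the corner.\<close>

definition T :: "(nat \<Rightarrow> real) \<Rightarrow> real \<Rightarrow> real \<times> real \<Rightarrow> real" where
  "T c n y = (\<Sum>i\<in>I. (c (i+1) - c i) * (1 / w i y)) + n"
definition T1 :: "(nat \<Rightarrow> real) \<Rightarrow> real \<times> real \<Rightarrow> real" where
  "T1 c y = (\<Sum>i\<in>I. (c (i+1) - c i) * (- w1 i y / (w i y)\<^sup>2))"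
definition T2 :: "(nat \<Rightarrow> real) \<Rightarrow> real \<times> real \<Rightarrow> real" where
  "T2 c y = (\<Sum>i\<in>I. (c (i+1) - c i) * (- w2 i y / (w i y)\<^sup>2))"
definition S :: "(nat \<Rightarrow> real) \<Rightarrow> real \<Rightarrow> real \<times> real \<Rightarrow> real" where
  "S c n y = 1/2 * (\<Sum>i\<in>I. (c (i+1) - c i) * (sg i * ln (w i y))) + n * Hk y"
definition S1 :: "(nat \<Rightarrow> real) \<Rightarrow> real \<Rightarrow> real \<times> real \<Rightarrow> real" where
  "S1 c n y = 1/2 * (T c n y + snd y * T2 c y)"
definition S2 :: "(nat \<Rightarrow> real) \<Rightarrow> real \<Rightarrow> real \<times> real \<Rightarrow> real" where
  "S2 c n y = - 1/2 * (T c n y + fst y * T1 c y)"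
definition Bq :: "(nat \<Rightarrow> real) \<Rightarrow> real \<Rightarrow> real \<times> real \<Rightarrow> real" where
  "Bq c n y = 1/2 * c k * fst y - 1/2 * c (k+1) * snd y - 1/2 * (fst y * snd y * T c n y)"

lemma finite_I: "finite I" by (simp add: I_def)

lemma sum_I: "(\<Sum>i=1..d-1. f i) = f k + (\<Sum>i\<in>I. (f i :: real))"
  unfolding I_def using k by (intro sum.remove) auto

lemma sum_I_split: "(\<Sum>i\<in>I. (f i :: real)) = (\<Sum>i=1..k-1. f i) + (\<Sum>i=k+1..d-1. f i)"
proof -
  have "I = {1..k-1} \<union> {k+1..d-1}" using k by (auto simp: I_def)
  then show ?thesis by (simp add: sum.union_disjoint)
qed

lemma sum_I_sg: "(\<Sum>i\<in>I. (c (i+1) - c i) * sg i) = (c d - c (k+1)) - (c k - c 1)"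
proof -
  have "(\<Sum>i=1..k-1. (c (i+1) - c i) * sg i) = - (\<Sum>i=1..k-1. c (i+1) - c i)"
    using k unfolding sum_negf[symmetric] by (intro sum.cong) (auto simp: sg_def)
  moreover have "(\<Sum>i=k+1..d-1. (c (i+1) - c i) * sg i) = (\<Sum>i=k+1..d-1. c (i+1) - c i)"
    by (intro sum.cong) (auto simp: sg_def)
  ultimately show ?thesis
    using sum_telescope_nat(1)[of k d c] sum_telescope_nat(2)[of "k+1" d c] k by (simp add: sum_I_split)
qed

lemma sg_sq: "sg i * sg i = 1" by (simp add: sg_def)

lemma Dom_pos: "y \<in> Dom \<Longrightarrow> i \<in> I \<Longrightarrow> 0 < Q i y" "y \<in> Dom \<Longrightarrow> i \<in> I \<Longrightarrow> 0 < w i y"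
  by (auto simp: Dom_def Q_def)

lemma Q_sq: "y \<in> Dom \<Longrightarrow> i \<in> I \<Longrightarrow> Q i y * Q i y = h i y * h i y + fst y * snd y"
  by (auto simp: Dom_def Q_def power2_eq_square)

text \<open>Rationalisation: \<open>w i\<close> times its conjugate is
  \<open>Q\<^sup>2 - h\<^sup>2\<close>, the product of the coordinates.\<close>

lemma w_conj: "y \<in> Dom \<Longrightarrow> i \<in> I \<Longrightarrow> Q i y = sg i * h i y + fst y * snd y / w i y"
proof -
  assume y: "y \<in> Dom" "i \<in> I"
  have "(Q i y - sg i * h i y) * w i y = Q i y * Q i y - (sg i * sg i) * (h i y * h i y)"
    by (simp add: w_def algebra_simps)
  also have "\<dots> = fst y * snd y" using Q_sq[OF y] by (simp add: sg_sq)
  finally show ?thesis using Dom_pos(2)[OF y] by (simp add: field_simps)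
qed

lemma continuous_on_h: "continuous_on UNIV (h i)"
  unfolding h_def[abs_def] by (intro continuous_intros) auto

lemma open_Dom: "open Dom"
proof -
  have c: "continuous_on UNIV (\<lambda>y. (h i y)\<^sup>2 + fst y * snd y)" for i
    by (intro continuous_intros continuous_on_h)
  moreover have "continuous_on UNIV (w i)" for i
    unfolding w_def[abs_def] Q_def by (intro continuous_on_add continuous_on_real_sqrt c
        continuous_on_mult continuous_on_const continuous_on_h)
  ultimately have o: "open {y. 0 < (h i y)\<^sup>2 + fst y * snd y \<and> 0 < w i y}" for i
    by (intro open_Collect_conj open_Collect_less continuous_on_const)
  have e: "Dom = (\<Inter>i\<in>I. {y. 0 < (h i y)\<^sup>2 + fst y * snd y \<and> 0 < w i y})" by (auto simp: Dom_def)
  show ?thesis unfolding e by (intro open_INT finite_I ballI o)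
qed

lemma smooth_on_coord: "smooth_on Dom fst" "smooth_on Dom snd"
  by (intro smooth_on_fst smooth_on_snd open_Dom)+

lemma smooth_on_half: "smooth_on Dom f \<Longrightarrow> smooth_on Dom (\<lambda>y. f y / 2)" for f :: "real \<times> real \<Rightarrow> real"
  by (intro smooth_on_divide smooth_on_const open_Dom) auto

lemma smooth_on_h: "smooth_on Dom (h i)"
  unfolding h_def[abs_def] by (intro smooth_on_add smooth_on_half smooth_on_diff smooth_on_const smooth_on_coord open_Dom)

lemma smooth_on_Q: "i \<in> I \<Longrightarrow> smooth_on Dom (Q i)"
  unfolding Q_def[abs_def]
  by (intro smooth_on_sqrt smooth_on_add smooth_on_power smooth_on_mult smooth_on_h smooth_on_coord open_Dom)
     (auto simp: Dom_def)

lemma smooth_on_w: "i \<in> I \<Longrightarrow> smooth_on Dom (w i)"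
  unfolding w_def[abs_def]
  by (intro smooth_on_add smooth_on_mult smooth_on_const smooth_on_Q smooth_on_h open_Dom)

lemma smooth_on_w12: "i \<in> I \<Longrightarrow> smooth_on Dom (w1 i)" "i \<in> I \<Longrightarrow> smooth_on Dom (w2 i)"
  unfolding w1_def[abs_def] w2_def[abs_def]
  by (intro smooth_on_add smooth_on_diff smooth_on_mult smooth_on_divide smooth_on_const smooth_on_Q
      smooth_on_h smooth_on_coord open_Dom; use Dom_pos in force)+

lemma smooth_on_T: "smooth_on Dom (T c n)" "smooth_on Dom (T1 c)" "smooth_on Dom (T2 c)"
  unfolding T_def[abs_def] T1_def[abs_def] T2_def[abs_def]
  by (intro smooth_on_add smooth_on_sum smooth_on_mult smooth_on_divide smooth_on_power smooth_on_minus
      smooth_on_const smooth_on_w smooth_on_w12 open_Dom; use Dom_pos in force)+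

lemma smooth_on_S12: "smooth_on Dom (S1 c n)" "smooth_on Dom (S2 c n)"
  unfolding S1_def[abs_def] S2_def[abs_def]
  by (intro smooth_on_add smooth_on_mult smooth_on_const smooth_on_T smooth_on_coord open_Dom)+

lemma w_has_derivative:
  assumes "y \<in> Dom" "i \<in> I"
  shows "(w i has_derivative (\<lambda>v. w1 i y * fst v + w2 i y * snd v)) (at y)"
proof -
  have pos: "0 < (h i y)\<^sup>2 + fst y * snd y" using assms by (auto simp: Dom_def)
  have h: "(h i has_derivative (\<lambda>v. (fst v - snd v) / 2)) (at y)"
    unfolding h_def[abs_def] by (auto intro!: derivative_eq_intros)
  have q: "((\<lambda>y. (h i y)\<^sup>2 + fst y * snd y) has_derivative
     (\<lambda>v. h i y * (fst v - snd v) + (fst y * snd v + fst v * snd y))) (at y)"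
    by (auto intro!: derivative_eq_intros h)
  have "((\<lambda>y. sqrt ((h i y)\<^sup>2 + fst y * snd y)) has_derivative
     (\<lambda>v. (h i y * (fst v - snd v) + (fst y * snd v + fst v * snd y)) * (inverse (Q i y) / 2))) (at y)"
    using has_derivative_real_sqrt[OF pos q] by (simp add: Q_def)
  then have "(w i has_derivative (\<lambda>v. (h i y * (fst v - snd v) + (fst y * snd v + fst v * snd y))
      * (inverse (Q i y) / 2) + sg i * ((fst v - snd v) / 2))) (at y)"
    unfolding w_def[abs_def] Q_def[abs_def] by (intro has_derivative_add has_derivative_mult_right h) 
  then show ?thesis
    by (rule has_derivative_eq_rhs) (use Dom_pos(1)[OF assms] in \<open>simp add: fun_eq_iff w1_def w2_def field_simps\<close>)
qed

text \<open>Relations of Cauchy-Riemann type. Summed over i, they make the derivatives of S half the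
  derivative of \<open>snd y * T\<close> in the second coordinate and minus half that of
  \<open>fst y * T\<close> in the first.\<close>

lemma w_relations:
  assumes "y \<in> Dom" "i \<in> I"
  shows "sg i * w1 i y * w i y = w i y - snd y * w2 i y"
    and "sg i * w2 i y * w i y = - (w i y - fst y * w1 i y)"
proof -
  let ?Q = "Q i y" and ?h = "h i y" and ?g = "sg i"
  have Q: "?Q \<noteq> 0" "?Q * ?Q = ?h * ?h + fst y * snd y" and g: "?g * ?g = 1"
    using Dom_pos(1)[OF assms] Q_sq[OF assms] sg_sq by auto
  have W: "w1 i y = (?h + snd y + ?g * ?Q) / (2 * ?Q)" "w2 i y = (fst y - ?h - ?g * ?Q) / (2 * ?Q)"
    using Q by (simp_all add: w1_def w2_def field_simps)
  have alg: "(W * (2 * ?Q) - s * N) / (2 * ?Q) = W - s * (N / (2 * ?Q))" for W s N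
    using Q(1) by (simp add: diff_divide_distrib)
  have E1: "?g * (?h + snd y + ?g * ?Q) * (?Q + ?g * ?h) = (?Q + ?g * ?h) * (2 * ?Q) - snd y * (fst y - ?h - ?g * ?Q)"
    using Q(2) g by algebra
  have "?g * w1 i y * w i y = (?g * (?h + snd y + ?g * ?Q) * (?Q + ?g * ?h)) / (2 * ?Q)"
    unfolding W w_def by simp
  also have "\<dots> = w i y - snd y * w2 i y"
    unfolding E1 W w_def by (rule alg)
  finally show "?g * w1 i y * w i y = w i y - snd y * w2 i y" .
  have E2: "?g * (fst y - ?h - ?g * ?Q) * (?Q + ?g * ?h) = - ((?Q + ?g * ?h) * (2 * ?Q) - fst y * (?h + snd y + ?g * ?Q))"
    using Q(2) g by algebra
  have "?g * w2 i y * w i y = (?g * (fst y - ?h - ?g * ?Q) * (?Q + ?g * ?h)) / (2 * ?Q)"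
    unfolding W w_def by simp
  also have "\<dots> = - (w i y - fst y * w1 i y)"
    unfolding E2 W w_def alg[symmetric] by (simp only: minus_divide_left)
  finally show "?g * w2 i y * w i y = - (w i y - fst y * w1 i y)" .
qed

lemma T_has_derivative:
  assumes y: "y \<in> Dom"
  shows "(T c n has_derivative (\<lambda>v. T1 c y * fst v + T2 c y * snd v)) (at y)"
proof -
  have "((\<lambda>y. 1 / w i y) has_derivative (\<lambda>v. - w1 i y / (w i y)\<^sup>2 * fst v + - w2 i y / (w i y)\<^sup>2 * snd v)) (at y)"
    if "i \<in> I" for i
  proof -
    have nz: "w i y \<noteq> 0" using Dom_pos(2)[OF y that] by simp
    show ?thesis
      by (rule has_derivative_eq_rhs[OF has_derivative_divide[OF has_derivative_const w_has_derivative[OF y that] nz]])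
         (use nz in \<open>simp add: fun_eq_iff power2_eq_square field_simps\<close>)
  qed
  then have "(T c n has_derivative (\<lambda>v. (\<Sum>i\<in>I. (c (i+1) - c i) *
      (- w1 i y / (w i y)\<^sup>2 * fst v + - w2 i y / (w i y)\<^sup>2 * snd v)) + 0)) (at y)"
    unfolding T_def[abs_def]
    by (intro has_derivative_add has_derivative_sum has_derivative_mult_right has_derivative_const)
  moreover have "(\<Sum>i\<in>I. (c (i+1) - c i) * (- w1 i y / (w i y)\<^sup>2 * p + - w2 i y / (w i y)\<^sup>2 * q)) + 0
      = T1 c y * p + T2 c y * q" for p q
    unfolding T1_def T2_def sum_distrib_right sum.distrib[symmetric] add_0_right
    by (intro sum.cong refl) (simp only: distrib_left mult.assoc)
  ultimately show ?thesis by (simp only:)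
qed

lemma S_has_derivative:
  assumes y: "y \<in> Dom"
  shows "(S c n has_derivative (\<lambda>v. S1 c n y * fst v + S2 c n y * snd v)) (at y)"
proof -
  have "((\<lambda>y. sg i * ln (w i y)) has_derivative
      (\<lambda>v. (1 / w i y + snd y * (- w2 i y / (w i y)\<^sup>2)) * fst v
        - (1 / w i y + fst y * (- w1 i y / (w i y)\<^sup>2)) * snd v)) (at y)"
    if i: "i \<in> I" for i
  proof -
    have pos: "0 < w i y" using Dom_pos(2)[OF y i] .
    have 1: "sg i * w1 i y / w i y = 1 / w i y + snd y * (- w2 i y / (w i y)\<^sup>2)"
      using w_relations(1)[OF y i] pos by (simp add: power2_eq_square field_simps)
    have 2: "sg i * w2 i y / w i y = - (1 / w i y + fst y * (- w1 i y / (w i y)\<^sup>2))"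
      using w_relations(2)[OF y i] pos by (simp add: power2_eq_square field_simps)
    have "((\<lambda>y. sg i * ln (w i y)) has_derivative
      (\<lambda>v. sg i * ((w1 i y * fst v + w2 i y * snd v) * inverse (w i y)))) (at y)"
      by (rule derivative_eq_intros w_has_derivative[OF y i] pos refl | simp add: pos fun_eq_iff mult.commute)+
    moreover have "sg i * ((w1 i y * p + w2 i y * q) * inverse (w i y))
       = (1 / w i y + snd y * (- w2 i y / (w i y)\<^sup>2)) * p
        - (1 / w i y + fst y * (- w1 i y / (w i y)\<^sup>2)) * q" for p q
    proof -
      have "sg i * ((w1 i y * p + w2 i y * q) * inverse (w i y))
        = (sg i * w1 i y / w i y) * p + (sg i * w2 i y / w i y) * q"
        by (simp add: divide_inverse algebra_simps)
      then show ?thesis unfolding 1 2 by (simp only: mult_minus_left diff_conv_add_uminus)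
    qed
    ultimately show ?thesis by (simp only:)
  qed
  moreover have "(Hk has_derivative (\<lambda>v. (fst v - snd v) / 2)) (at y)"
    unfolding Hk_def[abs_def] by (auto intro!: derivative_eq_intros)
  ultimately have "(S c n has_derivative (\<lambda>v. 1/2 * (\<Sum>i\<in>I. (c (i+1) - c i) *
      ((1 / w i y + snd y * (- w2 i y / (w i y)\<^sup>2)) * fst v
        - (1 / w i y + fst y * (- w1 i y / (w i y)\<^sup>2)) * snd v)) + n * ((fst v - snd v) / 2))) (at y)"
    unfolding S_def[abs_def]
    by (intro has_derivative_add has_derivative_sum has_derivative_mult_right)
  moreover have "1/2 * (\<Sum>i\<in>I. (c (i+1) - c i) *
      ((1 / w i y + snd y * (- w2 i y / (w i y)\<^sup>2)) * p
        - (1 / w i y + fst y * (- w1 i y / (w i y)\<^sup>2)) * q)) + n * ((p - q) / 2)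
      = S1 c n y * p + S2 c n y * q" for p q
  proof -
    have "(\<Sum>i\<in>I. (c (i+1) - c i) *
      ((1 / w i y + snd y * (- w2 i y / (w i y)\<^sup>2)) * p
        - (1 / w i y + fst y * (- w1 i y / (w i y)\<^sup>2)) * q))
      = ((\<Sum>i\<in>I. (c (i+1) - c i) * (1 / w i y)) + snd y * (\<Sum>i\<in>I. (c (i+1) - c i) * (- w2 i y / (w i y)\<^sup>2))) * p
       - ((\<Sum>i\<in>I. (c (i+1) - c i) * (1 / w i y)) + fst y * (\<Sum>i\<in>I. (c (i+1) - c i) * (- w1 i y / (w i y)\<^sup>2))) * q"
      unfolding sum_distrib_left sum.distrib[symmetric] sum_distrib_right sum_subtractf[symmetric]
      by (intro sum.cong refl) (simp only: algebra_simps)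
    also have "\<dots> = (T c n y - n + snd y * T2 c y) * p - (T c n y - n + fst y * T1 c y) * q"
      by (simp add: T_def T1_def T2_def)
    finally have E: "(\<Sum>i\<in>I. (c (i+1) - c i) *
      ((1 / w i y + snd y * (- w2 i y / (w i y)\<^sup>2)) * p
        - (1 / w i y + fst y * (- w1 i y / (w i y)\<^sup>2)) * q))
      = (T c n y - n + snd y * T2 c y) * p - (T c n y - n + fst y * T1 c y) * q" .
    show ?thesis unfolding E S1_def S2_def by (simp add: field_simps)
  qed
  ultimately show ?thesis by simp
qed

lemma Bq_has_derivative:
  assumes y: "y \<in> Dom"
  shows "(Bq c n has_derivative (\<lambda>v. (1/2 * c k + snd y * S2 c n y) * fst v
    + (- 1/2 * c (k+1) - fst y * S1 c n y) * snd v)) (at y)"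
  unfolding Bq_def[abs_def]
  by (rule derivative_eq_intros T_has_derivative[OF y] refl
      | simp add: fun_eq_iff S1_def S2_def algebra_simps)+

section \<open>The map and the components of xi in corner coordinates\<close>

definition half_point :: "real \<times> real \<Rightarrow> real \<times> real" where
  "half_point y = (Hk y, sqrt (fst y * snd y))"

lemma radius_half_point:
  assumes "0 \<le> fst y" "0 \<le> snd y"
  shows "radius a i (Hk y) (sqrt (fst y * snd y)) = Q i y"
    "radius a k (Hk y) (sqrt (fst y * snd y)) = (fst y + snd y) / 2"
proof -
  have *: "(sqrt (fst y * snd y))\<^sup>2 = fst y * snd y" using assms by simp
  show "radius a i (Hk y) (sqrt (fst y * snd y)) = Q i y"
    unfolding radius_def * by (simp add: Q_def Hk_def h_def algebra_simps)
  have "(Hk y + a k)\<^sup>2 + fst y * snd y = ((fst y + snd y) / 2)\<^sup>2"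
    by (simp add: Hk_def power2_eq_square field_simps)
  then show "radius a k (Hk y) (sqrt (fst y * snd y)) = (fst y + snd y) / 2"
    unfolding radius_def * using assms by simp
qed

text \<open>By \<open>w_conj\<close> every other radius is affine in y plus
  \<open>fst y * snd y / w i\<close>, and the radius of node k is half the sum of the coordinates;
  no square root singularity is left.\<close>

lemma conj_fun_half_point:
  assumes y: "y \<in> Dom" "0 \<le> fst y" "0 \<le> snd y"
  shows "conj_fun d a c n (Hk y) (sqrt (fst y * snd y)) = conj_fun d a c 0 (- a k) 0 + Bq c n y"
proof -
  let ?\<delta> = "\<lambda>i. c (i+1) - c i"
  have corner: "radius a i (- a k) 0 = sg i * (a i - a k)" if "i \<in> I" for i
    using that a_le[of i k] a_le[of k i] k by (auto simp: radius_0 sg_def I_def not_less)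
  have 0: "radius a k (- a k) 0 = 0" by (simp add: radius_0)
  have "(\<Sum>i\<in>I. ?\<delta> i * radius a i (Hk y) (sqrt (fst y * snd y)))
      = (\<Sum>i\<in>I. ?\<delta> i * (sg i * (a i - a k)) + ?\<delta> i * sg i * ((fst y - snd y) / 2)
        + ?\<delta> i * (1 / w i y) * (fst y * snd y))"
  proof (intro sum.cong refl)
    fix i assume i: "i \<in> I"
    have "radius a i (Hk y) (sqrt (fst y * snd y))
        = sg i * (a i - a k) + sg i * ((fst y - snd y) / 2) + fst y * snd y / w i y"
      using w_conj[OF y(1) i] radius_half_point(1)[OF y(2,3), of i] by (simp add: h_def distrib_left)
    then show "?\<delta> i * radius a i (Hk y) (sqrt (fst y * snd y))
      = ?\<delta> i * (sg i * (a i - a k)) + ?\<delta> i * sg i * ((fst y - snd y) / 2) + ?\<delta> i * (1 / w i y) * (fst y * snd y)"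
      by (simp add: distrib_left mult.assoc)
  qed
  also have "\<dots> = (\<Sum>i\<in>I. ?\<delta> i * (sg i * (a i - a k))) + (\<Sum>i\<in>I. ?\<delta> i * sg i) * ((fst y - snd y) / 2)
      + (\<Sum>i\<in>I. ?\<delta> i * (1 / w i y)) * (fst y * snd y)"
    by (simp add: sum.distrib sum_distrib_right)
  also have "(\<Sum>i\<in>I. ?\<delta> i * (1 / w i y)) = T c n y - n" by (simp add: T_def)
  also have "(\<Sum>i\<in>I. ?\<delta> i * (sg i * (a i - a k))) = (\<Sum>i\<in>I. ?\<delta> i * radius a i (- a k) 0)"
    using corner by simp
  finally have E: "(\<Sum>i\<in>I. ?\<delta> i * radius a i (Hk y) (sqrt (fst y * snd y)))
      = (\<Sum>i\<in>I. ?\<delta> i * radius a i (- a k) 0) + ((c d - c (k+1)) - (c k - c 1)) * ((fst y - snd y) / 2)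
        + (T c n y - n) * (fst y * snd y)"
    unfolding sum_I_sg .
  have r: "(sqrt (fst y * snd y))\<^sup>2 = fst y * snd y" using y by simp
  show ?thesis
    unfolding conj_fun_def sum_I E radius_half_point(2)[OF y(2,3)] 0 r Bq_def
    by (simp add: Hk_def field_simps)
qed

text \<open>For a node before k the argument of the logarithm tends to 0 like the product of the
  coordinates. Collected together with node k and \<open>c 1 * ln r\<close>, these logarithms
  telescope to half the components of the two normals at the corner.\<close>

lemma xi_fun_half_point:
  assumes y: "y \<in> Dom" "0 < fst y" "0 < snd y"
  shows "xi_fun d a c n (Hk y) (sqrt (fst y * snd y))
    = 1/2 * c (k+1) * ln (fst y) + 1/2 * c k * ln (snd y) + S c n y"
proof -
  let ?\<delta> = "\<lambda>i. c (i+1) - c i" and ?l = "ln (fst y) + ln (snd y)"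
  have le: "0 \<le> fst y" "0 \<le> snd y" using y by auto
  let ?f = "\<lambda>i. ln (Hk y + a i + sqrt ((Hk y + a i)\<^sup>2 + (sqrt (fst y * snd y))\<^sup>2))"
  have f: "?f i = ln (h i y + Q i y)" for i
    using radius_half_point(1)[OF le, of i] unfolding radius_def by (simp add: Hk_def h_def algebra_simps)
  have fk: "?f k = ln (fst y)"
    using radius_half_point(2)[OF le] unfolding radius_def by (simp add: Hk_def field_simps)
  \<comment> \<open>\<open>(1 - sg i) / 2\<close> is the indicator of \<open>i < k\<close>.\<close>
  have fi: "?f i = (1 - sg i) / 2 * ?l + sg i * ln (w i y)" if i: "i \<in> I" for i
  proof (cases "i < k")
    case True
    then have "h i y + Q i y = fst y * snd y / w i y" using w_conj[OF y(1) i] by (simp add: sg_def)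
    then show ?thesis unfolding f using True y Dom_pos(2)[OF y(1) i] by (simp add: sg_def ln_div ln_mult)
  next
    case False
    then show ?thesis unfolding f by (simp add: sg_def w_def add.commute)
  qed
  have "(\<Sum>i\<in>I. ?\<delta> i * ?f i) = (\<Sum>i\<in>I. ?\<delta> i * ((1 - sg i) / 2 * ?l + sg i * ln (w i y)))"
    using fi by (intro sum.cong refl) simp
  also have "\<dots> = ((\<Sum>i\<in>I. ?\<delta> i) - (\<Sum>i\<in>I. ?\<delta> i * sg i)) / 2 * ?l + (\<Sum>i\<in>I. ?\<delta> i * (sg i * ln (w i y)))"
    unfolding sum_subtractf[symmetric] sum_divide_distrib sum_distrib_right sum.distrib[symmetric]
    by (intro sum.cong refl) (simp add: field_simps)
  also have "(\<Sum>i\<in>I. ?\<delta> i) = (c d - c (k+1)) + (c k - c 1)"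
    using sum_telescope_nat(1)[of k d c] sum_telescope_nat(2)[of "k+1" d c] k by (simp add: sum_I_split)
  finally have E: "(\<Sum>i\<in>I. ?\<delta> i * ?f i) = (c k - c 1) * ?l + (\<Sum>i\<in>I. ?\<delta> i * (sg i * ln (w i y)))"
    unfolding sum_I_sg by simp
  have r: "ln (sqrt (fst y * snd y)) = ?l / 2" using y by (simp add: ln_sqrt ln_mult)
  show ?thesis
    unfolding xi_fun_def sum_I E fk r S_def by (simp add: field_simps)
qed

text \<open>The extension of X across the boundary: smooth on all of \<open>Dom\<close>, equal to X
  on the closed quadrant.\<close>

definition Z1 :: "real \<times> real \<Rightarrow> real" where "Z1 y = q1 + conj_fun d a B 0 (- a k) 0 + Bq B n2 y"
definition Z2 :: "real \<times> real \<Rightarrow> real" where "Z2 y = q2 - conj_fun d a A 0 (- a k) 0 - Bq A n1 y"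

lemma X_half_point:
  assumes "y \<in> Dom" "0 \<le> fst y" "0 \<le> snd y"
  shows "X (half_point y) = (Z1 y, Z2 y)"
  using conj_fun_half_point[OF assms]
  by (simp add: X_def X1_def X2_def Z1_def Z2_def half_point_def)

definition \<kappa> :: real where "\<kappa> = - D k (k+1)"
text \<open>The quotients of the edge functions k+1 and k by their coordinates, as
  \<open>L_Z\<close> shows. Both are \<open>\<kappa> / 2\<close> at the corner; \<open>M1\<close>
  stays so on the axis \<open>snd y = 0\<close> and \<open>M2\<close> on
  \<open>fst y = 0\<close>.\<close>

definition M1 :: "real \<times> real \<Rightarrow> real" where
  "M1 y = 1/2 * \<kappa> + 1/2 * (snd y * (T A n1 y * B (k+1) - T B n2 y * A (k+1)))"
definition M2 :: "real \<times> real \<Rightarrow> real" where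
  "M2 y = 1/2 * \<kappa> + 1/2 * (fst y * (T A n1 y * B k - T B n2 y * A k))"

lemma \<kappa>_pos: "0 < \<kappa>" using D_neg[of k "k+1"] k by (simp add: \<kappa>_def)

lemma \<kappa>_eq: "\<kappa> = A (k+1) * B k - B (k+1) * A k" by (simp add: \<kappa>_def D_def)

lemma L_Z: "L (k+1) (Z1 y, Z2 y) = fst y * M1 y" "L k (Z1 y, Z2 y) = snd y * M2 y"
proof -
  have "L (k+1) (Z1 y, Z2 y) = A (k+1) * Bq B n2 y - B (k+1) * Bq A n1 y"
    using corner2[OF k] by (simp add: L_def Z1_def Z2_def algebra_simps)
  also have "\<dots> = fst y * M1 y" by (simp add: Bq_def M1_def \<kappa>_eq algebra_simps)
  finally show "L (k+1) (Z1 y, Z2 y) = fst y * M1 y" .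
  have "L k (Z1 y, Z2 y) = A k * Bq B n2 y - B k * Bq A n1 y"
    using corner1[OF k] by (simp add: L_def Z1_def Z2_def algebra_simps)
  also have "\<dots> = snd y * M2 y" by (simp add: Bq_def M2_def \<kappa>_eq algebra_simps)
  finally show "L k (Z1 y, Z2 y) = snd y * M2 y" .
qed

definition Z11 :: "real \<times> real \<Rightarrow> real" where "Z11 y = 1/2 * B k + snd y * S2 B n2 y"
definition Z12 :: "real \<times> real \<Rightarrow> real" where "Z12 y = - 1/2 * B (k+1) - fst y * S1 B n2 y"
definition Z21 :: "real \<times> real \<Rightarrow> real" where "Z21 y = - (1/2 * A k + snd y * S2 A n1 y)"
definition Z22 :: "real \<times> real \<Rightarrow> real" where "Z22 y = - (- 1/2 * A (k+1) - fst y * S1 A n1 y)"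

lemma Z_has_derivative:
  assumes "y \<in> Dom"
  shows "(Z1 has_derivative (\<lambda>v. Z11 y * fst v + Z12 y * snd v)) (at y)"
    and "(Z2 has_derivative (\<lambda>v. Z21 y * fst v + Z22 y * snd v)) (at y)"
  unfolding Z1_def[abs_def] Z2_def[abs_def]
  by (rule derivative_eq_intros Bq_has_derivative[OF assms] refl
      | simp add: fun_eq_iff Z11_def Z12_def Z21_def Z22_def algebra_simps)+

definition M11 :: "real \<times> real \<Rightarrow> real" where
  "M11 y = 1/2 * (snd y * (T1 A y * B (k+1) - T1 B y * A (k+1)))"
definition M12 :: "real \<times> real \<Rightarrow> real" where
  "M12 y = S1 A n1 y * B (k+1) - S1 B n2 y * A (k+1)"
definition M21 :: "real \<times> real \<Rightarrow> real" where
  "M21 y = - (S2 A n1 y * B k - S2 B n2 y * A k)"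
definition M22 :: "real \<times> real \<Rightarrow> real" where
  "M22 y = 1/2 * (fst y * (T2 A y * B k - T2 B y * A k))"

lemma M_has_derivative:
  assumes "y \<in> Dom"
  shows "(M1 has_derivative (\<lambda>v. M11 y * fst v + M12 y * snd v)) (at y)"
    and "(M2 has_derivative (\<lambda>v. M21 y * fst v + M22 y * snd v)) (at y)"
  unfolding M1_def[abs_def] M2_def[abs_def]
  by (rule derivative_eq_intros T_has_derivative[OF assms] refl
      | simp add: fun_eq_iff M11_def M12_def M21_def M22_def S1_def S2_def algebra_simps)+

text \<open>The product rule for the factorisations in \<open>L_Z\<close>.\<close>

lemma LZ_derivatives:
  "A (k+1) * Z11 y + B (k+1) * Z21 y = M1 y + fst y * M11 y"
  "A (k+1) * Z12 y + B (k+1) * Z22 y = fst y * M12 y"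
  "A k * Z11 y + B k * Z21 y = snd y * M21 y"
  "A k * Z12 y + B k * Z22 y = M2 y + snd y * M22 y"
  by (simp_all add: Z11_def Z12_def Z21_def Z22_def M1_def M2_def M11_def M12_def M21_def M22_def
      S1_def S2_def \<kappa>_eq algebra_simps)

text \<open>\<kappa> is, up to orientation, the determinant of the passage to edge functions. In
  terms of these the derivative matrix is triangular on either axis, with \<open>M1\<close> and
  \<open>M2\<close> on the diagonal up to one term that enters the determinant multiplied by 0 or
  vanishes itself.\<close>

lemma jacobian_Z:
  assumes "fst y = 0 \<or> snd y = 0"
  shows "\<kappa> * (Z11 y * Z22 y - Z12 y * Z21 y) = M1 y * M2 y"
proof -
  have "\<kappa> * (Z11 y * Z22 y - Z12 y * Z21 y)
     = (A (k+1) * Z11 y + B (k+1) * Z21 y) * (A k * Z12 y + B k * Z22 y) * (-1) * (-1)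
       - (A (k+1) * Z12 y + B (k+1) * Z22 y) * (A k * Z11 y + B k * Z21 y)"
    unfolding \<kappa>_eq by (simp add: algebra_simps)
  then show ?thesis unfolding LZ_derivatives using assms by (auto simp: M11_def M22_def)
qed

text \<open>The gradient of the smooth part of the potential.\<close>

definition \<gamma> :: "(nat \<Rightarrow> real) \<Rightarrow> real \<Rightarrow> real \<times> real \<Rightarrow> real" where
  "\<gamma> c n y = S c n y - 1/2 * c (k+1) * ln (M1 y) - 1/2 * c k * ln (M2 y) - 1/2 * (c k + c (k+1))"
definition \<gamma>1 :: "(nat \<Rightarrow> real) \<Rightarrow> real \<Rightarrow> real \<times> real \<Rightarrow> real" where
  "\<gamma>1 c n y = S1 c n y - 1/2 * c (k+1) * (M11 y / M1 y) - 1/2 * c k * (M21 y / M2 y)"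
definition \<gamma>2 :: "(nat \<Rightarrow> real) \<Rightarrow> real \<Rightarrow> real \<times> real \<Rightarrow> real" where
  "\<gamma>2 c n y = S2 c n y - 1/2 * c (k+1) * (M12 y / M1 y) - 1/2 * c k * (M22 y / M2 y)"

lemma \<gamma>_has_derivative:
  assumes "y \<in> Dom" "0 < M1 y" "0 < M2 y"
  shows "(\<gamma> c n has_derivative (\<lambda>v. \<gamma>1 c n y * fst v + \<gamma>2 c n y * snd v)) (at y)"
proof -
  have ln_der: "((\<lambda>y. ln (f y)) has_derivative (\<lambda>v. (p / f y) * fst v + (q / f y) * snd v)) (at y)"
    if "(f has_derivative (\<lambda>v. p * fst v + q * snd v)) (at y)" "0 < f y"
    for f :: "real \<times> real \<Rightarrow> real" and p q
    by (rule derivative_eq_intros that refl | simp add: fun_eq_iff divide_inverse algebra_simps)+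
  have "(\<gamma> c n has_derivative (\<lambda>v. (S1 c n y * fst v + S2 c n y * snd v)
     - 1/2 * c (k+1) * ((M11 y / M1 y) * fst v + (M12 y / M1 y) * snd v)
     - 1/2 * c k * ((M21 y / M2 y) * fst v + (M22 y / M2 y) * snd v) - 0)) (at y)"
    unfolding \<gamma>_def[abs_def]
    by (intro has_derivative_diff has_derivative_mult_right has_derivative_const S_has_derivative ln_der
        M_has_derivative assms)
  then show ?thesis
    by (rule has_derivative_eq_rhs) (simp add: fun_eq_iff \<gamma>1_def \<gamma>2_def algebra_simps)
qed

text \<open>Closedness of \<open>\<gamma> A n1 dZ1 + \<gamma> B n2 dZ2\<close>. As the edge
  functions are the coordinates times \<open>M1\<close> and \<open>M2\<close>, the logarithms of
  \<open>M1\<close> and \<open>M2\<close> contribute single derivatives of these, which cancel the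
  contribution of S.\<close>

lemma \<gamma>_closed:
  assumes "M1 y \<noteq> 0" "M2 y \<noteq> 0"
  shows "\<gamma>1 A n1 y * Z12 y - \<gamma>2 A n1 y * Z11 y + \<gamma>1 B n2 y * Z22 y - \<gamma>2 B n2 y * Z21 y = 0"
proof -
  have "\<gamma>1 A n1 y * Z12 y - \<gamma>2 A n1 y * Z11 y + \<gamma>1 B n2 y * Z22 y - \<gamma>2 B n2 y * Z21 y
    = (S1 A n1 y * Z12 y - S2 A n1 y * Z11 y + S1 B n2 y * Z22 y - S2 B n2 y * Z21 y)
     - 1/2 * (M11 y / M1 y * (A (k+1) * Z12 y + B (k+1) * Z22 y) - M12 y / M1 y * (A (k+1) * Z11 y + B (k+1) * Z21 y))
     - 1/2 * (M21 y / M2 y * (A k * Z12 y + B k * Z22 y) - M22 y / M2 y * (A k * Z11 y + B k * Z21 y))"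
    unfolding \<gamma>1_def \<gamma>2_def by (simp add: algebra_simps)
  also have "M11 y / M1 y * (A (k+1) * Z12 y + B (k+1) * Z22 y) - M12 y / M1 y * (A (k+1) * Z11 y + B (k+1) * Z21 y) = - M12 y"
    unfolding LZ_derivatives using assms by (simp add: field_simps)
  also have "M21 y / M2 y * (A k * Z12 y + B k * Z22 y) - M22 y / M2 y * (A k * Z11 y + B k * Z21 y) = M21 y"
    unfolding LZ_derivatives using assms by (simp add: field_simps)
  also have "S1 A n1 y * Z12 y - S2 A n1 y * Z11 y + S1 B n2 y * Z22 y - S2 B n2 y * Z21 y = - 1/2 * M12 y + 1/2 * M21 y"
    unfolding Z11_def Z12_def Z21_def Z22_def M12_def M21_def by (simp add: algebra_simps)
  finally show ?thesis by simp
qed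

lemma smooth_on_M: "smooth_on Dom M1" "smooth_on Dom M2"
  unfolding M1_def[abs_def] M2_def[abs_def]
  by (intro smooth_on_add smooth_on_diff smooth_on_mult smooth_on_const smooth_on_T smooth_on_coord open_Dom)+

lemma smooth_on_M12: "smooth_on Dom M11" "smooth_on Dom M12" "smooth_on Dom M21" "smooth_on Dom M22"
  unfolding M11_def[abs_def] M12_def[abs_def] M21_def[abs_def] M22_def[abs_def]
  by (intro smooth_on_add smooth_on_diff smooth_on_minus smooth_on_mult smooth_on_const smooth_on_T
      smooth_on_S12 smooth_on_coord open_Dom)+

lemma smooth_on_Z12: "smooth_on Dom Z11" "smooth_on Dom Z12" "smooth_on Dom Z21" "smooth_on Dom Z22"
  unfolding Z11_def[abs_def] Z12_def[abs_def] Z21_def[abs_def] Z22_def[abs_def]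
  by (intro smooth_on_add smooth_on_diff smooth_on_minus smooth_on_mult smooth_on_const
      smooth_on_S12 smooth_on_coord open_Dom)+

definition Dom' :: "(real \<times> real) set" where
  "Dom' = {y \<in> Dom. 0 < M1 y \<and> 0 < M2 y \<and> Z11 y * Z22 y - Z12 y * Z21 y \<noteq> 0}"

lemma open_Dom': "open Dom'"
proof -
  have 1: "open {y \<in> Dom. 0 < f y}" if "smooth_on Dom f" for f :: "real \<times> real \<Rightarrow> real"
    using continuous_open_preimage[OF smooth_on_imp_continuous_on[OF that] open_Dom, of "{0<..}"]
    by (simp add: vimage_def Int_def)
  \<comment> \<open>The square turns being nonzero into a positivity condition.\<close>
  have "smooth_on Dom (\<lambda>y. (Z11 y * Z22 y - Z12 y * Z21 y)\<^sup>2)"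
    by (intro smooth_on_power smooth_on_diff smooth_on_mult smooth_on_Z12 open_Dom)
  from open_Int[OF open_Int[OF 1[OF smooth_on_M(1)] 1[OF smooth_on_M(2)]] 1[OF this]]
  have "open ({y \<in> Dom. 0 < M1 y} \<inter> {y \<in> Dom. 0 < M2 y} \<inter> {y \<in> Dom. 0 < (Z11 y * Z22 y - Z12 y * Z21 y)\<^sup>2})" .
  moreover have "Dom' = {y \<in> Dom. 0 < M1 y} \<inter> {y \<in> Dom. 0 < M2 y} \<inter> {y \<in> Dom. 0 < (Z11 y * Z22 y - Z12 y * Z21 y)\<^sup>2}"
    by (auto simp: Dom'_def)
  ultimately show ?thesis by simp
qed

lemma smooth_on_\<gamma>12: "smooth_on Dom' (\<gamma>1 c n)" "smooth_on Dom' (\<gamma>2 c n)"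
proof -
  have sub: "Dom' \<subseteq> Dom" by (auto simp: Dom'_def)
  note sm = smooth_on_M[THEN smooth_on_subset, OF sub] smooth_on_M12[THEN smooth_on_subset, OF sub]
    smooth_on_S12[THEN smooth_on_subset, OF sub]
  show "smooth_on Dom' (\<gamma>1 c n)" "smooth_on Dom' (\<gamma>2 c n)"
    unfolding \<gamma>1_def[abs_def] \<gamma>2_def[abs_def]
    by (intro smooth_on_diff smooth_on_mult smooth_on_divide smooth_on_const sm open_Dom'; force simp: Dom'_def)+
qed

text \<open>The closed form built from \<gamma> has a primitive f0 in a full neighbourhood of p;
  subtracting f0 and both logarithmic terms from u leaves zero derivative on the polygon side. Both
  terms occur even if only one edge contains p; the other one is smooth there.\<close>

lemma potential_near_boundary:
  assumes y0: "y0 \<in> Dom" "0 < M1 y0" "0 < M2 y0" "fst y0 = 0 \<or> snd y0 = 0"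
    and p: "(p $ 1, p $ 2) = (Z1 y0, Z2 y0)"
  obtains V f y where "open V" "p \<in> V" "smooth_on V f" "isCont y p" "y p = y0" "y ` V \<subseteq> Dom"
    "\<And>x. x \<in> V \<inter> U \<Longrightarrow> u x = 1/2 * (L k (x $ 1, x $ 2) * ln (L k (x $ 1, x $ 2)))
        + 1/2 * (L (k+1) (x $ 1, x $ 2) * ln (L (k+1) (x $ 1, x $ 2))) + f x"
    "\<And>x. x \<in> V \<Longrightarrow> L k (x $ 1, x $ 2) = snd (y x) * M2 (y x)"
    "\<And>x. x \<in> V \<Longrightarrow> L (k+1) (x $ 1, x $ 2) = fst (y x) * M1 (y x)"
    "\<And>x. x \<in> V \<inter> U \<Longrightarrow> 0 < fst (y x) \<and> 0 < snd (y x) \<and> (snd (hp x))\<^sup>2 = fst (y x) * snd (y x)"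
proof -
  have jac: "Z11 y0 * Z22 y0 - Z12 y0 * Z21 y0 \<noteq> 0"
    using jacobian_Z[OF y0(4)] y0(2,3) by auto
  have sub: "Dom' \<subseteq> Dom" by (auto simp: Dom'_def)
  have y0': "y0 \<in> Dom'" using y0 jac by (simp add: Dom'_def)
  note Zd = Z_has_derivative(1)[OF subsetD[OF sub]] Z_has_derivative(2)[OF subsetD[OF sub]]
  note Zs = smooth_on_Z12[THEN smooth_on_subset, OF sub]
  obtain N where N: "open N" "y0 \<in> N" "N \<subseteq> Dom'" "inj_on (\<lambda>y. (Z1 y, Z2 y)) N"
    using planar_locally_injective[OF open_Dom' y0' Zd jac Zs[THEN smooth_on_imp_continuous_on]] by blast
  define Yl where "Yl = inv_into N (\<lambda>y. (Z1 y, Z2 y))"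
  have YZ: "Yl (Z1 y, Z2 y) = y" if "y \<in> N" for y
    unfolding Yl_def using inv_into_f_f[OF N(4) that] by simp
  have jN: "Z11 y * Z22 y - Z12 y * Z21 y \<noteq> 0" if "y \<in> N" for y using that N(3) by (auto simp: Dom'_def)
  note inv = planar_inverse[OF N(1) YZ Zd(1)[OF subsetD[OF N(3)]] Zd(2)[OF subsetD[OF N(3)]] jN
    Zs[THEN smooth_on_subset, OF N(3)]]
  define V0 where "V0 = (\<lambda>y. (Z1 y, Z2 y)) ` N"
  have V0: "open V0" "smooth_on V0 Yl" unfolding V0_def using inv(1,3) by blast+
  let ?pr = "\<lambda>x :: real^2. (x $ 1, x $ 2)"
  have "open (?pr -` V0)"
    by (intro open_vimage[OF V0(1)] linear_continuous_on bounded_linear_pair)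
  moreover have "p \<in> ?pr -` V0" using N(2) p by (auto simp: V0_def)
  ultimately obtain e where e: "0 < e" "ball p e \<subseteq> ?pr -` V0"
    using open_contains_ball by blast
  \<comment> \<open>A ball, because convexity serves twice: for the primitive of \<gamma>, and for
    constancy on \<open>V \<inter> U\<close>.\<close>
  define V where "V = ball p e"
  define y where "y = (\<lambda>x. Yl (?pr x))"
  have VV: "?pr x \<in> V0" if "x \<in> V" for x using that e(2) by (auto simp: V_def)
  have yN: "y x \<in> N" and Zy: "(Z1 (y x), Z2 (y x)) = ?pr x" if x: "x \<in> V" for x
  proof -
    obtain v where "v \<in> N" "?pr x = (Z1 v, Z2 v)" using VV[OF x] by (auto simp: V0_def)
    then show "y x \<in> N" "(Z1 (y x), Z2 (y x)) = ?pr x" by (auto simp: y_def YZ)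
  qed
  have y0p: "y p = y0" using YZ[OF N(2)] p by (simp add: y_def)
  have oV: "open V" "convex V" "p \<in> V" using e(1) by (auto simp: V_def)
  have ysm: "smooth_on V y"
    unfolding y_def using VV
    by (intro smooth_on_compose[OF oV(1) V0(1,2) smooth_on_linear[OF bounded_linear_pair oV(1)]]) auto
  let ?j = "\<lambda>y. Z11 y * Z22 y - Z12 y * Z21 y"
  have yD: "(y has_derivative (\<lambda>v. ((v $ 1 * Z22 (y x) - v $ 2 * Z12 (y x)) / ?j (y x),
      (v $ 2 * Z11 (y x) - v $ 1 * Z21 (y x)) / ?j (y x)))) (at x)" if x: "x \<in> V" for x
    using has_derivative_compose[OF bounded_linear_imp_has_derivative[OF bounded_linear_pair] inv(2)]
      VV[OF x] unfolding V0_def y_def by simp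
  define G1 where "G1 = (\<lambda>c n x. (\<gamma>1 c n (y x) * Z22 (y x) - \<gamma>2 c n (y x) * Z21 (y x)) / ?j (y x))"
  define G2 where "G2 = (\<lambda>c n x. (\<gamma>2 c n (y x) * Z11 (y x) - \<gamma>1 c n (y x) * Z12 (y x)) / ?j (y x))"
  have ND: "z \<in> Dom" "0 < M1 z" "0 < M2 z" if "z \<in> N" for z using that N(3) by (auto simp: Dom'_def)
  have GD: "((\<lambda>x. \<gamma> c n (y x)) has_derivative (\<lambda>v. G1 c n x * v $ 1 + G2 c n x * v $ 2)) (at x)"
    if x: "x \<in> V" for x c n
    by (rule has_derivative_eq_rhs[OF has_derivative_compose[OF yD[OF x] \<gamma>_has_derivative[OF ND[OF yN[OF x]]]]])
       (use jN[OF yN[OF x]] in \<open>simp add: fun_eq_iff G1_def G2_def field_simps\<close>)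
  have comp: "smooth_on V (\<lambda>x. f (y x))" if "smooth_on Dom' f" for f :: "real \<times> real \<Rightarrow> real"
    using yN N(3) by (intro smooth_on_compose[OF oV(1) open_Dom' that ysm]) auto
  note cs = comp[OF smooth_on_\<gamma>12(1)] comp[OF smooth_on_\<gamma>12(2)] Zs[THEN comp]
  have Gsm: "smooth_on V (G1 c n)" "smooth_on V (G2 c n)" for c n
    unfolding G1_def G2_def
    by (intro smooth_on_divide smooth_on_diff smooth_on_mult oV(1) cs jN yN; assumption)+
  have sym: "G2 A n1 x = G1 B n2 x" if "x \<in> V" for x
    using \<gamma>_closed[of "y x"] ND[OF yN[OF that]] by (simp add: G1_def G2_def)
  obtain f0 where f0: "\<And>x. x \<in> V \<Longrightarrow>
      (f0 has_derivative (\<lambda>v. \<gamma> A n1 (y x) * v $ 1 + \<gamma> B n2 (y x) * v $ 2)) (at x)"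
  proof (rule planar_primitive[OF oV(1,2) GD[where c = A and n = n1], of "\<lambda>x. \<gamma> B n2 (y x)" "G2 B n2"])
    show "((\<lambda>x. \<gamma> B n2 (y x)) has_derivative (\<lambda>v. G2 A n1 x * v $ 1 + G2 B n2 x * v $ 2)) (at x)"
      if "x \<in> V" for x using GD[OF that, of B n2] sym[OF that] by simp
  qed (auto intro: Gsm smooth_on_imp_continuous_on)
  have f0sm: "smooth_on V f0"
    by (rule smooth_on_planar[OF oV(1) f0]) (auto intro: smooth_on_planar[OF oV(1) GD] Gsm)
  let ?Lk = "\<lambda>x :: real^2. L k (?pr x)" and ?Lk1 = "\<lambda>x :: real^2. L (k+1) (?pr x)"
  have LM: "?Lk x = snd (y x) * M2 (y x)" "?Lk1 x = fst (y x) * M1 (y x)" if "x \<in> V" for x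
    using L_Z[of "y x"] Zy[OF that] by simp_all
  have Lpos: "0 < ?Lk x" "0 < ?Lk1 x" if "x \<in> U" for x
    using that k by (auto simp: U_def P_int_def)
  have ypos: "0 < fst (y x)" "0 < snd (y x)" if "x \<in> V" "x \<in> U" for x
    using LM[OF that(1)] Lpos[OF that(2)] ND(2,3)[OF yN[OF that(1)]]
    by (auto simp: zero_less_mult_iff dest: less_asym)
  have hpy: "hp x = half_point (y x)" if x: "x \<in> V" "x \<in> U" for x
  proof -
    have "X (half_point (y x)) = ?pr x"
      using X_half_point[OF ND(1)[OF yN[OF x(1)]]] ypos[OF x] Zy[OF x(1)] by simp
    moreover have "half_point (y x) \<in> half_plane"
      using ypos[OF x] by (simp add: half_plane_iff half_point_def)
    ultimately show ?thesis unfolding hp_def using Y_X by metis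
  qed
  define F where "F = (\<lambda>x. u x - 1/2 * (?Lk x * ln (?Lk x)) - 1/2 * (?Lk1 x * ln (?Lk1 x)) - f0 x)"
  have LD: "((\<lambda>x. L j (?pr x)) has_derivative (\<lambda>v. A j * v $ 1 + B j * v $ 2)) (at x)" for j and x :: "real^2"
    unfolding L_def fst_conv snd_conv
    by (rule has_derivative_eq_rhs, (rule derivative_intros bounded_linear_imp_has_derivative bounded_linear_vec_nth)+) auto
  have FD: "(F has_derivative (\<lambda>v. 0)) (at x)" if x: "x \<in> V" "x \<in> U" for x
  proof -
    have LL: "((\<lambda>x. L j (?pr x) * ln (L j (?pr x))) has_derivative
        (\<lambda>v. (ln (L j (?pr x)) + 1) * (A j * v $ 1 + B j * v $ 2))) (at x)" if pos: "0 < L j (?pr x)" for j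
      by (rule derivative_eq_intros LD pos refl | use pos in \<open>simp add: fun_eq_iff field_simps\<close>)+
    have xi: "Xi1 x = 1/2 * A (k+1) * ln (fst (y x)) + 1/2 * A k * ln (snd (y x)) + S A n1 (y x)"
      "Xi2 x = 1/2 * B (k+1) * ln (fst (y x)) + 1/2 * B k * ln (snd (y x)) + S B n2 (y x)"
      using xi_fun_half_point[OF ND(1)[OF yN[OF x(1)]] ypos[OF x]]
      by (simp_all add: Xi1_def Xi2_def hpy[OF x] half_point_def)
    \<comment> \<open>The logarithms of the coordinates cancel those in \<open>Xi1\<close> and
      \<open>Xi2\<close>. The 1 in the derivative of \<open>t * ln t\<close> is the origin of the
      constant at the end of \<gamma>.\<close>
    have lns: "ln (?Lk x) = ln (snd (y x)) + ln (M2 (y x))" "ln (?Lk1 x) = ln (fst (y x)) + ln (M1 (y x))"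
      using LM[OF x(1)] ypos[OF x] ND(2,3)[OF yN[OF x(1)]] by (simp_all add: ln_mult)
    have "(F has_derivative (\<lambda>v. (Xi1 x * v $ 1 + Xi2 x * v $ 2)
        - 1/2 * ((ln (?Lk x) + 1) * (A k * v $ 1 + B k * v $ 2))
        - 1/2 * ((ln (?Lk1 x) + 1) * (A (k+1) * v $ 1 + B (k+1) * v $ 2))
        - (\<gamma> A n1 (y x) * v $ 1 + \<gamma> B n2 (y x) * v $ 2))) (at x)"
      unfolding F_def
      by (intro has_derivative_diff has_derivative_mult_right u LL Lpos f0 x)
    then show ?thesis
      by (rule has_derivative_eq_rhs, unfold xi lns \<gamma>_def) (simp add: fun_eq_iff algebra_simps)
  qed
  have "\<exists>C. \<forall>x\<in>V \<inter> U. F x = C"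
  proof (rule has_derivative_zero_constant)
    show "convex (V \<inter> U)" by (intro convex_Int oV convex_U)
    show "(F has_derivative (\<lambda>v. 0)) (at x within V \<inter> U)" if "x \<in> V \<inter> U" for x
      by (rule has_derivative_at_withinI, rule FD) (use that in auto)
  qed
  then obtain C where C: "\<And>x. x \<in> V \<inter> U \<Longrightarrow> F x = C" by blast
  show ?thesis
  proof (rule that[of V "\<lambda>x. f0 x + C" y])
    show "smooth_on V (\<lambda>x. f0 x + C)" by (intro smooth_on_add smooth_on_const f0sm oV)
    show "isCont y p"
      using smooth_on_imp_continuous_on[OF ysm] continuous_on_eq_continuous_at[OF oV(1)] oV(3) by blast
    show "y ` V \<subseteq> Dom" using ND(1)[OF yN] by auto
    show "u x = 1/2 * (?Lk x * ln (?Lk x)) + 1/2 * (?Lk1 x * ln (?Lk1 x)) + (f0 x + C)" if "x \<in> V \<inter> U" for x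
      using C[OF that] by (simp add: F_def)
    show "0 < fst (y x) \<and> 0 < snd (y x) \<and> (snd (hp x))\<^sup>2 = fst (y x) * snd (y x)" if "x \<in> V \<inter> U" for x
      using that ypos[of x] hpy[of x] by (simp add: half_point_def)
  qed (use oV y0p LM in auto)
qed

end

section \<open>The boundary condition at interior points, corners and edges\<close>

context toric_potential
begin

text \<open>\<open>c i * L i\<close> is going to be the original edge function. The index set F is a
  parameter, so that the edges through p can be identified separately.\<close>

definition boundary_at :: "(nat \<Rightarrow> real) \<Rightarrow> real^2 \<Rightarrow> nat set \<Rightarrow> bool" where
  "boundary_at c p F \<longleftrightarrow>
     (\<exists>V f. open V \<and> p \<in> V \<and> smooth_on V f \<and>
        (\<forall>x\<in>V \<inter> U. u x = (\<Sum>i\<in>F. 1 / (2 * c i) * (c i * L i (x $ 1, x $ 2)) * ln (c i * L i (x $ 1, x $ 2))) + f x)) \<and>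
     (\<exists>\<delta>>0. ((\<lambda>x. det (hessian u x) * (\<Prod>i\<in>F. c i * L i (x $ 1, x $ 2))) \<longlongrightarrow> \<delta>) (at p within U))"

lemma smooth_on_L: "open V \<Longrightarrow> smooth_on V (\<lambda>x :: real^2. L j (x $ 1, x $ 2))"
  unfolding L_def fst_conv snd_conv
  by (intro smooth_on_add smooth_on_mult smooth_on_const smooth_on_linear bounded_linear_vec_nth)

lemma L_pos_U: "x \<in> U \<Longrightarrow> 1 \<le> j \<Longrightarrow> j \<le> d \<Longrightarrow> 0 < L j (x $ 1, x $ 2)"
  by (auto simp: U_def P_int_def)

lemma boundary_at_interior:
  assumes "p \<in> U"
  shows "boundary_at c p {}"
proof -
  have "isCont (\<lambda>x. 1 / (snd (hp x))\<^sup>2) p"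
  proof -
    have "isCont hp p"
      using smooth_on_imp_continuous_on[OF smooth_on_hp] continuous_on_eq_continuous_at[OF open_U] assms by blast
    then show ?thesis using hp_half_plane[OF assms] by (intro continuous_intros) (auto simp: half_plane_iff)
  qed
  then have "((\<lambda>x. 1 / (snd (hp x))\<^sup>2) \<longlongrightarrow> 1 / (snd (hp p))\<^sup>2) (at p within U)"
    using continuous_at_imp_continuous_within continuous_within by blast
  then have "((\<lambda>x. det (hessian u x)) \<longlongrightarrow> 1 / (snd (hp p))\<^sup>2) (at p within U)"
    by (rule Lim_transform_eventually) (auto simp: eventually_at_filter det_hessian_u)
  moreover have "0 < 1 / (snd (hp p))\<^sup>2" using hp_half_plane[OF assms] by (simp add: half_plane_iff)
  moreover have "\<exists>V f. open V \<and> p \<in> V \<and> smooth_on V f \<and> (\<forall>x\<in>V \<inter> U. u x = 0 + f x)"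
    using open_U assms smooth_on_u by (intro exI[of _ U] exI[of _ u]) auto
  ultimately show ?thesis
    unfolding boundary_at_def sum.empty prod.empty mult_1_right by blast
qed

end

context toric_corner
begin

lemma isCont_M: "y \<in> Dom \<Longrightarrow> isCont M1 y" "y \<in> Dom \<Longrightarrow> isCont M2 y"
  using smooth_on_imp_continuous_on[OF smooth_on_M(1)] smooth_on_imp_continuous_on[OF smooth_on_M(2)]
    continuous_on_eq_continuous_at[OF open_Dom] by blast+

lemma I_iff: "i \<in> I \<longleftrightarrow> 1 \<le> i \<and> i < d \<and> i \<noteq> k"
  using k by (auto simp: I_def)

text \<open>Rescaling an edge function by the cone parameter changes its logarithmic term by a
  linear function only.\<close>

lemma log_term:
  fixes c t :: real
  assumes "0 < c" "0 < t"
  shows "1 / (2 * c) * (c * t) * ln (c * t) = 1/2 * (t * ln t) + 1/2 * ln c * t"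
  using assms by (simp add: ln_mult field_simps)

lemma boundary_at_corner:
  assumes c: "\<And>i. 0 < c i" and p: "(p $ 1, p $ 2) = (Z1 (0, 0), Z2 (0, 0))" and Dom: "(0, 0) \<in> Dom"
  shows "boundary_at c p {k, k+1}"
proof -
  have M: "0 < M1 (0, 0)" "0 < M2 (0, 0)" using \<kappa>_pos by (auto simp: M1_def M2_def)
  obtain V f y where V: "open V" "p \<in> V" "smooth_on V f" "isCont y p" "y p = (0, 0)" "y ` V \<subseteq> Dom"
    "\<And>x. x \<in> V \<inter> U \<Longrightarrow> u x = 1/2 * (L k (x $ 1, x $ 2) * ln (L k (x $ 1, x $ 2)))
        + 1/2 * (L (k+1) (x $ 1, x $ 2) * ln (L (k+1) (x $ 1, x $ 2))) + f x"
    "\<And>x. x \<in> V \<Longrightarrow> L k (x $ 1, x $ 2) = snd (y x) * M2 (y x)"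
    "\<And>x. x \<in> V \<Longrightarrow> L (k+1) (x $ 1, x $ 2) = fst (y x) * M1 (y x)"
    "\<And>x. x \<in> V \<inter> U \<Longrightarrow> 0 < fst (y x) \<and> 0 < snd (y x) \<and> (snd (hp x))\<^sup>2 = fst (y x) * snd (y x)"
    by (rule potential_near_boundary[OF Dom M _ p]) auto
  define g where "g = (\<lambda>x. f x - 1/2 * ln (c k) * L k (x $ 1, x $ 2) - 1/2 * ln (c (k+1)) * L (k+1) (x $ 1, x $ 2))"
  have "smooth_on V g" unfolding g_def
    by (intro smooth_on_diff smooth_on_mult smooth_on_const smooth_on_L V)
  moreover have "u x = (\<Sum>i\<in>{k, k+1}. 1 / (2 * c i) * (c i * L i (x $ 1, x $ 2)) * ln (c i * L i (x $ 1, x $ 2))) + g x"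
    if "x \<in> V \<inter> U" for x
  proof -
    have "0 < L k (x $ 1, x $ 2)" "0 < L (k+1) (x $ 1, x $ 2)" using L_pos_U[of x] that k by auto
    then show ?thesis
      using V(7)[OF that] log_term[OF c[of k]] log_term[OF c[of "k+1"]] by (simp add: g_def)
  qed
  moreover have "((\<lambda>x. det (hessian u x) * (\<Prod>i\<in>{k, k+1}. c i * L i (x $ 1, x $ 2)))
      \<longlongrightarrow> c k * c (k+1) * M1 (y p) * M2 (y p)) (at p within U)"
  proof (rule Lim_transform_eventually)
    have "isCont (\<lambda>x. c k * c (k+1) * M1 (y x) * M2 (y x)) p"
      using isCont_o2[OF V(4) isCont_M(1)] isCont_o2[OF V(4) isCont_M(2)] Dom V(5)
      by (intro continuous_intros) auto
    then show "((\<lambda>x. c k * c (k+1) * M1 (y x) * M2 (y x)) \<longlongrightarrow> c k * c (k+1) * M1 (y p) * M2 (y p)) (at p within U)"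
      using continuous_at_imp_continuous_within continuous_within by blast
    \<comment> \<open>The determinant is the reciprocal of the product of the coordinates, which the
      two edge functions contain as factors; only \<open>M1\<close> and \<open>M2\<close>
      remain.\<close>
    have eq: "c k * c (k+1) * M1 (y x) * M2 (y x) = det (hessian u x) * (\<Prod>i\<in>{k, k+1}. c i * L i (x $ 1, x $ 2))"
      if "x \<in> V" "x \<in> U" for x
      using V(8-10)[of x] that by (simp add: det_hessian_u)
    show "\<forall>\<^sub>F x in at p within U. c k * c (k+1) * M1 (y x) * M2 (y x)
        = det (hessian u x) * (\<Prod>i\<in>{k, k+1}. c i * L i (x $ 1, x $ 2))"
      unfolding eventually_at_topological using V(1,2) eq by blast
  qed
  moreover have "0 < c k * c (k+1) * M1 (y p) * M2 (y p)" using c M V(5) by simp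
  ultimately show ?thesis unfolding boundary_at_def using V(1,2) by blast
qed

lemma boundary_at_edge:
  assumes c: "\<And>i. 0 < c i" and y0: "(y1, y2) \<in> Dom" "0 < M1 (y1, y2)" "0 < M2 (y1, y2)"
    and p: "(p $ 1, p $ 2) = (Z1 (y1, y2), Z2 (y1, y2))"
  shows "y1 = 0 \<Longrightarrow> 0 < y2 \<Longrightarrow> boundary_at c p {k+1}"
    and "y2 = 0 \<Longrightarrow> 0 < y1 \<Longrightarrow> boundary_at c p {k}"
proof -
  have *: "boundary_at c p {j}" if zero: "y1 = 0 \<or> y2 = 0"
    and jj: "j = k \<and> j' = k+1 \<and> 0 < y1 \<or> j = k+1 \<and> j' = k \<and> 0 < y2" for j j'
  proof -
    have zero': "fst (y1, y2) = 0 \<or> snd (y1, y2) = 0" using zero by simp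
    obtain V f y where V: "open V" "p \<in> V" "smooth_on V f" "isCont y p" "y p = (y1, y2)" "y ` V \<subseteq> Dom"
      "\<And>x. x \<in> V \<inter> U \<Longrightarrow> u x = 1/2 * (L k (x $ 1, x $ 2) * ln (L k (x $ 1, x $ 2)))
          + 1/2 * (L (k+1) (x $ 1, x $ 2) * ln (L (k+1) (x $ 1, x $ 2))) + f x"
      "\<And>x. x \<in> V \<Longrightarrow> L k (x $ 1, x $ 2) = snd (y x) * M2 (y x)"
      "\<And>x. x \<in> V \<Longrightarrow> L (k+1) (x $ 1, x $ 2) = fst (y x) * M1 (y x)"
      "\<And>x. x \<in> V \<inter> U \<Longrightarrow> 0 < fst (y x) \<and> 0 < snd (y x) \<and> (snd (hp x))\<^sup>2 = fst (y x) * snd (y x)"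
      by (rule potential_near_boundary[OF y0 zero' p]) (rule that; assumption)
    \<comment> \<open>Here the edge function of the other index j' stays positive, so its
      logarithmic term can be moved into the smooth part.\<close>
    define W where "W = {x \<in> V. 0 < L j' (x $ 1, x $ 2)}"
    have "open (V \<inter> (\<lambda>x. L j' (x $ 1, x $ 2)) -` {0<..})"
      by (intro continuous_open_preimage smooth_on_imp_continuous_on smooth_on_L V(1)) auto
    then have oW: "open W" unfolding W_def by (simp add: vimage_def Int_def)
    have pW: "p \<in> W"
      using V(2,5) V(8,9)[OF V(2)] jj y0(2,3) by (auto simp: W_def)
    define g where "g = (\<lambda>x. f x + 1/2 * (L j' (x $ 1, x $ 2) * ln (L j' (x $ 1, x $ 2))) - 1/2 * ln (c j) * L j (x $ 1, x $ 2))"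
    have "smooth_on W f" using smooth_on_subset[OF V(3)] by (auto simp: W_def)
    then have "smooth_on W g" unfolding g_def
      by (intro smooth_on_add smooth_on_diff smooth_on_mult smooth_on_const smooth_on_ln smooth_on_L oW)
         (auto simp: W_def)
    moreover have "u x = (\<Sum>i\<in>{j}. 1 / (2 * c i) * (c i * L i (x $ 1, x $ 2)) * ln (c i * L i (x $ 1, x $ 2))) + g x"
      if "x \<in> W \<inter> U" for x
    proof -
      have "0 < L j (x $ 1, x $ 2)" using L_pos_U[of x j] that k jj by auto
      then show ?thesis
        using V(7)[of x] that jj log_term[OF c[of j]] by (auto simp: g_def W_def)
    qed
    \<comment> \<open>What is left of determinant times edge function j once its coordinate cancels:
      the other coordinate stays in the denominator and is positive at p.\<close>
    moreover define m where "m = (\<lambda>y. if j = k then c k * M2 y / fst y else c (k+1) * M1 y / snd y)"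
    have "((\<lambda>x. det (hessian u x) * (\<Prod>i\<in>{j}. c i * L i (x $ 1, x $ 2))) \<longlongrightarrow> m (y p)) (at p within U)"
    proof (rule Lim_transform_eventually)
      have "isCont (\<lambda>x. M1 (y x)) p" "isCont (\<lambda>x. M2 (y x)) p"
        using isCont_o2[OF V(4) isCont_M(1)] isCont_o2[OF V(4) isCont_M(2)] y0(1) V(5) by auto
      then have "isCont (\<lambda>x. m (y x)) p"
        unfolding m_def using V(4,5) jj by (cases "j = k") (auto intro!: continuous_intros)
      then show "((\<lambda>x. m (y x)) \<longlongrightarrow> m (y p)) (at p within U)"
        using continuous_at_imp_continuous_within continuous_within by blast
      have eq: "m (y x) = det (hessian u x) * (\<Prod>i\<in>{j}. c i * L i (x $ 1, x $ 2))"
        if "x \<in> V" "x \<in> U" for x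
        using V(8-10)[of x] that jj by (auto simp: det_hessian_u m_def)
      show "\<forall>\<^sub>F x in at p within U. m (y x) = det (hessian u x) * (\<Prod>i\<in>{j}. c i * L i (x $ 1, x $ 2))"
        unfolding eventually_at_topological using V(1,2) eq by blast
    qed
    moreover have "0 < m (y p)" using c y0(2,3) V(5) jj by (auto simp: m_def)
    ultimately show ?thesis unfolding boundary_at_def using oW pW by blast
  qed
  show "y1 = 0 \<Longrightarrow> 0 < y2 \<Longrightarrow> boundary_at c p {k+1}" using *[of "k+1" k] by simp
  show "y2 = 0 \<Longrightarrow> 0 < y1 \<Longrightarrow> boundary_at c p {k}" using *[of k "k+1"] by simp
qed

text \<open>On the axes of the quadrant M1 and M2 are sums over all nodes of increments of the determinants D,
  weighted with \<open>1 / (2 \<bar>H + a i\<bar>)\<close>; summation by parts makes them positive.\<close>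

lemma M1_edge_pos:
  assumes H: "H + a k < 0" "k + 1 < d \<Longrightarrow> 0 < H + a (k+1)"
  shows "(0, - 2 * (H + a k)) \<in> Dom" "0 < M1 (0, - 2 * (H + a k))"
proof -
  \<comment> \<open>At \<open>r = 0\<close> with \<open>H + a k < 0\<close> the radius is
    \<open>- (H + a k)\<close>, so the first coordinate is 0 and the second twice the
    radius.\<close>
  define y where "y = (0 :: real, - 2 * (H + a k))"
  have y: "fst y = 0" "snd y = - 2 * (H + a k)" by (auto simp: y_def)
  have h: "h i y = H + a i" for i by (simp add: h_def y field_simps)
  have neg: "H + a i < 0" if "1 \<le> i" "i \<le> k" for i using a_le[of i k] that k H by simp
  have pos: "0 < H + a i" if "k < i" "i < d" for i using a_le[of "k+1" i] that k H by simp
  have Q: "Q i y = \<bar>H + a i\<bar>" for i by (simp add: Q_def h y)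
  have w: "w i y = 2 * \<bar>H + a i\<bar>" "H + a i \<noteq> 0" if "i \<in> I" for i
    using that neg[of i] pos[of i] unfolding I_iff by (cases "i < k"; force simp: w_def Q h sg_def)+
  have D: "y \<in> Dom" using w by (auto simp: Dom_def h y)
  then show "(0, - 2 * (H + a k)) \<in> Dom" by (simp add: y_def)
  define z where "z = (\<lambda>i. 1 / (2 * \<bar>H + a i\<bar>))"
  have wz: "1 / w i y = z i" if "i \<in> I" for i by (simp add: w that z_def)
  obtain m where m: "0 < m" "\<And>i j. 1 \<le> i \<Longrightarrow> i < j \<Longrightarrow> j \<le> d \<Longrightarrow> D i j \<le> - m"
    using D_gap by blast
  have zpos: "0 < z i" if "1 \<le> i" "i < d" for i
    using neg[of i] pos[of i] that by (cases "i \<le> k") (auto simp: z_def)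
  let ?f = "\<lambda>i. (D (i+1) (k+1) - D i (k+1)) * z i"
  have "(D (k+1) (k+1) + m) * z k \<le> (\<Sum>i=1..k. ?f i)"
  proof (rule sum_increments_lower)
    show "z i \<le> z (i+1)" if "1 \<le> i" "i < k" for i
      using neg[of i] neg[of "i+1"] a_less[of i "i+1"] that k by (auto simp: z_def intro!: divide_left_mono mult_pos_pos)
  qed (use m k zpos[of 1] in auto)
  moreover have "0 < m * z k" using m(1) zpos[of k] k by simp
  moreover have "0 \<le> (\<Sum>i=k+1..d-1. ?f i)"
  proof (cases "k + 1 < d")
    case True
    have "(m - D (k+1) (k+1)) * z (k+1) \<le> (\<Sum>i=k+1..d-1. ?f i)"
    proof (rule sum_decrements_lower[OF True])
      show "m \<le> D i (k+1)" if "k+1 < i" "i \<le> d" for i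
        using m(2)[of "k+1" i] D_swap[of i "k+1"] that by simp
      show "z (i+1) \<le> z i" if "k + 1 \<le> i" "i + 1 < d" for i
        using pos[of i] pos[of "i+1"] a_less[of i "i+1"] that by (auto simp: z_def intro!: divide_left_mono mult_pos_pos)
      show "0 \<le> z (d-1)" by (rule less_imp_le, rule zpos) (use d k in auto)
    qed
    moreover have "0 \<le> m * z (k+1)" using m(1) zpos[of "k+1"] True by simp
    ultimately show ?thesis by simp
  next
    case False
    then have "{k+1..d-1} = {}" by auto
    then show ?thesis by (simp only: sum.empty)
  qed
  ultimately have sum_pos: "0 < (\<Sum>i=1..d-1. ?f i)"
    using sum_split_at[of "k+1" d ?f] k by simp
  have T: "T A n1 y * B (k+1) - T B n2 y * A (k+1) = (\<Sum>i\<in>I. ?f i) + (n1 * B (k+1) - n2 * A (k+1))"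
  proof -
    have "(\<Sum>i\<in>I. ?f i) = (\<Sum>i\<in>I. (A (i+1) - A i) * (1 / w i y)) * B (k+1) - (\<Sum>i\<in>I. (B (i+1) - B i) * (1 / w i y)) * A (k+1)"
      unfolding sum_distrib_right sum_subtractf[symmetric]
      by (intro sum.cong refl) (simp only: wz, simp add: D_def algebra_simps)
    then show ?thesis by (simp add: T_def algebra_simps)
  qed
  \<comment> \<open>Since \<open>snd y * z k = 1\<close>, the constant \<open>\<kappa> / 2\<close>
    is the summand for node k that the index set \<open>I\<close> leaves out.\<close>
  have "M1 y = 1/2 * (snd y * ((\<Sum>i=1..d-1. ?f i) + (n1 * B (k+1) - n2 * A (k+1))))"
    unfolding M1_def T sum_I using H(1) by (simp add: y z_def \<kappa>_def field_simps)
  also have "\<dots> > 0" using sum_pos n_det[of "k+1"] k H(1) by (simp add: y add_pos_nonneg)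
  finally show "0 < M1 (0, - 2 * (H + a k))" by (simp add: y_def)
qed

text \<open>The other axis is used for \<open>k = 1\<close>, where it is the first edge. There all
  \<open>H + a i\<close> are positive, so the weights decrease throughout and a single sum estimate
  suffices.\<close>

lemma M2_edge_pos:
  assumes H: "0 < H + a 1" and k1: "k = 1"
  shows "(2 * (H + a k), 0) \<in> Dom" "0 < M2 (2 * (H + a k), 0)"
proof -
  define y where "y = (2 * (H + a k), 0 :: real)"
  have y: "fst y = 2 * (H + a k)" "snd y = 0" by (auto simp: y_def)
  have h: "h i y = H + a i" for i by (simp add: h_def y field_simps)
  have pos: "0 < H + a i" if "1 \<le> i" "i < d" for i using a_le[of 1 i] that H by simp
  have Q: "Q i y = \<bar>H + a i\<bar>" for i by (simp add: Q_def h y)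
  have w: "w i y = 2 * \<bar>H + a i\<bar>" "H + a i \<noteq> 0" if "i \<in> I" for i
  proof -
    have i: "1 \<le> i" "i < d" "\<not> i < k" using that k1 unfolding I_iff by auto
    show "w i y = 2 * \<bar>H + a i\<bar>" "H + a i \<noteq> 0"
      using pos[OF i(1,2)] i(3) by (simp_all add: w_def Q h sg_def)
  qed
  have D: "y \<in> Dom" using w by (auto simp: Dom_def h y)
  then show "(2 * (H + a k), 0) \<in> Dom" by (simp add: y_def)
  define z where "z = (\<lambda>i. 1 / (2 * \<bar>H + a i\<bar>))"
  have wz: "1 / w i y = z i" if "i \<in> I" for i by (simp add: w that z_def)
  obtain m where m: "0 < m" "\<And>i j. 1 \<le> i \<Longrightarrow> i < j \<Longrightarrow> j \<le> d \<Longrightarrow> D i j \<le> - m"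
    using D_gap by blast
  have zpos: "0 < z i" if "1 \<le> i" "i < d" for i using pos[OF that] by (auto simp: z_def)
  let ?f = "\<lambda>i. (D (i+1) k - D i k) * z i"
  have "(m - D 1 k) * z 1 \<le> (\<Sum>i=1..d-1. ?f i)"
  proof (rule sum_decrements_lower)
    show "m \<le> D i k" if "1 < i" "i \<le> d" for i
      using m(2)[of k i] D_swap[of i k] that k1 by simp
    show "z (i+1) \<le> z i" if "1 \<le> i" "i + 1 < d" for i
      using pos[of i] pos[of "i+1"] a_less[of i "i+1"] that by (auto simp: z_def intro!: divide_left_mono mult_pos_pos)
    show "0 \<le> z (d-1)" by (rule less_imp_le, rule zpos) (use d k in auto)
  qed (use d in auto)
  moreover have "0 < m * z 1" using m(1) zpos[of 1] d by simp
  ultimately have sum_pos: "0 < (\<Sum>i=1..d-1. ?f i)" using k1 by simp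
  have T: "T A n1 y * B k - T B n2 y * A k = (\<Sum>i\<in>I. ?f i) + (n1 * B k - n2 * A k)"
  proof -
    have "(\<Sum>i\<in>I. ?f i) = (\<Sum>i\<in>I. (A (i+1) - A i) * (1 / w i y)) * B k - (\<Sum>i\<in>I. (B (i+1) - B i) * (1 / w i y)) * A k"
      unfolding sum_distrib_right sum_subtractf[symmetric]
      by (intro sum.cong refl) (simp only: wz, simp add: D_def algebra_simps)
    then show ?thesis by (simp add: T_def algebra_simps)
  qed
  have "D (k+1) k = \<kappa>" by (subst D_swap) (simp add: \<kappa>_def)
  then have fk: "?f k = \<kappa> * z k" by simp
  have Hk: "0 < H + a k" using H k1 by simp
  have "M2 y = 1/2 * (fst y * ((\<Sum>i=1..d-1. ?f i) + (n1 * B k - n2 * A k)))"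
    unfolding M2_def T sum_I fk using Hk by (simp add: y z_def field_simps)
  also have "\<dots> > 0" using sum_pos n_det[of k] k H k1 by (simp add: y add_pos_nonneg)
  finally show "0 < M2 (2 * (H + a k), 0)" by (simp add: y_def)
qed

lemma corner_in_Dom: "(0, 0) \<in> Dom"
proof -
  have "a i - a k \<noteq> 0 \<and> 0 < \<bar>a i - a k\<bar> + sg i * (a i - a k)" if "i \<in> I" for i
  proof -
    have "1 \<le> i" "i < d" "i \<noteq> k" using that k by (auto simp: I_def)
    then show ?thesis using a_less[of i k] a_less[of k i] k by (cases "i < k") (auto simp: sg_def)
  qed
  then show ?thesis by (auto simp: Dom_def h_def w_def Q_def)
qed

end

section \<open>The boundary condition at every point of the polygon\<close>

context toric_potential
begin

lemma boundary_behaviour: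
  assumes c: "\<And>i. 0 < c i" and p: "\<And>j. 1 \<le> j \<Longrightarrow> j \<le> d \<Longrightarrow> 0 \<le> L j (p $ 1, p $ 2)"
  shows "boundary_at c p {i\<in>{1..d}. L i (p $ 1, p $ 2) = 0}" (is "boundary_at c p ?F")
proof (cases "p \<in> U")
  case True
  then have F: "?F = {}" using L_pos_U[OF True] by force
  show ?thesis unfolding F by (rule boundary_at_interior[OF True])
next
  case False
  obtain z where z: "0 \<le> snd z" "(p $ 1, p $ 2) = X z" using closed_polygon_subset[of "(p $ 1, p $ 2)"] p by blast
  have "snd z = 0"
  proof (rule ccontr)
    assume "snd z \<noteq> 0"
    then have "X z \<in> P_int" using L_X_pos by (auto simp: P_int_def)
    then show False using False z(2) by (simp add: U_def)
  qed
  then obtain H where H: "(p $ 1, p $ 2) = X (H, 0)" using z(2) by (metis prod.collapse)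
  have corner_loc: "toric_corner d A B a l n1 n2 q1 q2 u k" if "1 \<le> k" "k < d" for k
    using that by unfold_locales
  show ?thesis
  proof (cases H rule: boundary_cases)
    case (corner k)
    interpret tc: toric_corner d A B a l n1 n2 q1 q2 u k using corner_loc corner by blast
    have "L j (X (H, 0)) = 0 \<longleftrightarrow> j = k \<or> j = k + 1" if j: "1 \<le> j" "j \<le> d" for j
    proof (cases "j = k \<or> j = k + 1")
      case True
      then have "L j (X (H, 0)) = 0"
        using corner a_le[of "k-1" k] a_le[of k "k+1"] j by (intro L_X_zero) auto
      then show ?thesis using True by simp
    next
      case False
      then have "j < k \<or> k + 1 < j" by auto
      then have "0 < L j (X (H, 0))"
        using corner j a_less[of j k] a_less[of k "j-1"] by (intro L_X_pos) auto
      then show ?thesis using False by simp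
    qed
    then have F: "?F = {k, k+1}" unfolding H using corner by auto
    have "X (H, 0) = (tc.Z1 (0, 0), tc.Z2 (0, 0))"
      using tc.X_half_point[OF tc.corner_in_Dom] corner by (simp add: tc.half_point_def tc.Hk_def)
    then show ?thesis unfolding F using H by (intro tc.boundary_at_corner c tc.corner_in_Dom) simp
  next
    \<comment> \<open>A point of the open edge k+1, seen in the chart at corner k on the axis
      \<open>fst y = 0\<close>.\<close>
    case (edge k)
    interpret tc: toric_corner d A B a l n1 n2 q1 q2 u k using corner_loc edge by blast
    have "L j (X (H, 0)) = 0 \<longleftrightarrow> j = k + 1" if j: "1 \<le> j" "j \<le> d" for j
    proof (cases "j = k + 1")
      case True
      then have "L j (X (H, 0)) = 0" using edge j by (intro L_X_zero) auto
      then show ?thesis using True by simp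
    next
      case False
      have "0 < L j (X (H, 0))"
      proof (cases "j \<le> k")
        case True
        then show ?thesis using edge j a_le[of j k] by (intro L_X_pos) auto
      next
        case gt: False
        then have "a (k+1) \<le> a (j-1)" "0 < H + a (k+1)" using False j edge(4) by (auto intro!: a_le)
        then show ?thesis using gt j edge by (intro L_X_pos) auto
      qed
      then show ?thesis using False by simp
    qed
    then have F: "?F = {k+1}" unfolding H using edge by auto
    note pos = tc.M1_edge_pos[OF edge(3,4)]
    have "tc.Hk (0, - 2 * (H + a k)) = H" by (simp add: tc.Hk_def field_simps)
    then have "X (H, 0) = (tc.Z1 (0, - 2 * (H + a k)), tc.Z2 (0, - 2 * (H + a k)))"
      using tc.X_half_point[OF pos(1)] edge(3) by (simp add: tc.half_point_def)
    moreover have "0 < tc.M2 (0, - 2 * (H + a k))" using tc.\<kappa>_pos by (simp add: tc.M2_def)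
    ultimately show ?thesis unfolding F using H edge(3) pos
      by (intro tc.boundary_at_edge(1)[where ?y1.0 = 0 and ?y2.0 = "- 2 * (H + a k)"] c) auto
  next
    case first_edge
    \<comment> \<open>The first edge has no preceding corner; it is the axis
      \<open>snd y = 0\<close> in the chart at corner 1.\<close>
    define k where "k = (1 :: nat)"
    interpret tc: toric_corner d A B a l n1 n2 q1 q2 u k using corner_loc d by (simp add: k_def)
    have Hk: "0 < H + a k" using first_edge by (simp add: k_def)
    have "L j (X (H, 0)) = 0 \<longleftrightarrow> j = 1" if j: "1 \<le> j" "j \<le> d" for j
    proof (cases "j = 1")
      case True
      then have "L j (X (H, 0)) = 0" using first_edge j by (intro L_X_zero) auto
      then show ?thesis using True by simp
    next
      case False
      then have "0 < L j (X (H, 0))"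
      proof -
        have "a 1 \<le> a (j-1)" using False j by (intro a_le) auto
        then show ?thesis using first_edge False j by (intro L_X_pos) auto
      qed
      then show ?thesis using False by simp
    qed
    then have F: "?F = {k}" unfolding H k_def using d by auto
    note pos = tc.M2_edge_pos[OF first_edge k_def]
    have "tc.Hk (2 * (H + a k), 0) = H" by (simp add: tc.Hk_def field_simps)
    then have "X (H, 0) = (tc.Z1 (2 * (H + a k), 0), tc.Z2 (2 * (H + a k), 0))"
      using tc.X_half_point[OF pos(1)] Hk by (simp add: tc.half_point_def)
    moreover have "0 < tc.M1 (2 * (H + a k), 0)" using tc.\<kappa>_pos by (simp add: tc.M1_def)
    ultimately show ?thesis unfolding F using H Hk pos
      by (intro tc.boundary_at_edge(2)[where ?y1.0 = "2 * (H + a k)" and ?y2.0 = 0] c) auto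
  qed
qed

end

section \<open>From the polygon to the parameters\<close>

locale moment_polygon =
  fixes d :: nat and \<alpha> \<beta> :: "nat \<Rightarrow> int" and lam :: "nat \<Rightarrow> real" and c :: "nat \<Rightarrow> real"
  assumes polygon: "strictly_unbounded_polygon d \<alpha> \<beta> lam" and c_pos: "\<And>i. 0 < c i"
begin

abbreviation "P \<equiv> polygon d \<alpha> \<beta> lam"
abbreviation "F \<equiv> edge d \<alpha> \<beta> lam"

definition Det :: "nat \<Rightarrow> nat \<Rightarrow> real" where
  "Det i j = of_int (\<alpha> i) * of_int (\<beta> j) - of_int (\<beta> i) * of_int (\<alpha> j)"

text \<open>The normal after a quarter turn: along it the i-th edge function changes at rate
  \<open>Det j i\<close>.\<close>

definition dir :: "nat \<Rightarrow> real^2" where "dir j = vector [- of_int (\<beta> j), of_int (\<alpha> j)]"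

lemma d2: "2 \<le> d" using polygon by (simp add: strictly_unbounded_polygon_def)

lemma ell_eq: "ell \<alpha> \<beta> lam i x = x $ 1 * of_int (\<alpha> i) + x $ 2 * of_int (\<beta> i) + lam i"
  by (simp add: ell_def normal_def inner_vec_def sum_2)

lemma Det_swap: "Det i j = - Det j i"
  by (simp add: Det_def)

lemma Det_step: "1 \<le> i \<Longrightarrow> i < d \<Longrightarrow> Det i (i+1) = -1"
  using polygon by (auto simp: strictly_unbounded_polygon_def det2_def normal_def Det_def)

lemma ell_dir: "ell \<alpha> \<beta> lam i (x + t *\<^sub>R dir j) = ell \<alpha> \<beta> lam i x + t * Det j i"
  by (simp add: ell_eq dir_def Det_def algebra_simps)

lemma on_line:
  assumes "1 \<le> j" "j \<le> d" "ell \<alpha> \<beta> lam j x = 0" "ell \<alpha> \<beta> lam j y = 0"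
  obtains t where "y = x + t *\<^sub>R dir j"
proof -
  have "coprime (\<alpha> j) (\<beta> j)" using polygon assms by (auto simp: strictly_unbounded_polygon_def)
  then have nz: "\<alpha> j \<noteq> 0 \<or> \<beta> j \<noteq> 0" by auto
  define X where "X = y $ 1 - x $ 1"
  define Y where "Y = y $ 2 - x $ 2"
  have e: "X * of_int (\<alpha> j) + Y * of_int (\<beta> j) = 0"
    using assms(3,4) by (simp add: ell_eq X_def Y_def algebra_simps)
  have "\<exists>t. X = - t * of_int (\<beta> j) \<and> Y = t * of_int (\<alpha> j)"
  proof (cases "\<alpha> j = 0")
    case True
    then have "Y = 0" using e nz by simp
    then show ?thesis using True nz by (intro exI[of _ "- X / of_int (\<beta> j)"]) simp
  next
    case False
    then show ?thesis using e by (intro exI[of _ "Y / of_int (\<alpha> j)"]) (simp add: field_simps)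
  qed
  then obtain t where "X = - t * of_int (\<beta> j)" "Y = t * of_int (\<alpha> j)" by blast
  then have "y = x + t *\<^sub>R dir j"
    by (simp add: vec_eq_iff forall_2 dir_def X_def Y_def)
  then show ?thesis by (rule that)
qed

definition corner_point :: "nat \<Rightarrow> real^2" where
  "corner_point k = (SOME x. x \<in> F k \<inter> F (k+1))"

lemma corner_point:
  assumes "1 \<le> k" "k < d"
  shows "corner_point k \<in> P" "ell \<alpha> \<beta> lam k (corner_point k) = 0" "ell \<alpha> \<beta> lam (k+1) (corner_point k) = 0"
proof -
  have "F k \<inter> F (k+1) \<noteq> {}" using polygon assms by (auto simp: strictly_unbounded_polygon_def)
  then obtain x where "x \<in> F k \<inter> F (k+1)" by blast
  then have "corner_point k \<in> F k \<inter> F (k+1)"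
    unfolding corner_point_def by (rule someI)
  then show "corner_point k \<in> P" "ell \<alpha> \<beta> lam k (corner_point k) = 0" "ell \<alpha> \<beta> lam (k+1) (corner_point k) = 0"
    by (auto simp: edge_def)
qed

lemma P_ell: "x \<in> P \<Longrightarrow> 1 \<le> i \<Longrightarrow> i \<le> d \<Longrightarrow> 0 \<le> ell \<alpha> \<beta> lam i x"
  by (auto simp: polygon_def)

lemma bounded_segment: "bounded ((\<lambda>t. x + t *\<^sub>R dir j) ` {s..t})"
  by (intro compact_imp_bounded compact_continuous_image continuous_intros) auto

text \<open>From its corner the first edge runs against \<open>dir 1\<close>, as the second edge
  function equals \<open>- t\<close> on it. If \<open>Det 1 j\<close> were positive, edge function j
  would bound it on that side.\<close>

lemma Det_first:
  assumes "1 \<le> j" "j \<le> d"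
  shows "Det 1 j \<le> 0"
proof (rule ccontr)
  assume "\<not> Det 1 j \<le> 0"
  then have pos: "0 < Det 1 j" by simp
  have k: "1 < d" using d2 by simp
  let ?p = "corner_point 1"
  note p = corner_point[OF order_refl k]
  have "F 1 \<subseteq> (\<lambda>t. ?p + t *\<^sub>R dir 1) ` {- ell \<alpha> \<beta> lam j ?p / Det 1 j..0}"
  proof
    fix x assume x: "x \<in> F 1"
    obtain t where t: "x = ?p + t *\<^sub>R dir 1"
      using on_line[of 1 ?p x] p(2) x d2 by (auto simp: edge_def)
    have "0 \<le> ell \<alpha> \<beta> lam 2 x" "0 \<le> ell \<alpha> \<beta> lam j x"
      using P_ell[of x] x d2 assms by (auto simp: edge_def)
    then have "0 \<le> - t" "0 \<le> ell \<alpha> \<beta> lam j ?p + t * Det 1 j"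
      using p(3) Det_step[of 1] k unfolding t ell_dir by (auto simp: numeral_2_eq_2)
    then have "t \<in> {- ell \<alpha> \<beta> lam j ?p / Det 1 j..0}" using pos by (auto simp: field_simps)
    then show "x \<in> (\<lambda>t. ?p + t *\<^sub>R dir 1) ` {- ell \<alpha> \<beta> lam j ?p / Det 1 j..0}" using t by blast
  qed
  then have "bounded (F 1)" using bounded_segment bounded_subset by blast
  then show False using polygon d2 by (auto simp: strictly_unbounded_polygon_def)
qed

lemma Det_last:
  assumes "1 \<le> j" "j \<le> d"
  shows "Det j d \<le> 0"
proof (rule ccontr)
  assume "\<not> Det j d \<le> 0"
  then have neg: "0 < - Det d j" using Det_swap[of j d] by simp
  have k: "1 \<le> d - 1" "d - 1 < d" "d - 1 + 1 = d" using d2 by auto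
  let ?p = "corner_point (d - 1)"
  note p = corner_point[OF k(1,2), unfolded k(3)]
  have "F d \<subseteq> (\<lambda>t. ?p + t *\<^sub>R dir d) ` {0..ell \<alpha> \<beta> lam j ?p / - Det d j}"
  proof
    fix x assume x: "x \<in> F d"
    obtain t where t: "x = ?p + t *\<^sub>R dir d"
      using on_line[of d ?p x] p(3) x d2 by (auto simp: edge_def)
    have "0 \<le> ell \<alpha> \<beta> lam (d-1) x" "0 \<le> ell \<alpha> \<beta> lam j x"
      using P_ell[of x] x d2 assms by (auto simp: edge_def)
    then have "0 \<le> t" "0 \<le> ell \<alpha> \<beta> lam j ?p + t * Det d j"
      using p(2) Det_step[OF k(1,2)] Det_swap[of d "d-1"] k(3) unfolding t ell_dir by auto
    then have "t \<in> {0..ell \<alpha> \<beta> lam j ?p / - Det d j}" using neg by (auto simp: field_simps)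
    then show "x \<in> (\<lambda>t. ?p + t *\<^sub>R dir d) ` {0..ell \<alpha> \<beta> lam j ?p / - Det d j}" using t by blast
  qed
  then have "bounded (F d)" using bounded_segment bounded_subset by blast
  then show False using polygon d2 by (auto simp: strictly_unbounded_polygon_def)
qed

lemma Det_1_d: "Det 1 d < 0"
proof -
  have "Det 1 d \<noteq> 0"
    using polygon by (auto simp: strictly_unbounded_polygon_def det2_def normal_def Det_def)
  then show ?thesis using Det_first[of d] d2 by simp
qed

text \<open>All normals lie in the open half-plane where E is positive, and there turning clockwise
  is a transitive relation. The induction composes single steps by the three-term relation for
  determinants of plane vectors.\<close>

lemma Det_neg:
  assumes "1 \<le> i" "i < j" "j \<le> d"
  shows "Det i j < 0"
  using assms(2,3)
proof (induction j rule: less_induct)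
  case (less j)
  define E where "E = (\<lambda>k. - Det 1 k - Det k d)"
  have E: "0 < E k" if "1 \<le> k" "k \<le> d" for k
  proof -
    have "Det 1 k \<noteq> 0 \<or> Det k d \<noteq> 0"
    proof (rule ccontr)
      assume a: "\<not> (Det 1 k \<noteq> 0 \<or> Det k d \<noteq> 0)"
      have "of_int (\<alpha> k) * Det 1 d = of_int (\<alpha> 1) * Det k d + of_int (\<alpha> d) * Det 1 k"
        "of_int (\<beta> k) * Det 1 d = of_int (\<beta> 1) * Det k d + of_int (\<beta> d) * Det 1 k"
        by (simp_all add: Det_def algebra_simps)
      then have "\<alpha> k = 0" "\<beta> k = 0" using a Det_1_d by auto
      moreover have "coprime (\<alpha> k) (\<beta> k)" using polygon that by (auto simp: strictly_unbounded_polygon_def)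
      ultimately show False by simp
    qed
    then show ?thesis using Det_first[OF that] Det_last[OF that] by (auto simp: E_def)
  qed
  show ?case
  proof (cases "j = i + 1")
    case True
    then show ?thesis using Det_step[of i] assms(1) less.prems by simp
  next
    case False
    then obtain k where k: "j = k + 1" "i < k" using less.prems by (metis Suc_eq_plus1 less_antisym less_imp_Suc_add linorder_neqE_nat add.commute plus_1_eq_Suc)
    have "Det i j * E k = Det i k * E j + Det k j * E i"
      by (simp add: Det_def E_def algebra_simps)
    moreover have "Det i k < 0" using less.IH[of k] k less.prems by simp
    moreover have "Det k j < 0" using Det_step[of k] k less.prems assms(1) by simp
    ultimately have "Det i j * E k < 0"
      using E[of j] E[of i] assms(1) less.prems by (simp add: add_neg_neg mult_neg_pos)
    then show ?thesis using E[of k] k less.prems assms(1) by (simp add: mult_less_0_iff)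
  qed
qed

text \<open>Along \<open>dir k\<close> the next edge function decreases at unit rate and it is
  nonnegative at the previous corner, so \<open>0 \<le> t\<close>. For \<open>t = 0\<close> the
  neighbouring edges would squeeze edge k to a point, which is no facet.\<close>

lemma edge_step:
  assumes "2 \<le> k" "k < d"
  obtains t where "0 < t" "corner_point k = corner_point (k-1) + t *\<^sub>R dir k"
proof -
  let ?p = "corner_point (k-1)" and ?q = "corner_point k"
  have km: "1 \<le> k - 1" "k - 1 < d" "k - 1 + 1 = k" using assms by auto
  note p = corner_point[OF km(1,2), unfolded km(3)]
  have k1: "1 \<le> k" using assms by simp
  note q = corner_point[OF k1 assms(2)]
  obtain t where t: "?q = ?p + t *\<^sub>R dir k" using on_line[OF k1 _ p(3) q(2)] assms by auto
  have s: "Det k (k+1) = -1" "Det k (k-1) = 1"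
    using Det_step[of k] Det_step[of "k-1"] Det_swap[of k "k-1"] assms km by auto
  have "ell \<alpha> \<beta> lam (k+1) ?q = ell \<alpha> \<beta> lam (k+1) ?p - t" unfolding t ell_dir s by simp
  then have "0 \<le> t" using q(3) P_ell[OF p(1), of "k+1"] assms by simp
  moreover have "t \<noteq> 0"
  proof
    assume "t = 0"
    then have pq: "?q = ?p" using t by simp
    have "F k \<subseteq> {?q}"
    proof
      fix x assume x: "x \<in> F k"
      then obtain r where r: "x = ?q + r *\<^sub>R dir k" using on_line[OF k1 _ q(2), of x] assms by (auto simp: edge_def)
      have "0 \<le> ell \<alpha> \<beta> lam (k+1) x" "0 \<le> ell \<alpha> \<beta> lam (k-1) x"
        using P_ell[of x] x assms by (auto simp: edge_def)
      then have "r \<le> 0" "0 \<le> r" using q(3) p(2) pq unfolding r ell_dir s by auto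
      then show "x \<in> {?q}" using r by simp
    qed
    then have "aff_dim (F k) \<le> 0" using aff_dim_subset[of "F k" "{?q}"] by simp
    moreover have "F k facet_of P" "interior P \<noteq> {}"
      using polygon assms by (auto simp: strictly_unbounded_polygon_def)
    then have "aff_dim (F k) = 1"
      using aff_dim_nonempty_interior[of P] by (simp add: facet_of_def)
    ultimately show False by simp
  qed
  ultimately show ?thesis using that[of t] t by simp
qed

section \<open>Scaled normals, edge lengths and the numbers a\<close>

definition A :: "nat \<Rightarrow> real" where "A i = of_int (\<alpha> i) / c i"
definition B :: "nat \<Rightarrow> real" where "B i = of_int (\<beta> i) / c i"
definition l :: "nat \<Rightarrow> real" where "l i = lam i / c i"

lemma AB_det: "A i * B j - B i * A j = Det i j / (c i * c j)"
  by (simp add: A_def B_def Det_def diff_divide_distrib)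

lemma ell_scaled: "ell \<alpha> \<beta> lam i x = c i * (A i * x $ 1 + B i * x $ 2 + l i)"
  using c_pos[of i] by (simp add: ell_eq A_def B_def l_def field_simps)

definition len :: "nat \<Rightarrow> real" where
  "len k = (SOME t. 0 < t \<and> corner_point k = corner_point (k-1) + t *\<^sub>R dir k)"

lemma len:
  assumes "2 \<le> k" "k < d"
  shows "0 < len k" "corner_point k = corner_point (k-1) + len k *\<^sub>R dir k"
proof -
  obtain t where "0 < t" "corner_point k = corner_point (k-1) + t *\<^sub>R dir k"
    by (rule edge_step[OF assms])
  then have "0 < t \<and> corner_point k = corner_point (k-1) + t *\<^sub>R dir k" by blast
  then have "0 < len k \<and> corner_point k = corner_point (k-1) + len k *\<^sub>R dir k"
    unfolding len_def by (rule someI)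
  then show "0 < len k" "corner_point k = corner_point (k-1) + len k *\<^sub>R dir k" by auto
qed

text \<open>The sum is empty for \<open>k = 1\<close>, so \<open>a 1 = 0\<close>. Along edge k the
  boundary map moves at unit rate in H by the scaled normal after a quarter turn, of size
  \<open>1 / c k\<close> times that of \<open>dir k\<close>; an edge of length \<open>len k\<close>
  hence takes up \<open>c k * len k\<close>.\<close>

definition a :: "nat \<Rightarrow> real" where "a k = (\<Sum>j=2..k. c j * len j)"

lemma a_Suc: "1 \<le> k \<Longrightarrow> a (k+1) = a k + c (k+1) * len (k+1)"
  by (simp add: a_def)

lemma a_less:
  assumes "1 \<le> i" "i < j" "j < d"
  shows "a i < a j"
  using assms(2,3)
proof (induction j rule: less_induct)
  case (less j)
  then obtain k where k: "j = k + 1" using assms(1) by (metis Suc_eq_plus1 not0_implies_Suc not_less_zero)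
  have "a k < a j" using k a_Suc[of k] len(1)[of "k+1"] c_pos[of "k+1"] assms(1) less.prems by simp
  moreover have "a i \<le> a k" using less.IH[of k] k less.prems by (cases "i = k") auto
  ultimately show ?case by simp
qed

text \<open>Between consecutive nodes no \<open>H + a i\<close> changes sign, so on
  \<open>r = 0\<close> the function is affine in H, with slope \<open>f (k+1)\<close> by
  telescoping.\<close>

lemma conj_fun_corner_step:
  assumes "1 \<le> k" "k + 1 < d"
  shows "conj_fun d a f 0 (- a (k+1)) 0 = conj_fun d a f 0 (- a k) 0 - (a (k+1) - a k) * f (k+1)"
proof -
  have le: "a i \<le> a j" if "1 \<le> i" "i \<le> j" "j < d" for i j using a_less[of i j] that by (cases "i = j") auto
  define s where "s = a (k+1) - a k"
  have 1: "(\<Sum>i=1..k. (f (i+1) - f i) * radius a i (- a (k+1)) 0)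
      = (\<Sum>i=1..k. (f (i+1) - f i) * radius a i (- a k) 0) + (\<Sum>i=1..k. f (i+1) - f i) * s"
    unfolding sum_distrib_right sum.distrib[symmetric]
  proof (intro sum.cong refl)
    fix i assume "i \<in> {1..k}"
    then have "a i \<le> a k" "a i \<le> a (k+1)" using le assms by auto
    then show "(f (i+1) - f i) * radius a i (- a (k+1)) 0 = (f (i+1) - f i) * radius a i (- a k) 0 + (f (i+1) - f i) * s"
      by (simp add: radius_0 s_def algebra_simps)
  qed
  have 2: "(\<Sum>i=k+1..d-1. (f (i+1) - f i) * radius a i (- a (k+1)) 0)
      = (\<Sum>i=k+1..d-1. (f (i+1) - f i) * radius a i (- a k) 0) - (\<Sum>i=k+1..d-1. f (i+1) - f i) * s"
    unfolding sum_distrib_right sum_subtractf[symmetric]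
  proof (intro sum.cong refl)
    fix i assume "i \<in> {k+1..d-1}"
    then have "a k \<le> a i" "a (k+1) \<le> a i" using le[of k i] le[of "k+1" i] assms by auto
    then show "(f (i+1) - f i) * radius a i (- a (k+1)) 0 = (f (i+1) - f i) * radius a i (- a k) 0 - (f (i+1) - f i) * s"
      by (simp add: radius_0 s_def algebra_simps)
  qed
  have tel: "(\<Sum>i=1..k. f (i+1) - f i) = f (k+1) - f 1" "(\<Sum>i=k+1..d-1. f (i+1) - f i) = f d - f (k+1)"
    using sum_telescope_nat[of "k+1" d f] assms by auto
  have split: "(\<Sum>i=1..d-1. g i) = (\<Sum>i=1..k. g i) + (\<Sum>i=k+1..d-1. g i)" for g :: "nat \<Rightarrow> real"
    using sum_split_at[of "k+1" d g] assms by simp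
  have "a (k+1) = a k + s" by (simp add: s_def)
  then show ?thesis unfolding conj_fun_def split 1 2 tel s_def[symmetric]
    by (simp add: algebra_simps add_divide_distrib diff_divide_distrib)
qed

text \<open>The constants of integration are fixed by sending \<open>H = - a 1\<close> to the first
  corner; the choice of \<open>a\<close> takes care of the other corners.\<close>

definition q1 :: real where "q1 = corner_point 1 $ 1 - conj_fun d a B 0 (- a 1) 0"
definition q2 :: real where "q2 = corner_point 1 $ 2 + conj_fun d a A 0 (- a 1) 0"

lemma corner_point_eq:
  assumes "1 \<le> k" "k < d"
  shows "q1 + conj_fun d a B 0 (- a k) 0 = corner_point k $ 1"
    and "q2 - conj_fun d a A 0 (- a k) 0 = corner_point k $ 2"
  using assms
proof (induction k rule: dec_induct)
  case base
  { case 1 then show ?case by (simp add: q1_def) }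
  { case 2 then show ?case by (simp add: q2_def) }
next
  case (step k)
  have s: "a (Suc k) - a k = c (Suc k) * len (Suc k)" using a_Suc[of k] step(1) by simp
  have "corner_point (Suc k) = corner_point k + len (Suc k) *\<^sub>R dir (Suc k)" if "Suc k < d"
    using len(2)[of "Suc k"] step(1) that by simp
  then have p: "corner_point (Suc k) $ 1 = corner_point k $ 1 - (a (Suc k) - a k) * B (Suc k)"
    "corner_point (Suc k) $ 2 = corner_point k $ 2 + (a (Suc k) - a k) * A (Suc k)" if "Suc k < d"
    using that c_pos[of "Suc k"] unfolding s by (auto simp: dir_def A_def B_def)
  { case 1 then show ?case using step conj_fun_corner_step[of k B] p(1) by simp }
  { case 2 then show ?case using step conj_fun_corner_step[of k A] p(2) by simp }
qed

lemma toric_data: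
  assumes "0 \<le> det2 \<nu> (normal \<alpha> \<beta> 1)" "0 \<le> det2 \<nu> (normal \<alpha> \<beta> d)"
  shows "toric_data d A B a l (\<nu> $ 1) (\<nu> $ 2) q1 q2"
proof
  show "2 \<le> d" by (rule d2)
  show "A i * B j - B i * A j < 0" if "1 \<le> i" "i < j" "j \<le> d" for i j
    unfolding AB_det using Det_neg[OF that] c_pos by (simp add: divide_neg_pos)
  show "a i < a j" if "1 \<le> i" "i < j" "j < d" for i j using a_less[OF that] .
  show "0 \<le> \<nu> $ 1 * B j - \<nu> $ 2 * A j" if j: "1 \<le> j" "j \<le> d" for j
  proof -
    define N where "N = (\<lambda>j. \<nu> $ 1 * of_int (\<beta> j) - \<nu> $ 2 * of_int (\<alpha> j))"
    have N: "0 \<le> N 1" "0 \<le> N d" using assms by (auto simp: N_def det2_def normal_def)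
    \<comment> \<open>Each normal is a combination of the first and the last one with nonnegative
      coefficients; this is Cramer's rule cleared of its denominator.\<close>
    have "N j * (- Det 1 d) = (- Det j d) * N 1 + (- Det 1 j) * N d"
      by (simp add: N_def Det_def algebra_simps)
    also have "\<dots> \<ge> 0" using N Det_first[OF j] Det_last[OF j]
      by (intro add_nonneg_nonneg mult_nonneg_nonneg) auto
    finally have "0 \<le> N j" using Det_1_d by (simp add: mult_le_0_iff)
    moreover have "\<nu> $ 1 * B j - \<nu> $ 2 * A j = N j / c j"
      by (simp add: N_def A_def B_def diff_divide_distrib)
    ultimately show ?thesis using c_pos[of j] by simp
  qed
  fix k assume k: "1 \<le> k" "k < d"
  have z: "A i * corner_point k $ 1 + B i * corner_point k $ 2 + l i = 0"
    if "ell \<alpha> \<beta> lam i (corner_point k) = 0" for i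
    using that c_pos[of i] by (simp add: ell_scaled)
  show "A k * (q1 + conj_fun d a B 0 (- a k) 0) + B k * (q2 - conj_fun d a A 0 (- a k) 0) + l k = 0"
    unfolding corner_point_eq[OF k] by (rule z) (rule corner_point(2)[OF k])
  show "A (k+1) * (q1 + conj_fun d a B 0 (- a k) 0) + B (k+1) * (q2 - conj_fun d a A 0 (- a k) 0) + l (k+1) = 0"
    unfolding corner_point_eq[OF k] by (rule z) (rule corner_point(3)[OF k])
qed

end

section \<open>The main theorem\<close>

context toric_data
begin

text \<open>From an interior point a small step against the recession direction stays in the polygon
  while it lowers every edge function, so all of them were positive.\<close>

lemma interior_polygon:
  assumes "Q = {x :: real^2. \<forall>j\<in>{1..d}. 0 \<le> L j (x $ 1, x $ 2)}"
  shows "interior Q = U"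
proof
  show "U \<subseteq> interior Q"
    by (rule interior_maximal[OF _ open_U]) (auto simp: assms U_def P_int_def less_imp_le)
  show "interior Q \<subseteq> U"
  proof
    fix x assume "x \<in> interior Q"
    then obtain e where e: "0 < e" "ball x e \<subseteq> Q" by (auto simp: mem_interior)
    define v :: "real^2" where "v = vector [e1, e2]"
    define m where "m = norm v + 1"
    define t where "t = e / (2 * m)"
    have m: "0 < m" "norm v \<le> m" unfolding m_def by (auto intro: add_nonneg_pos)
    have t: "0 < t" unfolding t_def using e(1) m by simp
    have "t * norm v \<le> t * m" using t m by simp
    also have "\<dots> = e / 2" using m by (simp add: t_def)
    finally have "x - t *\<^sub>R v \<in> ball x e" using e(1) t by (simp add: dist_norm)
    then have xQ: "x - t *\<^sub>R v \<in> Q" using e(2) by blast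
    have "0 < L j (x $ 1, x $ 2)" if j: "1 \<le> j" "j \<le> d" for j
    proof -
      have "L j ((x - t *\<^sub>R v) $ 1, (x - t *\<^sub>R v) $ 2) = L j (x $ 1, x $ 2) - t * E j"
        by (simp add: L_def E_def v_def algebra_simps)
      moreover have "0 \<le> L j ((x - t *\<^sub>R v) $ 1, (x - t *\<^sub>R v) $ 2)"
        using xQ j unfolding assms by auto
      ultimately show ?thesis using mult_pos_pos[OF t E_pos[OF j]] by simp
    qed
    then show "x \<in> U" by (simp add: U_def P_int_def)
  qed
qed

lemma diffeomorphism_X: "diffeomorphism_betw (\<lambda>p. vector [X1 p, X2 p] :: real^2) half_plane U"
proof -
  let ?f = "\<lambda>p. vector [X1 p, X2 p] :: real^2"
  have inj: "inj_on ?f half_plane"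
    by (rule inj_on_inverseI[of _ hp]) (rule hp_X(2))
  have img: "?f ` half_plane = U"
  proof
    show "?f ` half_plane \<subseteq> U" using hp_X(1) by blast
    show "U \<subseteq> ?f ` half_plane"
    proof
      fix x assume x: "x \<in> U"
      then have "?f (hp x) = x" using X_hp[OF x] by (simp add: X_def vec_eq_iff forall_2)
      then show "x \<in> ?f ` half_plane" using hp_half_plane[OF x] by (intro image_eqI[of x ?f "hp x"]) simp_all
    qed
  qed
  have "smooth_on half_plane X1"
    by (rule smooth_onI[OF open_half_plane X1_has_derivative[folded half_plane_iff]])
       (assumption, intro smooth_on_add smooth_on_minus smooth_on_mult smooth_on_const smooth_on_xi_r
         smooth_on_xi_H smooth_on_snd open_half_plane)
  moreover have "smooth_on half_plane X2"
    by (rule smooth_onI[OF open_half_plane X2_has_derivative[folded half_plane_iff]])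
       (assumption, intro smooth_on_add smooth_on_minus smooth_on_mult smooth_on_const smooth_on_xi_r
         smooth_on_xi_H smooth_on_snd open_half_plane)
  ultimately have "smooth_on half_plane (\<lambda>p. X1 p *\<^sub>R (axis 1 1 :: real^2) + X2 p *\<^sub>R axis 2 1)"
    by (intro smooth_on_add smooth_on_scaleR smooth_on_const open_half_plane)
  moreover have "X1 p *\<^sub>R (axis 1 1 :: real^2) + X2 p *\<^sub>R axis 2 1 = ?f p" for p
    by (simp add: vec_eq_iff forall_2 axis_def)
  ultimately have sm: "smooth_on half_plane ?f" by simp
  have "inv_into half_plane ?f x = hp x" if x: "x \<in> U" for x
  proof -
    obtain z where z: "z \<in> half_plane" "x = ?f z" using x img by blast
    then show ?thesis using inv_into_f_f[OF inj z(1)] hp_X(2)[OF z(1)] by simp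
  qed
  then have "smooth_on U (inv_into half_plane ?f)"
    by (intro smooth_on_cong[OF open_U smooth_on_hp]) simp
  then show ?thesis using inj img sm by (simp add: diffeomorphism_betw_def bij_betw_def)
qed

end

theorem theorem4p1:
  fixes d :: nat and \<alpha> \<beta> :: "nat \<Rightarrow> int" and lam :: "nat \<Rightarrow> real"
    and J :: "nat set" and \<theta> :: "nat \<Rightarrow> real"
  assumes "strictly_unbounded_polygon d \<alpha> \<beta> lam"
    and "J \<subseteq> {1..d}"
    and "\<And>j. j \<in> J \<Longrightarrow> 0 < \<theta> j \<and> \<theta> j < 1"
  shows "\<exists>a :: nat \<Rightarrow> real. \<forall>\<nu> :: real^2.
    0 \<le> det2 \<nu> (normal \<alpha> \<beta> 1) \<and> 0 \<le> det2 \<nu> (normal \<alpha> \<beta> d) \<longrightarrow>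
    (let \<xi>1 = xi_fun d a (cone_scaled J \<theta> \<alpha>) (\<nu>$1);
         \<xi>2 = xi_fun d a (cone_scaled J \<theta> \<beta>) (\<nu>$2);
         P = polygon d \<alpha> \<beta> lam
     in \<exists>x1 x2 :: real \<times> real \<Rightarrow> real.
          (\<forall>p\<in>half_plane. (x1 has_derivative star_form \<xi>2 p) (at p)) \<and>
          (\<forall>p\<in>half_plane. (x2 has_derivative (\<lambda>v. - star_form \<xi>1 p v)) (at p)) \<and>
          diffeomorphism_betw (\<lambda>p. vector [x1 p, x2 p] :: real^2) half_plane (interior P) \<and>
          (\<exists>g u. conical_toric_scalar_flat_kaehler_metric d \<alpha> \<beta> lam (cone_param J \<theta>) g u \<and>
             (\<forall>H r. 0 < r \<longrightarrow>
                (u has_derivative (\<lambda>v. \<xi>1 H r * v$1 + \<xi>2 H r * v$2))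
                  (at (vector [x1 (H, r), x2 (H, r)])))))"
proof -
  define c where "c = cone_param J \<theta>"
  interpret mp: moment_polygon d \<alpha> \<beta> lam c
    using assms by unfold_locales (auto simp: c_def cone_param_def)
  have c: "c i = (if i \<in> J then \<theta> i else 1)" for i by (simp add: c_def cone_param_def)
  have AB: "cone_scaled J \<theta> \<alpha> = mp.A" "cone_scaled J \<theta> \<beta> = mp.B"
    using c by (auto simp: fun_eq_iff cone_scaled_def mp.A_def mp.B_def)
  show ?thesis
    unfolding AB c_def[symmetric] Let_def
  proof (intro exI[of _ mp.a] allI impI)
    \<comment> \<open>The witness \<open>mp.a\<close> is already fixed: it depends on the polygon
      and on c only.\<close>
    fix \<nu> :: "real^2"
    assume \<nu>: "0 \<le> det2 \<nu> (normal \<alpha> \<beta> 1) \<and> 0 \<le> det2 \<nu> (normal \<alpha> \<beta> d)"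
    interpret td: toric_data d mp.A mp.B mp.a mp.l "\<nu> $ 1" "\<nu> $ 2" mp.q1 mp.q2
      using mp.toric_data \<nu> by blast
    obtain u where u: "\<And>x. x \<in> td.U \<Longrightarrow> (u has_derivative (\<lambda>w. td.Xi1 x * w $ 1 + td.Xi2 x * w $ 2)) (at x)"
      using td.potential_exists by blast
    interpret tp: toric_potential d mp.A mp.B mp.a mp.l "\<nu> $ 1" "\<nu> $ 2" mp.q1 mp.q2 u
      using u by unfold_locales
    have ell: "ell \<alpha> \<beta> lam i x = c i * td.L i (x $ 1, x $ 2)" for i x
      by (simp add: mp.ell_scaled td.L_def)
    have P: "polygon d \<alpha> \<beta> lam = {x. \<forall>j\<in>{1..d}. 0 \<le> td.L j (x $ 1, x $ 2)}"
      unfolding polygon_def ell using mp.c_pos by (simp add: zero_le_mult_iff order.strict_implies_not_eq less_imp_le not_le[symmetric])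
    have int: "interior (polygon d \<alpha> \<beta> lam) = td.U" by (rule td.interior_polygon[OF P])
    define g :: "phase \<Rightarrow> phase \<Rightarrow> phase \<Rightarrow> real" where
      "g = (\<lambda>(x, t) (v, s) (w, z). \<Sum>i\<in>UNIV. \<Sum>j\<in>UNIV. hessian u x $ i $ j * v$i * w$j
           + matrix_inv (hessian u x) $ i $ j * s$i * z$j)"
    have bc: "boundary_condition d \<alpha> \<beta> lam c u"
      unfolding boundary_condition_def Let_def int ell
    proof
      fix p assume "p \<in> polygon d \<alpha> \<beta> lam"
      then have "tp.boundary_at c p {i \<in> {1..d}. td.L i (p $ 1, p $ 2) = 0}"
        by (intro tp.boundary_behaviour mp.c_pos) (auto simp: P)
      moreover have "{i \<in> {1..d}. c i * td.L i (p $ 1, p $ 2) = 0} = {i \<in> {1..d}. td.L i (p $ 1, p $ 2) = 0}"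
        using mp.c_pos by (auto simp: less_imp_neq[symmetric])
      ultimately show "(\<exists>V f. open V \<and> p \<in> V \<and> smooth_on V f \<and> (\<forall>x\<in>V \<inter> td.U. u x =
            (\<Sum>i\<in>{i \<in> {1..d}. c i * td.L i (p $ 1, p $ 2) = 0}.
              1 / (2 * c i) * (c i * td.L i (x $ 1, x $ 2)) * ln (c i * td.L i (x $ 1, x $ 2))) + f x)) \<and>
          (\<exists>\<delta>>0. ((\<lambda>x. det (hessian u x) * (\<Prod>i\<in>{i \<in> {1..d}. c i * td.L i (p $ 1, p $ 2) = 0}.
              c i * td.L i (x $ 1, x $ 2))) \<longlongrightarrow> \<delta>) (at p within td.U))"
        unfolding tp.boundary_at_def by simp
    qed
    have metric: "conical_toric_scalar_flat_kaehler_metric d \<alpha> \<beta> lam c g u"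
      unfolding conical_toric_scalar_flat_kaehler_metric_def toric_kaehler_metric_def int
      using tp.smooth_on_u tp.pos_def_hessian_u tp.scalar_flat_u bc by (simp add: g_def)
    let ?\<xi>1 = "xi_fun d mp.a mp.A (\<nu> $ 1)" and ?\<xi>2 = "xi_fun d mp.a mp.B (\<nu> $ 2)"
    have star: "(td.X1 has_derivative star_form ?\<xi>2 p) (at p)"
      "(td.X2 has_derivative (\<lambda>v. - star_form ?\<xi>1 p v)) (at p)" if "p \<in> half_plane" for p
    proof -
      have p: "0 < snd p" using that by (simp add: half_plane_iff)
      show "(td.X1 has_derivative star_form ?\<xi>2 p) (at p)"
        by (rule has_derivative_eq_rhs[OF td.X1_has_derivative[OF p]])
           (simp add: fun_eq_iff star_form_xi_fun[OF p td.d1])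
      show "(td.X2 has_derivative (\<lambda>v. - star_form ?\<xi>1 p v)) (at p)"
        by (rule has_derivative_eq_rhs[OF td.X2_has_derivative[OF p]])
           (simp add: fun_eq_iff star_form_xi_fun[OF p td.d1])
    qed
    have du: "(u has_derivative (\<lambda>v. ?\<xi>1 H r * v$1 + ?\<xi>2 H r * v$2))
        (at (vector [td.X1 (H, r), td.X2 (H, r)]))" if "0 < r" for H r
    proof -
      have "(H, r) \<in> half_plane" using that by (simp add: half_plane_iff)
      from u[OF td.hp_X(1)[OF this]] td.hp_X(2)[OF this] show ?thesis
        by (simp add: td.Xi1_def td.Xi2_def)
    qed
    show "\<exists>x1 x2 :: real \<times> real \<Rightarrow> real.
          (\<forall>p\<in>half_plane. (x1 has_derivative star_form ?\<xi>2 p) (at p)) \<and>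
          (\<forall>p\<in>half_plane. (x2 has_derivative (\<lambda>v. - star_form ?\<xi>1 p v)) (at p)) \<and>
          diffeomorphism_betw (\<lambda>p. vector [x1 p, x2 p] :: real^2) half_plane (interior (polygon d \<alpha> \<beta> lam)) \<and>
          (\<exists>g u. conical_toric_scalar_flat_kaehler_metric d \<alpha> \<beta> lam c g u \<and>
             (\<forall>H r. 0 < r \<longrightarrow>
                (u has_derivative (\<lambda>v. ?\<xi>1 H r * v$1 + ?\<xi>2 H r * v$2))
                  (at (vector [x1 (H, r), x2 (H, r)]))))"
      unfolding int
    proof (rule exI[of _ td.X1], rule exI[of _ td.X2], intro conjI ballI)
      show "\<exists>g u. conical_toric_scalar_flat_kaehler_metric d \<alpha> \<beta> lam c g u \<and>
             (\<forall>H r. 0 < r \<longrightarrow>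
                (u has_derivative (\<lambda>v. ?\<xi>1 H r * v$1 + ?\<xi>2 H r * v$2))
                  (at (vector [td.X1 (H, r), td.X2 (H, r)])))"
        by (intro exI[of _ g] exI[of _ u] conjI metric allI impI du)
    qed (rule star td.diffeomorphism_X; assumption)+
  qed
qed

end
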